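(* Consider either a sequence of weighted branching processes (Case 1) or a sequence of weighted branching trees (Case 2), with associated measures $\mu_n,\mu$ (and $\nu_n^*,\nu^*$ in Case 2), processes $\{W^{(n,j)}:j\ge0\}$, $n\ge1$, limiting process $\{W^{(j)}:j\ge0\}$ and constants $\rho_n,\rho$, all as defined in the context. Suppose that as $n\to\infty$, $$d_1(\mu_n,\mu)\to0\ \ (\text{Case 1})\qquad\text{or}\qquad d_1(\nu_n^*,\nu^* )+d_1(\mu_n,\mu)\to0\ \ (\text{Case 2}).$$ Then for any fixed $j\in\mathbb N$, the law of $W^{(n,j)}$ converges in $d_1$ to the law of $W^{(j)}$ as $n\to\infty$. Moreover, suppose in addition that $\rho>0$, that $Q^{(n)}=Q\equiv1$ for all $n$, and that all the weights are nonnegative ($C^{(n)}_i,C_i\ge 0$ for all $n,i$ in Case 1; $C^{(n)},C\ge0$ for all $n$ in Case 2). Then for any sequence $j_n\in\mathbb N$ with $j_n\to\infty$ and $$j_n\,d_1(\mu_n,\mu)\to0\ \ (\text{Case 1})\qquad\text{or}\qquad d_1(\nu_n^*,\nu^* )+j_n\,d_1(\mu_n,\mu)\to0\ \ (\text{Case 2})$$ as $n\to\infty$, we have the convergence in distribution $$\frac{W^{(n,j_n)}}{\rho_n^{j_n}}\Rightarrow\mathcal W\qquad\text{and}\qquad\frac{W^{(n,j_n)}}{\rho^{j_n}}\Rightarrow\mathcal W,$$ where $\mathcal W$ is the a.s. limit of the nonnegative martingale $W^{(j)}/\rho^j$ as $j\to\infty$.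
   Context: Kantorovich-Rubinstein distance: for probability measures $\mu,\nu$ on $\mathcal S=\mathbb R^d$ or $\mathcal S$ = the space of real sequences with finite $\ell_1$ norm, $d_1(\mu,\nu)=\inf E[\|\mathbf X-\mathbf Y\|_1]$ over all couplings $(\mathbf X,\mathbf Y)$ with $\mathbf X\sim\mu$, $\mathbf Y\sim\nu$; $\|\cdot\|_1$ is the $\ell_1$ norm. All measures to which $d_1$ is applied are assumed to have finite first moment $\int\|\mathbf x\|_1\,d\mu<\infty$. Trees: $\mathbb N=\{0,1,2,\dots\}$, $\mathbb N_+=\{1,2,\dots\}$, $U=\bigcup_{k\ge0}\mathbb N_+^k$, $\mathbb N_+^0=\{\emptyset\}$; $(\mathbf i,r)$ is concatenation. Given offspring numbers $N_{\mathbf i}$ and weights, $A_0=\{\emptyset\}$, $A_n=\{(\mathbf i,r):\mathbf i\in A_{n-1},1\le r\le N_{\mathbf i}\}$, $\Pi_\emptyset=1$, $\Pi_{(\mathbf i,r)}=C_{(\mathbf i,r)}\Pi_{\mathbf i}$, and $$W^{(0)}=Q_\emptyset,\qquad W^{(j)}=\sum_{\mathbf i\in A_j}Q_{\mathbf i}\Pi_{\mathbf i}\quad(j\ge1).$$ - Weighted branching process with generic branching vector $(Q,N,C_1,C_2,\dots)$, $N\in\mathbb N\cup\{\infty\}$: the vectors $(Q_{\mathbf i},N_{\mathbf i},C_{(\mathbf i,1)},C_{(\mathbf i,2)},\dots)$, $\mathbf i\in U$, are i.i.d. copies of the generic vector. - Weighted branching tree with generic branching vector $(Q,N,C)$, $N\in\mathbb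 N$: the vectors $(Q_{\mathbf i},N_{\mathbf i},C_{\mathbf i})$, $\mathbf i\in U$, are i.i.d. copies of the generic vector (so $C_{\mathbf i}$ may depend on $(Q_{\mathbf i},N_{\mathbf i})$). Case 1. For each $n$, $W^{(n,j)}$ denotes $W^{(j)}$ built on the weighted branching process with generic vector $(Q^{(n)},N^{(n)},C^{(n)}_1,C^{(n)}_2,\dots)$; $\mu_n$ is the law of $(Q^{(n)},C^{(n)}_11(N^{(n)}\ge1),C^{(n)}_21(N^{(n)}\ge2),\dots)$. The limit process $W^{(j)}$ is built on the weighted branching process with generic vector $(Q,N,C_1,C_2,\dots)$, and $\mu$ is the law of $(Q,C_11(N\ge1),C_21(N\ge2),\dots)$. Here $\rho_n=E[\sum_{i=1}^{N^{(n)}}|C^{(n)}_i|]$, $\rho=E[\sum_{i=1}^N|C_i|]$. Case 2. For each $n$, $W^{(n,j)}$ denotes $W^{(j)}$ built on the weighted branching tree with generic vector $(Q^{(n)},N^{(n)},C^{(n)})$; $\mu_n$ is the law of $(C^{(n)}Q^{(n)},C^{(n)}1(N^{(n)}\ge1),C^{(n)}1(N^{(n)}\ge2),\dots)$ and $\nu_n^*$ is the law of $(Q^{(n)},N^{(n)})$. The limit $\mu$ is the law of $(CQ,C1(N\ge1),C1(N\ge2),\dots)$ for some real random variable $C$ independent of a random vector $(Q,N)$, $N\in\mathbb N$; $\nu^*$ is the law of $(Q,N)$. The limit process $W^{(j)}$ is built on the weighted branching tree with generic vector $(Q,N,C)$ with $C$ independent of $(Q,N)$; equivalently, on the weighted branching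 process with generic vector $(Q,N,C_1,C_2,\dots)$ where the $C_i$ are i.i.d. copies of $C$ independent of $(Q,N)$. Here $\rho_n=E[N^{(n)}|C^{(n)}|]$, $\rho=E[N|C|]=E[N]E[|C|]$. *)

theory Defs
  imports "HOL-Probability.Probability"
begin

section \<open>The Kantorovich-Rubinstein distance\<close>

definition l1_vec :: "'a::euclidean_space \<Rightarrow> ennreal" where
  "l1_vec x = ennreal (\<Sum>b\<in>Basis. \<bar>x \<bullet> b\<bar>)"

definition l1_seq :: "(nat \<Rightarrow> real) \<Rightarrow> ennreal" where
  "l1_seq x = (\<Sum>k. ennreal \<bar>x k\<bar>)"

text \<open>
  Probability measures on the space of summable sequences are represented as probability measures
  on all real sequences, with the product sigma-algebra, whose first moment with respect to
  \<open>l1_seq\<close> is finite. Such measures give full mass to the summable sequences, and so do both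
  marginals of any coupling of two of them; on the summable sequences the product sigma-algebra is
  the Borel sigma-algebra of the (separable) norm.
\<close>

abbreviation seq_space :: "(nat \<Rightarrow> real) measure" where
  "seq_space \<equiv> PiM UNIV (\<lambda>_. borel)"

definition finite_first_moment :: "('a \<Rightarrow> ennreal) \<Rightarrow> 'a measure \<Rightarrow> bool" where
  "finite_first_moment l1 \<mu> \<longleftrightarrow> (\<integral>\<^sup>+ x. l1 x \<partial>\<mu>) < \<infinity>"

definition couplings :: "'a measure \<Rightarrow> 'b measure \<Rightarrow> ('a \<times> 'b) measure set" where
  "couplings \<mu> \<nu> = {\<gamma>. prob_space \<gamma> \<and> sets \<gamma> = sets (\<mu> \<Otimes>\<^sub>M \<nu>) \<and>
     distr \<gamma> \<mu> fst = \<mu> \<and> distr \<gamma> \<nu> snd = \<nu>}"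

definition d1 :: "('a::minus \<Rightarrow> ennreal) \<Rightarrow> 'a measure \<Rightarrow> 'a measure \<Rightarrow> ennreal" where
  "d1 l1 \<mu> \<nu> = (INF \<gamma>\<in>couplings \<mu> \<nu>. \<integral>\<^sup>+ z. l1 (fst z - snd z) \<partial>\<gamma>)"


section \<open>Trees, weights and the processes built on them\<close>

text \<open>Node labels: finite words over the positive integers; \<open>i @ [r]\<close> is the node \<open>(i, r)\<close>.\<close>

definition nodes :: "nat list set" where
  "nodes = {i. 0 \<notin> set i}"

primrec generation :: "(nat list \<Rightarrow> 'a \<Rightarrow> enat) \<Rightarrow> nat \<Rightarrow> 'a \<Rightarrow> nat list set" where
  "generation N 0 \<omega> = {[]}"
| "generation N (Suc n) \<omega> =
     {i @ [r] | i r. i \<in> generation N n \<omega> \<and> 1 \<le> r \<and> enat r \<le> N i \<omega>}"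

function path_weight :: "(nat list \<Rightarrow> 'a \<Rightarrow> real) \<Rightarrow> nat list \<Rightarrow> 'a \<Rightarrow> real" where
  "path_weight C [] \<omega> = 1"
| "path_weight C (i @ [r]) \<omega> = C (i @ [r]) \<omega> * path_weight C i \<omega>"
  by (auto, metis rev_exhaust)
termination
  by (relation "Wellfounded.measure (\<lambda>(C, i, \<omega>). length i)") auto

text \<open>
  A generation may be infinite when offspring numbers may be infinite; \<open>infsum\<close> is then the sum of
  an absolutely convergent series, and 0 if absolute convergence fails, which under finite first
  moments happens with probability zero.
\<close>

definition W :: "(nat list \<Rightarrow> 'a \<Rightarrow> real) \<Rightarrow> (nat list \<Rightarrow> 'a \<Rightarrow> enat) \<Rightarrow>
    (nat list \<Rightarrow> 'a \<Rightarrow> real) \<Rightarrow> nat \<Rightarrow> 'a \<Rightarrow> real" where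
  "W Q N C j \<omega> = (\<Sum>\<^sub>\<infinity>i\<in>generation N j \<omega>. Q i \<omega> * path_weight C i \<omega>)"

lemma W_0: "W Q N C 0 \<omega> = Q [] \<omega>"
  by (simp add: W_def)


section \<open>Weighted branching processes\<close>

text \<open>
  A generic branching vector enters only through its law \<open>G\<close>; its components are then the
  coordinates on the probability space \<open>G\<close>. In a point \<open>(q, m, c)\<close>, the value \<open>c r\<close> with
  \<open>r \<ge> 1\<close> is the weight of the \<open>r\<close>-th child.
\<close>

type_synonym wbp_vector = "real \<times> enat \<times> (nat \<Rightarrow> real)"

definition wbp_space :: "wbp_vector measure" where
  "wbp_space = borel \<Otimes>\<^sub>M count_space UNIV \<Otimes>\<^sub>M PiM {1..} (\<lambda>_. borel)"

definition weighted_branching_process :: "'a measure \<Rightarrow> wbp_vector measure \<Rightarrow>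
    (nat list \<Rightarrow> 'a \<Rightarrow> real) \<Rightarrow> (nat list \<Rightarrow> 'a \<Rightarrow> enat) \<Rightarrow> (nat list \<Rightarrow> 'a \<Rightarrow> real) \<Rightarrow> bool" where
  "weighted_branching_process M G Q N C \<longleftrightarrow>
     (let X = (\<lambda>i \<omega>. (Q i \<omega>, N i \<omega>, \<lambda>r\<in>{1..}. C (i @ [r]) \<omega>)) in
      prob_space M \<and> prob_space.indep_vars M (\<lambda>_. wbp_space) X nodes \<and>
      (\<forall>i\<in>nodes. distr M wbp_space (X i) = G))"

definition wbp_mu :: "wbp_vector measure \<Rightarrow> (nat \<Rightarrow> real) measure" where
  "wbp_mu G = distr G seq_space
     (\<lambda>(q, m, c) k. if k = 0 then q else if enat k \<le> m then c k else 0)"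

definition wbp_rho :: "wbp_vector measure \<Rightarrow> real" where
  "wbp_rho G = (\<integral>(q, m, c). (\<Sum>\<^sub>\<infinity>r\<in>{r. 1 \<le> r \<and> enat r \<le> m}. \<bar>c r\<bar>) \<partial>G)"


section \<open>Weighted branching trees\<close>

type_synonym wbt_vector = "real \<times> nat \<times> real"

definition wbt_space :: "wbt_vector measure" where
  "wbt_space = borel \<Otimes>\<^sub>M count_space UNIV \<Otimes>\<^sub>M borel"

definition weighted_branching_tree :: "'a measure \<Rightarrow> wbt_vector measure \<Rightarrow>
    (nat list \<Rightarrow> 'a \<Rightarrow> real) \<Rightarrow> (nat list \<Rightarrow> 'a \<Rightarrow> nat) \<Rightarrow> (nat list \<Rightarrow> 'a \<Rightarrow> real) \<Rightarrow> bool" where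
  "weighted_branching_tree M G Q N C \<longleftrightarrow>
     (let X = (\<lambda>i \<omega>. (Q i \<omega>, N i \<omega>, C i \<omega>)) in
      prob_space M \<and> prob_space.indep_vars M (\<lambda>_. wbt_space) X nodes \<and>
      (\<forall>i\<in>nodes. distr M wbt_space (X i) = G))"

text \<open>
  Independence of \<open>C\<close> and \<open>(Q, N)\<close>, as independence of the generated events;
  \<open>indep_var\<close> requires both variables to have the same type.
\<close>

definition wbt_weight_indep :: "wbt_vector measure \<Rightarrow> bool" where
  "wbt_weight_indep G \<longleftrightarrow> prob_space.indep_set G
     {(\<lambda>(q, m, c). c) -` A \<inter> space G | A. A \<in> sets borel}
     {(\<lambda>(q, m, c). (q, m)) -` B \<inter> space G | B. B \<in> sets (borel \<Otimes>\<^sub>M count_space UNIV)}"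

definition wbt_mu :: "wbt_vector measure \<Rightarrow> (nat \<Rightarrow> real) measure" where
  "wbt_mu G = distr G seq_space
     (\<lambda>(q, m, c) k. if k = 0 then c * q else if k \<le> m then c else 0)"

definition wbt_nu :: "wbt_vector measure \<Rightarrow> (real \<times> real) measure" where
  "wbt_nu G = distr G borel (\<lambda>(q, m, c). (q, real m))"

definition wbt_rho :: "wbt_vector measure \<Rightarrow> real" where
  "wbt_rho G = (\<integral>(q, m, c). real m * \<bar>c\<bar> \<partial>G)"

text \<open>The process \<open>W\<close> on a weighted branching tree, where all offspring numbers are finite.\<close>

abbreviation W_tree :: "(nat list \<Rightarrow> 'a \<Rightarrow> real) \<Rightarrow> (nat list \<Rightarrow> 'a \<Rightarrow> nat) \<Rightarrow>
    (nat list \<Rightarrow> 'a \<Rightarrow> real) \<Rightarrow> nat \<Rightarrow> 'a \<Rightarrow> real" where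
  "W_tree Q N C \<equiv> W Q (\<lambda>i \<omega>. enat (N i \<omega>)) C"

end

theory Submission
  imports Defs
begin

text \<open>
  Both cases are instances of one model: a tree whose nodes carry independent labels in the space
  of sequences, the root with law \<open>\<mu>0\<close> and all other nodes with law \<open>\<mu>\<close>. In Case 1 the label of \<open>i\<close>
  is \<open>(Q, C_1 1(N \<ge> 1), C_2 1(N \<ge> 2), \<dots>)\<close> and \<open>\<mu>0 = \<mu>\<close>. In Case 2 the weight of \<open>i\<close> is moved into
  its own label, \<open>(C Q, C 1(N \<ge> 1), C 1(N \<ge> 2), \<dots>)\<close>, and the root, which has no weight, is labelled
  \<open>(Q, 1(N \<ge> 1), 1(N \<ge> 2), \<dots>)\<close>; the root laws are then as close as the laws of \<open>(Q, N)\<close>.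

  Coupling the labels of two trees independently at every node and telescoping along paths bounds
  the \<open>L\<^sup>1\<close> distance of the sums over generation \<open>j\<close> by a constant times
  \<open>(c0 + j c) R ^ j\<close>, where \<open>c0\<close>, \<open>c\<close> are the costs of the couplings and \<open>R\<close> exceeds the limiting mean \<open>\<rho>\<close> by \<open>c\<close>.
  For fixed \<open>j\<close> this gives convergence in \<open>d1\<close>. If \<open>j c \<rightarrow> 0\<close>, the bound divided by \<open>\<rho> ^ j\<close> still
  vanishes, so the normalised sums inherit the limit of \<open>W j / \<rho> ^ j\<close>, which converges almost surely
  by Doob's theorem for nonnegative martingales.
\<close>

section \<open>Couplings and weak convergence\<close>

text \<open>Only first moments are assumed, so the limiting martingale need not converge in
  \<open>L^1\<close> and its limit may vanish. The two trees are therefore compared in the mean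
  within one generation, almost sure convergence is used for the limiting tree alone, and the two
  meet in expectations of bounded test functions. The factor \<open>j\<close> in the error arises
  because one label is changed per level; \<open>j c \<rightarrow> 0\<close> controls both this
  factor and \<open>(1 + c / \<rho>) ^ j\<close>.

  The processes may live on unrelated probability spaces, so the estimates are made for laws, on
  product spaces of labels.

  In Case 2 the labels have an exceptional root, and coordinate 0 is \<open>C Q\<close> rather than
  \<open>Q\<close>. This suits the coupling but not the martingale argument, which wants one label
  law with coordinate 0 equal to 1. For the limit, independence of \<open>C\<close> and
  \<open>(Q, N)\<close> permits a second labelling, where a node carries \<open>(Q, N)\<close> and
  the weights of its children: a Case 1 process with the same \<open>W\<close>, to which martingale
  convergence for Case 1 applies.\<close>

lemma measurable_from_sets_eq: "sets A = sets B \<Longrightarrow> f \<in> measurable B C \<Longrightarrow> f \<in> measurable A C"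
  by (subst measurable_cong_sets[OF _ refl])

lemma l1_vec_real: "l1_vec (x::real) = ennreal \<bar>x\<bar>"
  by (simp add: l1_vec_def)

lemma l1_vec_pair: "l1_vec (x :: real \<times> real) = ennreal (\<bar>fst x\<bar> + \<bar>snd x\<bar>)"
proof -
  have B: "(Basis :: (real \<times> real) set) = {(1, 0), (0, 1)}"
    by (auto simp: Basis_prod_def)
  show ?thesis
    unfolding l1_vec_def B by (simp add: inner_prod_def del: ennreal_plus)
qed

abbreviation cost :: "('a::minus \<Rightarrow> ennreal) \<Rightarrow> ('a \<times> 'a) measure \<Rightarrow> ennreal" where
  "cost l1 \<gamma> \<equiv> \<integral>\<^sup>+ z. l1 (fst z - snd z) \<partial>\<gamma>"

lemma couplingsD:
  assumes "\<gamma> \<in> couplings \<mu> \<nu>"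
  shows "prob_space \<gamma>" "sets \<gamma> = sets (\<mu> \<Otimes>\<^sub>M \<nu>)" "distr \<gamma> \<mu> fst = \<mu>" "distr \<gamma> \<nu> snd = \<nu>"
    "fst \<in> measurable \<gamma> \<mu>" "snd \<in> measurable \<gamma> \<nu>"
  using assms measurable_cong_sets[of \<gamma> "\<mu> \<Otimes>\<^sub>M \<nu>"] by (auto simp: couplings_def)

lemma pair_measure_in_couplings:
  assumes "prob_space \<mu>" "prob_space \<nu>"
  shows "\<mu> \<Otimes>\<^sub>M \<nu> \<in> couplings \<mu> \<nu>"
proof -
  interpret \<mu>: prob_space \<mu> by fact
  interpret \<nu>: prob_space \<nu> by fact
  interpret pair_prob_space \<mu> \<nu> ..
  have "distr (\<mu> \<Otimes>\<^sub>M \<nu>) \<nu> snd = \<nu>"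
  proof (intro measure_eqI)
    fix A assume A: "A \<in> sets (distr (\<mu> \<Otimes>\<^sub>M \<nu>) \<nu> snd)"
    then have "snd -` A \<inter> space (\<mu> \<Otimes>\<^sub>M \<nu>) = space \<mu> \<times> A"
      by (auto simp: space_pair_measure dest: sets.sets_into_space)
    with A show "emeasure (distr (\<mu> \<Otimes>\<^sub>M \<nu>) \<nu> snd) A = emeasure \<nu> A"
      by (simp add: emeasure_distr \<nu>.emeasure_pair_measure_Times \<mu>.emeasure_space_1)
  qed simp
  then show ?thesis
    unfolding couplings_def using prob_space_axioms by (simp add: \<nu>.distr_pair_fst)
qed

text \<open>No minimiser is used: a slack \<open>e\<close> above the infimum suffices, and when the
  infimum is infinite the product coupling will do.\<close>

lemma near_optimal_coupling:
  assumes "prob_space \<mu>" "prob_space \<nu>" "e > 0"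
  obtains \<gamma> where "\<gamma> \<in> couplings \<mu> \<nu>" "cost l1 \<gamma> \<le> d1 l1 \<mu> \<nu> + e"
proof (cases "d1 l1 \<mu> \<nu> = \<infinity>")
  case True
  then show ?thesis using pair_measure_in_couplings[OF assms(1,2)] that by simp
next
  case False
  then have "d1 l1 \<mu> \<nu> < d1 l1 \<mu> \<nu> + e"
    using \<open>e > 0\<close> by (cases "d1 l1 \<mu> \<nu>"; cases e) (auto simp: ennreal_less_iff simp flip: ennreal_plus)
  then show ?thesis
    using that unfolding d1_def INF_less_iff by (auto intro: less_imp_le)
qed

text \<open>Carries couplings of the laws of \<open>(Q, N)\<close> over to couplings of the root
  labels.\<close>

lemma couplings_distr:
  assumes \<gamma>: "\<gamma> \<in> couplings \<mu> \<nu>" and f: "f \<in> measurable \<mu> A" and g: "g \<in> measurable \<nu> B"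
  shows "distr \<gamma> (A \<Otimes>\<^sub>M B) (\<lambda>z. (f (fst z), g (snd z))) \<in> couplings (distr \<mu> A f) (distr \<nu> B g)"
proof -
  note [measurable] = f g couplingsD(5,6)[OF \<gamma>]
  have "distr \<gamma> A (\<lambda>z. f (fst z)) = distr (distr \<gamma> \<mu> fst) A f"
    by (simp add: distr_distr comp_def)
  moreover have "distr \<gamma> B (\<lambda>z. g (snd z)) = distr (distr \<gamma> \<nu> snd) B g"
    by (simp add: distr_distr comp_def)
  moreover have "distr (distr \<gamma> (A \<Otimes>\<^sub>M B) (\<lambda>z. (f (fst z), g (snd z)))) (distr \<mu> A f) fst = distr \<gamma> A (\<lambda>z. f (fst z))"
    by (subst distr_distr) (auto simp: comp_def intro!: distr_cong)
  moreover have "distr (distr \<gamma> (A \<Otimes>\<^sub>M B) (\<lambda>z. (f (fst z), g (snd z)))) (distr \<nu> B g) snd = distr \<gamma> B (\<lambda>z. g (snd z))"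
    by (subst distr_distr) (auto simp: comp_def intro!: distr_cong)
  moreover have "sets (distr \<gamma> (A \<Otimes>\<^sub>M B) (\<lambda>z. (f (fst z), g (snd z)))) = sets (distr \<mu> A f \<Otimes>\<^sub>M distr \<nu> B g)"
    unfolding sets_distr by (rule sets_pair_measure_cong) simp_all
  ultimately show ?thesis
    unfolding couplings_def mem_Collect_eq
    by (intro conjI prob_space.prob_space_distr couplingsD(1)[OF \<gamma>]) 
       (simp_all add: couplingsD(3,4)[OF \<gamma>])
qed

lemma d1_le_coupling: "\<gamma> \<in> couplings \<mu> \<nu> \<Longrightarrow> d1 l1 \<mu> \<nu> \<le> cost l1 \<gamma>"
  unfolding d1_def by (rule INF_lower)

lemma nn_integral_coupling_fst:
  assumes "\<gamma> \<in> couplings \<mu> \<nu>" "f \<in> borel_measurable \<mu>"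
  shows "(\<integral>\<^sup>+ z. f (fst z) \<partial>\<gamma>) = (\<integral>\<^sup>+ x. f x \<partial>\<mu>)"
proof -
  have "(\<integral>\<^sup>+ x. f x \<partial>\<mu>) = (\<integral>\<^sup>+ x. f x \<partial>distr \<gamma> \<mu> fst)"
    by (simp add: couplingsD(3)[OF assms(1)])
  then show ?thesis
    using couplingsD(5)[OF assms(1)] assms(2) by (simp add: nn_integral_distr)
qed

lemma nn_integral_coupling_snd:
  assumes "\<gamma> \<in> couplings \<mu> \<nu>" "f \<in> borel_measurable \<nu>"
  shows "(\<integral>\<^sup>+ z. f (snd z) \<partial>\<gamma>) = (\<integral>\<^sup>+ x. f x \<partial>\<nu>)"
proof -
  have "(\<integral>\<^sup>+ x. f x \<partial>\<nu>) = (\<integral>\<^sup>+ x. f x \<partial>distr \<gamma> \<nu> snd)"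
    by (simp add: couplingsD(4)[OF assms(1)])
  then show ?thesis
    using couplingsD(6)[OF assms(1)] assms(2) by (simp add: nn_integral_distr)
qed

text \<open>The scalings differ because one tree may be normalised by its own mean and the other by
  the limiting mean. Writing \<open>s x - t y = s (x - y) + (s - t) y\<close> separates the error of
  the coupling from that of the scaling; the latter costs the first moment of
  \<open>\<nu>\<close>.\<close>

lemma Lipschitz_integral_diff_le:
  fixes f :: "real \<Rightarrow> real"
  assumes \<mu>: "real_distribution \<mu>" and \<nu>: "real_distribution \<nu>" and \<gamma>: "\<gamma> \<in> couplings \<mu> \<nu>"
    and f: "f \<in> borel_measurable borel" "\<And>x. \<bar>f x\<bar> \<le> B" and L: "\<And>x y. \<bar>f x - f y\<bar> \<le> L * \<bar>x - y\<bar>" "L \<ge> 0"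
    and "s \<ge> 0"
  shows "ennreal \<bar>(\<integral>x. f (s * x) \<partial>\<mu>) - (\<integral>y. f (t * y) \<partial>\<nu>)\<bar> \<le>
    ennreal L * (ennreal s * cost l1_vec \<gamma> + ennreal \<bar>s - t\<bar> * (\<integral>\<^sup>+ y. l1_vec y \<partial>\<nu>))"
proof -
  interpret \<mu>: real_distribution \<mu> by fact
  interpret \<nu>: real_distribution \<nu> by fact
  interpret \<gamma>: prob_space \<gamma> using couplingsD[OF \<gamma>] by simp
  note [measurable] = f(1)
  have [measurable]: "fst \<in> borel_measurable \<gamma>" "snd \<in> borel_measurable \<gamma>"
    using couplingsD(5,6)[OF \<gamma>] by (simp_all cong: measurable_cong_sets)
  have int: "integrable \<gamma> (\<lambda>z. f (s * fst z))" "integrable \<gamma> (\<lambda>z. f (t * snd z))"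
    by (rule \<gamma>.integrable_const_bound[where B=B]; simp add: f)+
  have "(\<integral>x. f (s * x) \<partial>\<mu>) = (\<integral>x. f (s * x) \<partial>distr \<gamma> \<mu> fst)"
    by (simp add: couplingsD(3)[OF \<gamma>])
  also have "\<dots> = (\<integral>z. f (s * fst z) \<partial>\<gamma>)"
    by (subst integral_distr) (simp_all add: couplingsD(5)[OF \<gamma>])
  finally have 1: "(\<integral>x. f (s * x) \<partial>\<mu>) = (\<integral>z. f (s * fst z) \<partial>\<gamma>)" .
  have "(\<integral>x. f (t * x) \<partial>\<nu>) = (\<integral>x. f (t * x) \<partial>distr \<gamma> \<nu> snd)"
    by (simp add: couplingsD(4)[OF \<gamma>])
  also have "\<dots> = (\<integral>z. f (t * snd z) \<partial>\<gamma>)"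
    by (subst integral_distr) (simp_all add: couplingsD(6)[OF \<gamma>])
  finally have 2: "(\<integral>x. f (t * x) \<partial>\<nu>) = (\<integral>z. f (t * snd z) \<partial>\<gamma>)" .
  have "ennreal \<bar>(\<integral>x. f (s * x) \<partial>\<mu>) - (\<integral>y. f (t * y) \<partial>\<nu>)\<bar> = ennreal (norm (\<integral>z. f (s * fst z) - f (t * snd z) \<partial>\<gamma>))"
    using int by (simp add: 1 2)
  also have "\<dots> \<le> (\<integral>\<^sup>+ z. ennreal (norm (f (s * fst z) - f (t * snd z))) \<partial>\<gamma>)"
    by (rule integral_norm_bound_ennreal) (use int in auto)
  also have "\<dots> \<le> (\<integral>\<^sup>+ z. ennreal L * (ennreal s * l1_vec (fst z - snd z) + ennreal \<bar>s - t\<bar> * l1_vec (snd z)) \<partial>\<gamma>)"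
  proof (intro nn_integral_mono)
    fix z :: "real \<times> real"
    have "\<bar>f (s * fst z) - f (t * snd z)\<bar> \<le> L * \<bar>s * fst z - t * snd z\<bar>" by (rule L)
    also have "\<bar>s * fst z - t * snd z\<bar> = \<bar>s * (fst z - snd z) + (s - t) * snd z\<bar>"
      by (simp add: algebra_simps)
    also have "\<dots> \<le> s * \<bar>fst z - snd z\<bar> + \<bar>s - t\<bar> * \<bar>snd z\<bar>"
      by (rule order.trans[OF abs_triangle_ineq]) (simp add: abs_mult \<open>s \<ge> 0\<close>)
    finally have "\<bar>f (s * fst z) - f (t * snd z)\<bar> \<le> L * (s * \<bar>fst z - snd z\<bar> + \<bar>s - t\<bar> * \<bar>snd z\<bar>)"
      using L(2) by (simp add: mult_left_mono)
    then show "ennreal (norm (f (s * fst z) - f (t * snd z))) \<le> ennreal L * (ennreal s * l1_vec (fst z - snd z) + ennreal \<bar>s - t\<bar> * l1_vec (snd z))"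
      using L(2) \<open>s \<ge> 0\<close> by (simp add: l1_vec_real ennreal_mult[symmetric] ennreal_plus[symmetric] del: ennreal_plus)
  qed
  also have "\<dots> = ennreal L * (ennreal s * cost l1_vec \<gamma> + ennreal \<bar>s - t\<bar> * (\<integral>\<^sup>+ z. l1_vec (snd z) \<partial>\<gamma>))"
    unfolding l1_vec_real by (simp add: nn_integral_cmult nn_integral_add)
  also have "(\<integral>\<^sup>+ z. l1_vec (snd z) \<partial>\<gamma>) = (\<integral>\<^sup>+ y. l1_vec y \<partial>\<nu>)"
    by (rule nn_integral_coupling_snd[OF \<gamma>]) (simp add: l1_vec_real)
  finally show ?thesis .
qed

text \<open>\<open>cts_step\<close> is an affine function of slope \<open>- 1 / (b - a)\<close>
  clipped to \<open>[0, 1]\<close>, and clipping does not increase distances.\<close>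

lemma cts_step_Lipschitz:
  assumes "a < b"
  shows "\<bar>cts_step a b x - cts_step a b y\<bar> \<le> (1 / (b - a)) * \<bar>x - y\<bar>"
proof -
  have *: "cts_step a b x = min 1 (max 0 ((b - x) / (b - a)))" for x
    using assms by (auto simp: cts_step_def divide_simps min_def max_def)
  have "\<bar>min 1 (max 0 u) - min 1 (max 0 v)\<bar> \<le> \<bar>u - v\<bar>" for u v :: real by auto
  then have "\<bar>cts_step a b x - cts_step a b y\<bar> \<le> \<bar>(b - x) / (b - a) - (b - y) / (b - a)\<bar>"
    unfolding * .
  also have "\<dots> = \<bar>(y - x) / (b - a)\<bar>" by (simp add: diff_divide_distrib[symmetric])
  finally show ?thesis using assms by (simp add: abs_divide abs_minus_commute)
qed

text \<open>Weak convergence may be tested on the Lipschitz functions \<open>cts_step\<close>, for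
  which a cheap coupling makes the integrals close. \<open>conv\<close> concerns only the comparison
  laws \<open>\<nu> n\<close>; the martingale limit will enter there.\<close>

lemma weak_conv_m_of_coupling:
  assumes \<mu>: "\<And>n. real_distribution (\<mu> n)" and \<nu>: "\<And>n. real_distribution (\<nu> n)" and P: "real_distribution P"
    and \<gamma>: "\<And>n. \<gamma> n \<in> couplings (\<mu> n) (\<nu> n)" and s: "\<And>n. s n \<ge> 0"
    and lim: "(\<lambda>n. ennreal (s n) * cost l1_vec (\<gamma> n) + ennreal \<bar>s n - t n\<bar> * (\<integral>\<^sup>+ y. l1_vec y \<partial>\<nu> n)) \<longlonglongrightarrow> 0"
    and conv: "\<And>f :: real \<Rightarrow> real. continuous_on UNIV f \<Longrightarrow> (\<And>x. \<bar>f x\<bar> \<le> 1) \<Longrightarrow> (\<lambda>n. \<integral>y. f (t n * y) \<partial>\<nu> n) \<longlonglongrightarrow> (\<integral>y. f y \<partial>P)"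
  shows "weak_conv_m (\<lambda>n. distr (\<mu> n) borel (\<lambda>x. s n * x)) P"
proof (rule integral_cts_step_conv_imp_weak_conv)
  show "real_distribution (distr (\<mu> n) borel (\<lambda>x. s n * x))" for n
  proof -
    interpret real_distribution "\<mu> n" by (rule \<mu>)
    show ?thesis by (rule real_distribution_distr) simp
  qed
  fix x y :: real assume "x < y"
  let ?f = "cts_step x y" and ?L = "1 / (y - x)"
  have cont: "continuous_on UNIV ?f"
    using cts_step_uniformly_continuous[OF \<open>x < y\<close>] uniformly_continuous_imp_continuous by blast
  then have meas: "?f \<in> borel_measurable borel"
    by (rule borel_measurable_continuous_onI)
  have bdd: "\<bar>?f u\<bar> \<le> 1" for u using \<open>x < y\<close> by (auto simp: cts_step_def)
  have "(\<lambda>n. (\<integral>u. ?f (s n * u) \<partial>\<mu> n) - (\<integral>u. ?f (t n * u) \<partial>\<nu> n)) \<longlonglongrightarrow> 0"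
  proof (rule tendsto_rabs_zero_cancel)
    let ?D = "\<lambda>n. \<bar>(\<integral>u. ?f (s n * u) \<partial>\<mu> n) - (\<integral>u. ?f (t n * u) \<partial>\<nu> n)\<bar>"
    let ?E = "\<lambda>n. ennreal ?L * (ennreal (s n) * cost l1_vec (\<gamma> n) + ennreal \<bar>s n - t n\<bar> * (\<integral>\<^sup>+ y. l1_vec y \<partial>\<nu> n))"
    have "?E \<longlonglongrightarrow> ennreal ?L * 0"
      by (intro ennreal_tendsto_cmult lim) simp
    then have lim': "?E \<longlonglongrightarrow> 0" by (simp only: mult_zero_right)
    have "ennreal (?D n) \<le> ?E n" for n
      using \<open>x < y\<close>
      by (intro Lipschitz_integral_diff_le[OF \<mu> \<nu> \<gamma> meas bdd cts_step_Lipschitz]) (auto simp: s)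
    then have "\<forall>\<^sub>F n in sequentially. 0 \<le> ennreal (?D n)" "\<forall>\<^sub>F n in sequentially. ennreal (?D n) \<le> ?E n"
      by (simp_all only: zero_le eventually_True)
    then have "(\<lambda>n. ennreal (?D n)) \<longlonglongrightarrow> 0"
      by (rule tendsto_sandwich[OF _ _ tendsto_const lim'])
    then have "(\<lambda>n. ennreal (?D n)) \<longlonglongrightarrow> ennreal 0" by simp
    then show "?D \<longlonglongrightarrow> 0"
      by (subst (asm) tendsto_ennreal_iff) auto
  qed
  from tendsto_add[OF this conv[OF cont bdd]]
  have "(\<lambda>n. \<integral>u. ?f (s n * u) \<partial>\<mu> n) \<longlonglongrightarrow> (\<integral>u. ?f u \<partial>P)" by simp
  moreover have "(\<integral>u. ?f u \<partial>distr (\<mu> n) borel (\<lambda>x. s n * x)) = (\<integral>u. ?f (s n * u) \<partial>\<mu> n)" for n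
  proof -
    interpret real_distribution "\<mu> n" by (rule \<mu>)
    show ?thesis by (rule integral_distr) (use meas in auto)
  qed
  ultimately show "(\<lambda>n. \<integral>u. ?f u \<partial>distr (\<mu> n) borel (\<lambda>x. s n * x)) \<longlonglongrightarrow> (\<integral>u. ?f u \<partial>P)" by simp
qed (rule P)

section \<open>Almost sure convergence of nonnegative martingales\<close>

text \<open>
  The gains of the betting strategy that enters below \<open>a\<close> and leaves above \<open>b\<close> have mean zero, but
  each completed upcrossing earns \<open>b - a\<close>; so upcrossings are finite in number.
\<close>

primrec holding :: "real \<Rightarrow> real \<Rightarrow> (nat \<Rightarrow> real) \<Rightarrow> nat \<Rightarrow> bool" where
  "holding a b x 0 \<longleftrightarrow> x 0 < a"
| "holding a b x (Suc n) \<longleftrightarrow> x (Suc n) < a \<or> holding a b x n \<and> x (Suc n) < b"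

definition upcrossings :: "real \<Rightarrow> real \<Rightarrow> (nat \<Rightarrow> real) \<Rightarrow> nat \<Rightarrow> real" where
  "upcrossings a b x n = (\<Sum>k<n. of_bool (holding a b x k \<and> \<not> holding a b x (Suc k)))"

text \<open>The induction goes through because the left side also carries the open position, valued
  relative to \<open>a\<close>: it is negative on entry below \<open>a\<close>, and an exit at or
  above \<open>b\<close> turns it into at least \<open>b - a\<close>.\<close>

lemma upcrossings_gain:
  assumes "a < b"
  shows "(b - a) * upcrossings a b x n + of_bool (holding a b x n) * (x n - a)
    \<le> (\<Sum>k<n. of_bool (holding a b x k) * (x (Suc k) - x k))"
proof (induction n)
  case 0
  then show ?case by (simp add: upcrossings_def)
next
  case (Suc n)
  then show ?case using assms by (auto simp: upcrossings_def algebra_simps)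
qed

text \<open>If the exits stopped, a visit below \<open>a\<close> after the last one would start a
  position held forever, while a later value above \<open>b\<close> forces an exit.\<close>

lemma frequently_upcrosses:
  assumes "a < b" "\<exists>\<^sub>F n in sequentially. x n < a" "\<exists>\<^sub>F n in sequentially. x n > b"
  shows "infinite {k. holding a b x k \<and> \<not> holding a b x (Suc k)}"
proof
  assume "finite {k. holding a b x k \<and> \<not> holding a b x (Suc k)}"
  then obtain m where m: "\<And>k. k \<ge> m \<Longrightarrow> holding a b x k \<Longrightarrow> holding a b x (Suc k)"
    unfolding finite_nat_set_iff_bounded by (auto simp: not_less[symmetric])
  obtain n where n: "n \<ge> m" "x n < a"
    using assms(2) by (auto simp: frequently_sequentially)
  have "holding a b x n" using n by (cases n) auto
  have hold: "holding a b x k" if "n \<le> k" for k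
    using that
  proof (induction rule: dec_induct)
    case (step k)
    then show ?case using m[of k] n by simp
  qed fact
  obtain k where k: "n \<le> k" "b < x k"
    using assms(3) by (auto simp: frequently_sequentially)
  have "\<not> holding a b x k"
    using k(2) \<open>a < b\<close> by (cases k) auto
  with hold[OF k(1)] show False by contradiction
qed

text \<open>Doob's theorem, with the martingale property tested on sets of \<open>F n\<close>
  instead of through conditional expectations. Positive levels \<open>a\<close> are enough to
  separate liminf from limsup, because the values are nonnegative.\<close>

lemma nonneg_martingale_AE_convergent:
  fixes X :: "nat \<Rightarrow> 'a \<Rightarrow> real"
  assumes "prob_space M"
    and F: "\<And>n. subalgebra M (F n)" "\<And>m n. m \<le> n \<Longrightarrow> sets (F m) \<subseteq> sets (F n)"
    and X: "\<And>n. X n \<in> borel_measurable (F n)" "\<And>n. integrable M (X n)" "\<And>n \<omega>. 0 \<le> X n \<omega>"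
    and mart: "\<And>n A. A \<in> sets (F n) \<Longrightarrow> (\<integral>\<omega>. indicator A \<omega> * X (Suc n) \<omega> \<partial>M) = (\<integral>\<omega>. indicator A \<omega> * X n \<omega> \<partial>M)"
  shows "AE \<omega> in M. convergent (\<lambda>n. X n \<omega>)"
proof -
  interpret prob_space M by fact
  have sp: "space (F n) = space M" for n using F(1) by (auto simp: subalgebra_def)
  have XF: "X m \<in> borel_measurable (F n)" if "m \<le> n" for m n
    using X(1)[of m] F(2)[OF that] sp unfolding measurable_def by (auto simp: sp)
  have [measurable]: "X n \<in> borel_measurable M" for n
    using X(2) by auto
  let ?hold = "\<lambda>a b n. {\<omega>\<in>space M. holding a b (\<lambda>k. X k \<omega>) n}"
  \<comment> \<open>The position kept from time \<open>n\<close> to \<open>n + 1\<close> is decided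
    at time \<open>n\<close>; this is what allows the martingale identity to be applied to
    it.\<close>
  have hold: "?hold a b n \<in> sets (F n)" for a b n
  proof (induction n)
    case 0
    have "{\<omega>\<in>space (F 0). X 0 \<omega> < a} \<in> sets (F 0)" using X(1)[of 0] by measurable
    then show ?case by (simp add: sp)
  next
    case (Suc n)
    let ?below = "\<lambda>a. {\<omega>\<in>space (F (Suc n)). X (Suc n) \<omega> < a}"
    have [measurable]: "X (Suc n) \<in> borel_measurable (F (Suc n))" by (rule X)
    have [measurable]: "?hold a b n \<in> sets (F (Suc n))"
      using Suc F(2)[of n "Suc n"] by auto
    have "?below a \<union>
       (?hold a b n \<inter> ?below b) \<in> sets (F (Suc n))"
      by (intro sets.Un sets.Int) measurable
    also have "?below a \<union>
       (?hold a b n \<inter> ?below b)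
       = ?hold a b (Suc n)"
      by (auto simp: sp)
    finally show ?case .
  qed
  then have hold_M: "?hold a b n \<in> sets M" for a b n
    using F(1)[of n] by (auto simp: subalgebra_def)
  then have [measurable]: "Measurable.pred M (\<lambda>\<omega>. holding a b (\<lambda>k. X k \<omega>) n)" for a b n
    by (simp add: pred_def)
  \<comment> \<open>The gains have mean 0, and by nonnegativity an open position is worth at least
    \<open>- a\<close>; hence the expected number of completed upcrossings is at most
    \<open>a / (b - a)\<close>.\<close>
  have finite_upcrossings: "AE \<omega> in M. finite {k. holding a b (\<lambda>k. X k \<omega>) k \<and> \<not> holding a b (\<lambda>k. X k \<omega>) (Suc k)}"
    if "a < b" "0 < a" for a b
  proof -
    let ?H = "\<lambda>k \<omega>. holding a b (\<lambda>k. X k \<omega>) k"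
    let ?U = "\<lambda>n \<omega>. upcrossings a b (\<lambda>k. X k \<omega>) n"
    let ?gain = "\<lambda>n \<omega>. \<Sum>k<n. of_bool (?H k \<omega>) * (X (Suc k) \<omega> - X k \<omega>)"
    let ?I = "\<lambda>k \<omega>. of_bool (?H k \<omega> \<and> \<not> ?H (Suc k) \<omega>) :: real"
    have intH: "integrable M (\<lambda>\<omega>. of_bool (?H k \<omega>) * X n \<omega>)" for k n
      by (rule Bochner_Integration.integrable_bound[OF X(2)[of n]]) (auto)
    have gain0: "(\<integral>\<omega>. ?gain n \<omega> \<partial>M) = 0" for n
    proof -
      have "(\<integral>\<omega>. of_bool (?H k \<omega>) * X m \<omega> \<partial>M) = (\<integral>\<omega>. indicator {\<omega>\<in>space M. ?H k \<omega>} \<omega> * X m \<omega> \<partial>M)" for k m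
        by (rule Bochner_Integration.integral_cong) (auto simp: indicator_def)
      with mart[OF hold] show ?thesis
        by (simp add: right_diff_distrib intH)
    qed
    have "(\<integral>\<^sup>+ \<omega>. (\<Sum>k. ennreal (?I k \<omega>)) \<partial>M) \<le> ennreal (a / (b - a))"
    proof -
      have "(\<integral>\<^sup>+ \<omega>. (\<Sum>k. ennreal (?I k \<omega>)) \<partial>M) = (\<Sum>k. \<integral>\<^sup>+ \<omega>. ennreal (?I k \<omega>) \<partial>M)"
        by (rule nn_integral_suminf) measurable
      also have "\<dots> \<le> ennreal (a / (b - a))"
        unfolding suminf_eq_SUP
      proof (rule SUP_least)
        fix n
        have intI: "integrable M (\<lambda>\<omega>. ?U n \<omega>)"
          unfolding upcrossings_def
          by (intro Bochner_Integration.integrable_sum integrable_const_bound[where B=1]) auto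
        have "(b - a) * (\<integral>\<omega>. ?U n \<omega> \<partial>M) = (\<integral>\<omega>. (b - a) * ?U n \<omega> \<partial>M)"
          by simp
        also have "\<dots> \<le> (\<integral>\<omega>. ?gain n \<omega> + a \<partial>M)"
        proof (intro integral_mono)
          fix \<omega>
          have "- a \<le> of_bool (?H n \<omega>) * (X n \<omega> - a)" using X(3)[of n \<omega>] \<open>0 < a\<close> by auto
          with upcrossings_gain[OF \<open>a < b\<close>, of "\<lambda>k. X k \<omega>" n]
          show "(b - a) * ?U n \<omega> \<le> ?gain n \<omega> + a"
            by linarith
        qed (use intI in \<open>auto simp: right_diff_distrib intH\<close>)
        also have "\<dots> = (\<integral>\<omega>. ?gain n \<omega> \<partial>M) + a"
          by (subst Bochner_Integration.integral_add) (auto simp: right_diff_distrib intH prob_space)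
        finally have *: "(b - a) * (\<integral>\<omega>. ?U n \<omega> \<partial>M) \<le> a"
          unfolding gain0 by simp
        have "(\<Sum>k<n. \<integral>\<^sup>+ \<omega>. ennreal (?I k \<omega>) \<partial>M) = (\<integral>\<^sup>+ \<omega>. (\<Sum>k<n. ennreal (?I k \<omega>)) \<partial>M)"
          by (rule nn_integral_sum[symmetric]) measurable
        also have "\<dots> = (\<integral>\<^sup>+ \<omega>. ennreal (?U n \<omega>) \<partial>M)"
          unfolding upcrossings_def by (subst sum_ennreal) simp_all
        also have "\<dots> = ennreal (\<integral>\<omega>. ?U n \<omega> \<partial>M)"
          by (rule nn_integral_eq_integral[OF intI]) (auto simp: upcrossings_def intro!: sum_nonneg)
        also have "\<dots> \<le> ennreal (a / (b - a))"
          using * \<open>a < b\<close> by (intro ennreal_leI) (simp add: field_simps)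
        finally show "(\<Sum>k<n. \<integral>\<^sup>+ \<omega>. ennreal (?I k \<omega>) \<partial>M) \<le> ennreal (a / (b - a))" .
      qed
      finally show ?thesis .
    qed
    then have "(\<integral>\<^sup>+ \<omega>. (\<Sum>k. ennreal (?I k \<omega>)) \<partial>M) \<noteq> \<infinity>"
      by (auto simp: top_unique)
    then have "AE \<omega> in M. (\<Sum>k. ennreal (?I k \<omega>)) \<noteq> \<infinity>"
      by (intro nn_integral_noteq_infinite) measurable
    then show ?thesis
    proof eventually_elim
      case (elim \<omega>)
      then have "summable (\<lambda>k. ?I k \<omega>)"
        by (intro summable_suminf_not_top) auto
      then have "(\<lambda>k. ?I k \<omega>) \<longlonglongrightarrow> 0" by (rule summable_LIMSEQ_zero)
      then have "\<forall>\<^sub>F k in sequentially. \<bar>?I k \<omega>\<bar> < 1"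
        by (auto dest!: order_tendstoD(2)[OF tendsto_rabs, of _ 0 _ 1])
      then have "\<forall>\<^sub>F k in sequentially. \<not> (?H k \<omega> \<and> \<not> ?H (Suc k) \<omega>)"
        by eventually_elim auto
      then show ?case
        unfolding cofinite_eq_sequentially[symmetric] eventually_cofinite not_not .
    qed
  qed
  have "AE \<omega> in M. \<forall>a\<in>\<rat>. \<forall>b\<in>\<rat>. 0 < a \<longrightarrow> a < b \<longrightarrow>
      finite {k. holding a b (\<lambda>k. X k \<omega>) k \<and> \<not> holding a b (\<lambda>k. X k \<omega>) (Suc k)}"
    by (intro AE_ball_countable[THEN iffD2] ballI countable_rat AE_impI finite_upcrossings)
  \<comment> \<open>Fatou's lemma and the constant mean exclude \<open>\<infinity>\<close> as the
    common value of liminf and limsup.\<close>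
  moreover have "AE \<omega> in M. liminf (\<lambda>n. ennreal (X n \<omega>)) \<noteq> \<infinity>"
  proof (intro nn_integral_noteq_infinite)
    have "(\<integral>\<omega>. X n \<omega> \<partial>M) = (\<integral>\<omega>. X 0 \<omega> \<partial>M)" for n
    proof (induction n)
      case (Suc n)
      have "(\<integral>\<omega>. indicator (space M) \<omega> * X m \<omega> \<partial>M) = (\<integral>\<omega>. X m \<omega> \<partial>M)" for m
        by (rule Bochner_Integration.integral_cong) auto
      with mart[OF sets.top[of "F n"]] Suc show ?case by (simp add: sp)
    qed simp
    then have "(\<integral>\<^sup>+ \<omega>. ennreal (X n \<omega>) \<partial>M) = ennreal (\<integral>\<omega>. X 0 \<omega> \<partial>M)" for n
      using nn_integral_eq_integral[OF X(2)[of n]] X(3) by simp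
    then have "(\<integral>\<^sup>+ \<omega>. liminf (\<lambda>n. ennreal (X n \<omega>)) \<partial>M) \<le> ennreal (\<integral>\<omega>. X 0 \<omega> \<partial>M)"
      using nn_integral_liminf[of "\<lambda>n \<omega>. ennreal (X n \<omega>)" M] by (simp add: Liminf_const)
    then show "(\<integral>\<^sup>+ \<omega>. liminf (\<lambda>n. ennreal (X n \<omega>)) \<partial>M) \<noteq> \<infinity>"
      by (auto simp: top_unique)
  qed measurable
  ultimately show ?thesis
  proof eventually_elim
    case (elim \<omega>)
    \<comment> \<open>In \<open>ennreal\<close> liminf and limsup exist without any boundedness; a
      gap between them contains two rational levels that are crossed infinitely often.\<close>
    let ?x = "\<lambda>n. ennreal (X n \<omega>)"
    have eq: "liminf ?x = limsup ?x"
    proof (rule ccontr)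
      assume "liminf ?x \<noteq> limsup ?x"
      then have less: "liminf ?x < limsup ?x"
        using Liminf_le_Limsup[of sequentially ?x] by simp
      then obtain u where u: "liminf ?x < u" "u < limsup ?x" using dense by blast
      then obtain v where v: "u < v" "v < limsup ?x" using dense by blast
      have fin: "u < \<infinity>" "v < \<infinity>" using u v by (auto intro: less_le_trans simp: less_top[symmetric])
      then obtain u' v' where uv': "u = ennreal u'" "v = ennreal v'" "0 \<le> u'" "0 \<le> v'"
        by (cases u; cases v) auto
      with v have "u' < v'" by (simp add: ennreal_less_iff)
      then obtain a where a: "a \<in> \<rat>" "u' < a" "a < v'" using Rats_dense_in_real by blast
      then obtain b where b: "b \<in> \<rat>" "a < b" "b < v'" using Rats_dense_in_real by blast
      have "\<exists>\<^sub>F n in sequentially. ?x n < ennreal a"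
      proof (rule ccontr)
        assume "\<not> ?thesis"
        then have "\<forall>\<^sub>F n in sequentially. ennreal a \<le> ?x n" by (simp add: not_frequently not_less)
        then have "ennreal a \<le> liminf ?x" by (rule Liminf_bounded)
        moreover have "liminf ?x < ennreal a"
          using u(1) a uv' by (auto intro: less_trans[of _ u] simp: ennreal_less_iff)
        ultimately show False by simp
      qed
      then have 1: "\<exists>\<^sub>F n in sequentially. X n \<omega> < a"
        by (rule frequently_elim1) (simp add: ennreal_less_iff X)
      have "\<exists>\<^sub>F n in sequentially. ?x n > ennreal b"
      proof (rule ccontr)
        assume "\<not> ?thesis"
        then have "\<forall>\<^sub>F n in sequentially. ?x n \<le> ennreal b" by (simp add: not_frequently not_less)
        then have "limsup ?x \<le> ennreal b" by (rule Limsup_bounded)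
        moreover have "ennreal b < limsup ?x"
          using v(2) a b uv' by (auto intro: less_trans[of _ v] simp: ennreal_less_iff)
        ultimately show False by simp
      qed
      then have 2: "\<exists>\<^sub>F n in sequentially. X n \<omega> > b"
        by (rule frequently_elim1) (use a b uv' in \<open>simp add: ennreal_less_iff\<close>)
      from frequently_upcrosses[OF b(2) 1 2] elim(1) a b uv'(3) show False by auto
    qed
    then have "?x \<longlonglongrightarrow> liminf ?x"
      by (simp add: tendsto_iff_Liminf_eq_Limsup)
    moreover obtain l where "liminf ?x = ennreal l" "l \<ge> 0"
      using elim(2) by (cases "liminf ?x") auto
    ultimately have "(\<lambda>n. X n \<omega>) \<longlonglongrightarrow> l"
      by (simp add: X)
    then show ?case by (rule convergentI)
  qed
qed

section \<open>Trees with independent labels\<close>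

text \<open>Sums over a random generation become sums over this fixed set: a word outside the
  generation passes through a weight 0.\<close>

definition words :: "nat \<Rightarrow> nat list set" where
  "words j = {s \<in> nodes. length s = j}"

lemma nodes_simps [simp]: "[] \<in> nodes" "r # s \<in> nodes \<longleftrightarrow> r \<noteq> 0 \<and> s \<in> nodes"
    "s @ t \<in> nodes \<longleftrightarrow> s \<in> nodes \<and> t \<in> nodes"
  by (auto simp: nodes_def)

lemma words_0 [simp]: "words 0 = {[]}"
  by (auto simp: words_def)

lemma bij_betw_words_Suc: "bij_betw (\<lambda>(r, s). Suc r # s) (UNIV \<times> words j) (words (Suc j))"
  unfolding bij_betw_def
proof
  show "(\<lambda>(r, s). Suc r # s) ` (UNIV \<times> words j) = words (Suc j)"
  proof (intro equalityI subsetI)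
    fix t assume "t \<in> words (Suc j)"
    then obtain r s where "t = r # s" "r \<noteq> 0" "s \<in> words j"
      by (auto simp: words_def length_Suc_conv)
    then show "t \<in> (\<lambda>(r, s). Suc r # s) ` (UNIV \<times> words j)"
      by (intro image_eqI[of _ _ "(r - 1, s)"]) auto
  qed (auto simp: words_def)
qed (auto simp: inj_on_def)

text \<open>The first letter is split off because the estimates recurse into the subtrees of the
  children; the martingale argument will split off the last letter.\<close>

lemma nn_integral_words_Suc:
  "(\<integral>\<^sup>+ t. f t \<partial>count_space (words (Suc j))) = (\<Sum>r. \<integral>\<^sup>+ s. f (Suc r # s) \<partial>count_space (words j))"
proof -
  have "(\<integral>\<^sup>+ t. f t \<partial>count_space (words (Suc j))) =
      (\<integral>\<^sup>+ x. f (case x of (r, s) \<Rightarrow> Suc r # s) \<partial>count_space (UNIV \<times> words j))"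
    by (rule nn_integral_bij_count_space[OF bij_betw_words_Suc, symmetric])
  also have "\<dots> = (\<integral>\<^sup>+ x. f (case x of (r, s) \<Rightarrow> Suc r # s) \<partial>(count_space UNIV \<Otimes>\<^sub>M count_space (words j)))"
    by (simp add: pair_measure_countable)
  also have "\<dots> = (\<integral>\<^sup>+ r. \<integral>\<^sup>+ s. f (Suc r # s) \<partial>count_space (words j) \<partial>count_space UNIV)"
    by (subst sigma_finite_measure.nn_integral_fst[symmetric])
       (auto simp: sigma_finite_measure_count_space_countable pair_measure_countable)
  finally show ?thesis by (simp add: nn_integral_count_space_nat)
qed

text \<open>
  Coordinate 0 of a label plays the role of \<open>Q\<close>, coordinate \<open>r \<ge> 1\<close> that of the weight passed
  to the \<open>r\<close>-th child, which is 0 if there are fewer children.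
\<close>

primrec path_prod :: "(nat list \<Rightarrow> nat \<Rightarrow> real) \<Rightarrow> nat list \<Rightarrow> nat list \<Rightarrow> real" where
  "path_prod v p [] = 1"
| "path_prod v p (r # s) = v p r * path_prod v (p @ [r]) s"

definition contribution :: "(nat list \<Rightarrow> nat \<Rightarrow> real) \<Rightarrow> nat list \<Rightarrow> nat list \<Rightarrow> real" where
  "contribution v p s = path_prod v p s * v (p @ s) 0"

lemma contribution_simps [simp]:
  "contribution v p [] = v p 0"
  "contribution v p (r # s) = v p r * contribution v (p @ [r]) s"
  by (simp_all add: contribution_def)

lemma path_prod_snoc: "path_prod v p (s @ [r]) = path_prod v p s * v (p @ s) r"
  by (induction s arbitrary: p) auto

text \<open>The Bochner integral over the counting measure is 0 when the sum does not converge
  absolutely, which is the convention that \<open>infsum\<close> brings into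
  \<open>W\<close>.\<close>

definition tree_sum :: "nat \<Rightarrow> (nat list \<Rightarrow> nat \<Rightarrow> real) \<Rightarrow> real" where
  "tree_sum j v = (\<integral>s. contribution v [] s \<partial>count_space (words j))"

text \<open>Real families are summable exactly when they are absolutely summable, so both sides take
  the default value 0 together.\<close>

lemma infsum_eq_integral_count_space:
  fixes f :: "'a \<Rightarrow> real"
  shows "infsum f A = (\<integral>s. f s \<partial>count_space A)"
proof (cases "Infinite_Set_Sum.abs_summable_on f A")
  case True
  then show ?thesis
    using infsetsum_infsum[OF True] by (simp add: infsetsum_def)
next
  case False
  then have "\<not> f summable_on A"
    using summable_on_iff_abs_summable_on_real abs_summable_equivalent by blast
  with False show ?thesis
    unfolding abs_summable_on_def by (simp add: not_integrable_integral_eq infsum_not_exists)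
qed

text \<open>The sum of the absolute contributions of the words of length \<open>j\<close> below
  \<open>p\<close>, as a recursion in which each step separates the label of \<open>p\<close> from
  the labels strictly below it.\<close>

primrec abs_total :: "(nat list \<Rightarrow> nat \<Rightarrow> real) \<Rightarrow> nat list \<Rightarrow> nat \<Rightarrow> ennreal" where
  "abs_total v p 0 = ennreal \<bar>v p 0\<bar>"
| "abs_total v p (Suc j) = (\<Sum>r. ennreal \<bar>v p (Suc r)\<bar> * abs_total v (p @ [Suc r]) j)"

text \<open>Telescoping along a path: the labels of \<open>v\<close> above the node where the two trees are compared, those of \<open>w\<close> below it.\<close>

primrec diff_total :: "(nat list \<Rightarrow> nat \<Rightarrow> real) \<Rightarrow> (nat list \<Rightarrow> nat \<Rightarrow> real) \<Rightarrow> nat list \<Rightarrow> nat \<Rightarrow> ennreal" where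
  "diff_total v w p 0 = ennreal \<bar>v p 0 - w p 0\<bar>"
| "diff_total v w p (Suc j) = (\<Sum>r. ennreal \<bar>v p (Suc r) - w p (Suc r)\<bar> * abs_total w (p @ [Suc r]) j
     + ennreal \<bar>v p (Suc r)\<bar> * diff_total v w (p @ [Suc r]) j)"

text \<open>The total at \<open>p\<close> reads only labels at depth \<open>length p\<close> or
  more. Applied to a child of a node, this makes the total of the child's subtree independent of the
  label of the node.\<close>

lemma abs_total_fun_upd: "length i < length p \<Longrightarrow> abs_total (v(i := x)) p j = abs_total v p j"
proof (induction j arbitrary: p)
  case (Suc j)
  then have "i \<noteq> p" by auto
  with Suc show ?case by simp
qed auto

lemma diff_total_fun_upd: "length i < length p \<Longrightarrow> diff_total (v(i := x)) (w(i := y)) p j = diff_total v w p j"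
proof (induction j arbitrary: p)
  case (Suc j)
  then have "p \<noteq> i" by auto
  moreover from Suc.prems have "length i < length (p @ [Suc r])" for r by simp
  ultimately show ?case
    using Suc.IH abs_total_fun_upd[of i _ w y j] by (simp del: fun_upd_apply add: fun_upd_other)
qed auto

lemma nn_integral_abs_contribution:
  "(\<integral>\<^sup>+ s. ennreal \<bar>contribution v p s\<bar> \<partial>count_space (words j)) = abs_total v p j"
  by (induction j arbitrary: p)
     (auto simp: nn_integral_words_Suc nn_integral_count_space_finite abs_mult ennreal_mult nn_integral_cmult)

lemma nn_integral_diff_contribution:
  "(\<integral>\<^sup>+ s. ennreal \<bar>contribution v p s - contribution w p s\<bar> \<partial>count_space (words j)) \<le> diff_total v w p j"
proof (induction j arbitrary: p)
  case 0
  then show ?case by (simp add: nn_integral_count_space_finite)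
next
  case (Suc j)
  show ?case
    unfolding nn_integral_words_Suc diff_total.simps
  proof (intro suminf_le summableI)
    fix r
    let ?d = "\<lambda>s. ennreal \<bar>contribution v p (Suc r # s) - contribution w p (Suc r # s)\<bar>"
    let ?b = "\<lambda>s. ennreal \<bar>v p (Suc r) - w p (Suc r)\<bar> * ennreal \<bar>contribution w (p @ [Suc r]) s\<bar>
        + ennreal \<bar>v p (Suc r)\<bar> * ennreal \<bar>contribution v (p @ [Suc r]) s - contribution w (p @ [Suc r]) s\<bar>"
    let ?t = "ennreal \<bar>v p (Suc r) - w p (Suc r)\<bar> * abs_total w (p @ [Suc r]) j
      + ennreal \<bar>v p (Suc r)\<bar> * diff_total v w (p @ [Suc r]) j"
    have "(\<integral>\<^sup>+ s. ?d s \<partial>count_space (words j)) \<le>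
       (\<integral>\<^sup>+ s. ?b s \<partial>count_space (words j))"
    proof (intro nn_integral_mono)
      fix s
      define a b x y where "a = v p (Suc r)" "b = w p (Suc r)" "x = contribution v (p @ [Suc r]) s"
        "y = contribution w (p @ [Suc r]) s"
      have "a * x - b * y = (a - b) * y + a * (x - y)" by (simp add: algebra_simps)
      then have "\<bar>a * x - b * y\<bar> \<le> \<bar>a - b\<bar> * \<bar>y\<bar> + \<bar>a\<bar> * \<bar>x - y\<bar>"
        by (metis abs_mult abs_triangle_ineq)
      then show "?d s \<le>
        ?b s"
        by (simp add: a_b_x_y_def flip: ennreal_mult ennreal_plus)
    qed
    also have "\<dots> \<le> ?t"
      using Suc by (simp add: nn_integral_add nn_integral_cmult nn_integral_abs_contribution mult_left_mono)
    finally show "(\<integral>\<^sup>+ s. ?d s \<partial>count_space (words j)) \<le>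
      ?t" .
  qed
qed

lemma abs_tree_sum_le: "ennreal \<bar>tree_sum j v\<bar> \<le> abs_total v [] j"
proof (cases "integrable (count_space (words j)) (contribution v [])")
  case True
  from integral_norm_bound_ennreal[OF True] show ?thesis
    by (simp add: tree_sum_def nn_integral_abs_contribution)
qed (simp add: tree_sum_def not_integrable_integral_eq)

text \<open>Finiteness of both totals lets the difference of the sums be written as one absolutely
  convergent sum, to which the termwise telescoping applies.\<close>

lemma tree_sum_diff_le:
  assumes "abs_total v [] j < \<infinity>" "abs_total w [] j < \<infinity>"
  shows "ennreal \<bar>tree_sum j v - tree_sum j w\<bar> \<le> diff_total v w [] j"
proof -
  have int: "integrable (count_space (words j)) (contribution u [])" if "abs_total u [] j < \<infinity>" for u
    using that by (intro integrableI_bounded) (simp_all add: nn_integral_abs_contribution)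
  have "ennreal \<bar>tree_sum j v - tree_sum j w\<bar> = ennreal (norm (\<integral>s. contribution v [] s - contribution w [] s \<partial>count_space (words j)))"
    using assms int by (simp add: tree_sum_def)
  also have "\<dots> \<le> (\<integral>\<^sup>+ s. ennreal (norm (contribution v [] s - contribution w [] s)) \<partial>count_space (words j))"
    by (rule integral_norm_bound_ennreal) (use assms int in auto)
  finally show ?thesis
    using nn_integral_diff_contribution[where v = v and w = w and p = "[]" and j = j] by simp
qed

section \<open>The product law of the labels and one-step recursions for the means\<close>

definition tree_law :: "'x measure \<Rightarrow> 'x measure \<Rightarrow> (nat list \<Rightarrow> 'x) measure" where
  "tree_law M0 M = PiM nodes (\<lambda>i. if i = [] then M0 else M)"

lemma prob_space_tree_law: "prob_space M0 \<Longrightarrow> prob_space M \<Longrightarrow> prob_space (tree_law M0 M)"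
  unfolding tree_law_def by (intro prob_space_PiM) auto

lemma measurable_tree_law_component:
  assumes "f \<in> measurable N (tree_law M0 M)" "i \<in> nodes" "sets M0 = sets M"
  shows "(\<lambda>x. f x i) \<in> measurable N M"
proof -
  have "(\<lambda>x. f x i) \<in> measurable N (if i = [] then M0 else M)"
    using measurable_compose[OF assms(1)[unfolded tree_law_def] measurable_component_singleton[OF assms(2)]] .
  then show ?thesis
    using measurable_cong_sets[OF refl assms(3), of N] by (cases "i = []") simp_all
qed

text \<open>Replacing one coordinate of a product by an independent copy preserves the law. Since
  \<open>insert i nodes = nodes\<close>, the rule for adjoining a coordinate becomes this
  resampling, and the index set need not be split.\<close>

lemma nn_integral_tree_law_resample:
  assumes "prob_space M0" "prob_space M" and i: "i \<in> nodes" and f: "f \<in> borel_measurable (tree_law M0 M)"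
  shows "(\<integral>\<^sup>+ z. f z \<partial>tree_law M0 M) =
    (\<integral>\<^sup>+ u. \<integral>\<^sup>+ z. f (z(i := u)) \<partial>tree_law M0 M \<partial>(if i = [] then M0 else M))"
proof -
  let ?M = "\<lambda>i. if i = [] then M0 else M"
  interpret P: prob_space "tree_law M0 M" using assms by (intro prob_space_tree_law)
  have ins: "insert i nodes = nodes" using i by auto
  have upd: "(\<lambda>(x, X). X(i := x)) \<in> measurable (?M i \<Otimes>\<^sub>M tree_law M0 M) (tree_law M0 M)"
    unfolding tree_law_def split_def
    by (rule measurable_fun_upd[where J = nodes]) (use i in auto)
  have "tree_law M0 M = distr (?M i \<Otimes>\<^sub>M tree_law M0 M) (tree_law M0 M) (\<lambda>(x, X). X(i := x))"
    using distr_pair_PiM_eq_PiM[of nodes ?M i] assms(1,2) unfolding ins tree_law_def by simp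
  then have "(\<integral>\<^sup>+ z. f z \<partial>tree_law M0 M) = (\<integral>\<^sup>+ z. f z \<partial>distr (?M i \<Otimes>\<^sub>M tree_law M0 M) (tree_law M0 M) (\<lambda>(x, X). X(i := x)))"
    by simp
  also have "\<dots> = (\<integral>\<^sup>+ y. f (case y of (x, X) \<Rightarrow> X(i := x)) \<partial>(?M i \<Otimes>\<^sub>M tree_law M0 M))"
    using upd f by (simp add: nn_integral_distr split_def)
  also have "\<dots> = (\<integral>\<^sup>+ u. \<integral>\<^sup>+ z. f (z(i := u)) \<partial>tree_law M0 M \<partial>(?M i))"
    by (subst P.nn_integral_fst[symmetric]) (use measurable_compose[OF upd f] in \<open>simp_all add: split_def\<close>)
  finally show ?thesis .
qed

text \<open>Independence in the form used throughout: after resampling coordinate \<open>i\<close>,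
  \<open>g\<close> sees only the fresh value and \<open>h\<close> only the old labels, so the
  integral factorises. Invariance of \<open>h\<close> under updates at \<open>i\<close> stands for
  measurability with respect to the other labels.\<close>

lemma nn_integral_tree_law_mult:
  assumes "prob_space M0" "prob_space M" "sets M0 = sets M" and i: "i \<in> nodes"
    and g: "g \<in> borel_measurable M" and h: "h \<in> borel_measurable (tree_law M0 M)" "\<And>z u. z \<in> space (tree_law M0 M) \<Longrightarrow> h (z(i := u)) = h z"
  shows "(\<integral>\<^sup>+ z. g (z i) * h z \<partial>tree_law M0 M) =
    (\<integral>\<^sup>+ u. g u \<partial>(if i = [] then M0 else M)) * (\<integral>\<^sup>+ z. h z \<partial>tree_law M0 M)"
proof -
  have g': "g \<in> borel_measurable (if i = [] then M0 else M)"
    using g measurable_cong_sets[OF assms(3) refl, of "borel :: ennreal measure"] by (cases "i = []") simp_all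
  have "(\<lambda>z. g (z i) * h z) \<in> borel_measurable (tree_law M0 M)"
    by (intro borel_measurable_times_ennreal h(1)
        measurable_compose[OF measurable_tree_law_component[OF measurable_ident_sets[OF refl] i assms(3)] g])
  from nn_integral_tree_law_resample[OF assms(1,2) i this]
  have "(\<integral>\<^sup>+ z. g (z i) * h z \<partial>tree_law M0 M) =
      (\<integral>\<^sup>+ u. \<integral>\<^sup>+ z. g u * h (z(i := u)) \<partial>tree_law M0 M \<partial>(if i = [] then M0 else M))"
    by simp
  also have "\<dots> = (\<integral>\<^sup>+ u. \<integral>\<^sup>+ z. g u * h z \<partial>tree_law M0 M \<partial>(if i = [] then M0 else M))"
    by (intro nn_integral_cong) (simp add: h(2))
  finally show ?thesis
    by (simp add: h(1) g' nn_integral_cmult nn_integral_multc del: if_split)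
qed

abbreviation abs_mean :: "'x measure \<Rightarrow> ('x \<Rightarrow> nat \<Rightarrow> real) \<Rightarrow> nat \<Rightarrow> ennreal" where
  "abs_mean M x k \<equiv> \<integral>\<^sup>+ u. ennreal \<bar>x u k\<bar> \<partial>M"

text \<open>Labels have an arbitrary type so that they can be pairs drawn from a coupling, with
  \<open>fst\<close> and \<open>snd\<close> as the readings \<open>x\<close> and \<open>y\<close> of
  the two trees; the identity as reading gives a single tree.\<close>

locale labelled_tree =
  fixes M0 M :: "'x measure"
  assumes prob_M0: "prob_space M0" and prob_M: "prob_space M" and sets_eq: "sets M0 = sets M"
begin

abbreviation "P \<equiv> tree_law M0 M"
abbreviation "node_law i \<equiv> if i = [] then M0 else M"
abbreviation "mean_total x p j \<equiv> \<integral>\<^sup>+ z. abs_total (\<lambda>i. x (z i)) p j \<partial>P"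
abbreviation "mean_diff x y p j \<equiv> \<integral>\<^sup>+ z. diff_total (\<lambda>i. x (z i)) (\<lambda>i. y (z i)) p j \<partial>P"

lemma borel_measurable_M0: "f \<in> borel_measurable M \<Longrightarrow> f \<in> borel_measurable M0"
  by (subst measurable_cong_sets[OF sets_eq refl])

lemma component_measurable: "i \<in> nodes \<Longrightarrow> (\<lambda>z. z i) \<in> measurable P M"
  by (rule measurable_tree_law_component[OF measurable_ident_sets[OF refl] _ sets_eq])

lemma coordinate_measurable':
  assumes "x \<in> measurable M seq_space"
  shows "(\<lambda>u. x u (r::nat)) \<in> borel_measurable M"
  using assms by measurable

lemma coordinate_measurable:
  assumes "x \<in> measurable M seq_space" "i \<in> nodes"
  shows "(\<lambda>z. x (z i) r) \<in> borel_measurable P"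
  by (rule measurable_compose[OF component_measurable[OF assms(2)] coordinate_measurable'[OF assms(1)]])

lemma abs_total_measurable:
  assumes x: "x \<in> measurable M seq_space"
  shows "p \<in> nodes \<Longrightarrow> (\<lambda>z. abs_total (\<lambda>i. x (z i)) p j) \<in> borel_measurable P"
proof (induction j arbitrary: p)
  case 0
  then show ?case using coordinate_measurable[OF x] by simp
next
  case (Suc j)
  then have [measurable]: "(\<lambda>z. abs_total (\<lambda>i. x (z i)) (p @ [Suc r]) j) \<in> borel_measurable P" for r by simp
  note [measurable] = coordinate_measurable[OF x Suc.prems]
  show ?case by simp
qed

lemma diff_total_measurable:
  assumes x: "x \<in> measurable M seq_space" and y: "y \<in> measurable M seq_space"
  shows "p \<in> nodes \<Longrightarrow> (\<lambda>z. diff_total (\<lambda>i. x (z i)) (\<lambda>i. y (z i)) p j) \<in> borel_measurable P"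
proof (induction j arbitrary: p)
  case 0
  then show ?case using coordinate_measurable[OF x] coordinate_measurable[OF y] by simp
next
  case (Suc j)
  then have [measurable]: "(\<lambda>z. diff_total (\<lambda>i. x (z i)) (\<lambda>i. y (z i)) (p @ [Suc r]) j) \<in> borel_measurable P" for r by simp
  have [measurable]: "(\<lambda>z. abs_total (\<lambda>i. y (z i)) (p @ [Suc r]) j) \<in> borel_measurable P" for r
    using Suc by (intro abs_total_measurable y) auto
  note [measurable] = coordinate_measurable[OF x Suc.prems] coordinate_measurable[OF y Suc.prems]
  show ?case by simp
qed

lemma contribution_measurable:
  assumes x: "x \<in> measurable M seq_space"
  shows "p \<in> nodes \<Longrightarrow> s \<in> nodes \<Longrightarrow> (\<lambda>z. contribution (\<lambda>i. x (z i)) p s) \<in> borel_measurable P"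
proof (induction s arbitrary: p)
  case Nil
  then show ?case using coordinate_measurable[OF x] by simp
next
  case (Cons r s)
  then have [measurable]: "(\<lambda>z. contribution (\<lambda>i. x (z i)) (p @ [r]) s) \<in> borel_measurable P" by simp
  note [measurable] = coordinate_measurable[OF x Cons.prems(1)]
  show ?case by simp
qed

lemma tree_sum_measurable:
  assumes x: "x \<in> measurable M seq_space"
  shows "(\<lambda>z. tree_sum j (\<lambda>i. x (z i))) \<in> borel_measurable P"
  unfolding tree_sum_def
proof (rule sigma_finite_measure.borel_measurable_lebesgue_integral)
  show "sigma_finite_measure (count_space (words j))"
    by (simp add: sigma_finite_measure_count_space_countable)
  have "(\<lambda>(s, z). contribution (\<lambda>i. x (z i)) [] s) \<in> borel_measurable (count_space (words j) \<Otimes>\<^sub>M P)"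
    by (rule measurable_pair_measure_countable1)
       (auto intro!: contribution_measurable x simp: words_def)
  then show "(\<lambda>(z, s). contribution (\<lambda>i. x (z i)) [] s) \<in> borel_measurable (P \<Otimes>\<^sub>M count_space (words j))"
    by (subst measurable_pair_swap_iff) (simp add: split_def)
qed

lemma nn_integral_abs_total_Suc:
  assumes x: "x \<in> measurable M seq_space" and p: "p \<in> nodes"
  shows "mean_total x p (Suc j) =
    (\<Sum>r. abs_mean (node_law p) x (Suc r) * mean_total x (p @ [Suc r]) j)"
proof -
  have gM: "(\<lambda>u. ennreal \<bar>x u r\<bar>) \<in> borel_measurable M" for r
    using coordinate_measurable'[OF x] by simp
  note [measurable] = abs_total_measurable[OF x] coordinate_measurable[OF x p]
  have "mean_total x p (Suc j) =
    (\<Sum>r. \<integral>\<^sup>+ z. ennreal \<bar>x (z p) (Suc r)\<bar> * abs_total (\<lambda>i. x (z i)) (p @ [Suc r]) j \<partial>P)"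
    using p by (simp add: nn_integral_suminf)
  also have "\<dots> = (\<Sum>r. abs_mean (node_law p) x (Suc r) * mean_total x (p @ [Suc r]) j)"
  proof (intro arg_cong[where f = suminf] ext nn_integral_tree_law_mult prob_M0 prob_M sets_eq p)
    fix r z u
    have "(\<lambda>i. x ((z(p := u)) i)) = (\<lambda>i. x (z i))(p := x u)" by auto
    then show "abs_total (\<lambda>i. x ((z(p := u)) i)) (p @ [Suc r]) j = abs_total (\<lambda>i. x (z i)) (p @ [Suc r]) j"
      by (simp only: abs_total_fun_upd length_append) (simp add: abs_total_fun_upd)
  qed (use p in \<open>simp_all add: gM\<close>)
  finally show ?thesis .
qed

text \<open>Each product in \<open>diff_total\<close> has one factor that reads the label of
  \<open>p\<close> and one that reads labels strictly below, so both halves of the telescoping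
  factorise.\<close>

lemma nn_integral_diff_total_Suc:
  assumes x: "x \<in> measurable M seq_space" and y: "y \<in> measurable M seq_space" and p: "p \<in> nodes"
  shows "mean_diff x y p (Suc j) =
    (\<Sum>r. (\<integral>\<^sup>+ u. ennreal \<bar>x u (Suc r) - y u (Suc r)\<bar> \<partial>node_law p) * mean_total y (p @ [Suc r]) j
      + abs_mean (node_law p) x (Suc r) * mean_diff x y (p @ [Suc r]) j)"
proof -
  have gM: "(\<lambda>u. ennreal \<bar>x u r\<bar>) \<in> borel_measurable M" "(\<lambda>u. ennreal \<bar>x u r - y u r\<bar>) \<in> borel_measurable M" for r
    using coordinate_measurable'[OF x] coordinate_measurable'[OF y] by simp_all
  note [measurable] = abs_total_measurable[OF y] diff_total_measurable[OF x y]
    coordinate_measurable[OF x p] coordinate_measurable[OF y p]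
  have upd: "(\<lambda>i. f ((z(p := u)) i)) = (\<lambda>i. f (z i))(p := f u)" for f :: "'x \<Rightarrow> nat \<Rightarrow> real" and z u by auto
  have "mean_diff x y p (Suc j) =
    (\<Sum>r. (\<integral>\<^sup>+ z. ennreal \<bar>x (z p) (Suc r) - y (z p) (Suc r)\<bar> * abs_total (\<lambda>i. y (z i)) (p @ [Suc r]) j \<partial>P)
      + (\<integral>\<^sup>+ z. ennreal \<bar>x (z p) (Suc r)\<bar> * diff_total (\<lambda>i. x (z i)) (\<lambda>i. y (z i)) (p @ [Suc r]) j \<partial>P))"
    using p by (simp add: nn_integral_suminf nn_integral_add)
  moreover have "(\<integral>\<^sup>+ z. ennreal \<bar>x (z p) (Suc r) - y (z p) (Suc r)\<bar> * abs_total (\<lambda>i. y (z i)) (p @ [Suc r]) j \<partial>P)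
    = (\<integral>\<^sup>+ u. ennreal \<bar>x u (Suc r) - y u (Suc r)\<bar> \<partial>node_law p) * mean_total y (p @ [Suc r]) j" for r
  proof (intro nn_integral_tree_law_mult prob_M0 prob_M sets_eq p)
    show "abs_total (\<lambda>i. y ((z(p := u)) i)) (p @ [Suc r]) j = abs_total (\<lambda>i. y (z i)) (p @ [Suc r]) j" for z u
      unfolding upd by (simp add: abs_total_fun_upd)
  qed (use p in \<open>simp_all add: gM\<close>)
  moreover have "(\<integral>\<^sup>+ z. ennreal \<bar>x (z p) (Suc r)\<bar> * diff_total (\<lambda>i. x (z i)) (\<lambda>i. y (z i)) (p @ [Suc r]) j \<partial>P)
    = abs_mean (node_law p) x (Suc r) * mean_diff x y (p @ [Suc r]) j" for r
  proof (intro nn_integral_tree_law_mult prob_M0 prob_M sets_eq p)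
    show "diff_total (\<lambda>i. x ((z(p := u)) i)) (\<lambda>i. y ((z(p := u)) i)) (p @ [Suc r]) j = diff_total (\<lambda>i. x (z i)) (\<lambda>i. y (z i)) (p @ [Suc r]) j" for z u
      unfolding upd by (simp add: diff_total_fun_upd)
  qed (use p in \<open>simp_all add: gM\<close>)
  ultimately show ?thesis by simp
qed

lemma nn_integral_total_0:
  assumes x: "x \<in> measurable M seq_space" and y: "y \<in> measurable M seq_space" and p: "p \<in> nodes"
  shows "mean_total x p 0 = abs_mean (node_law p) x 0"
    "mean_diff x y p 0 = (\<integral>\<^sup>+ u. ennreal \<bar>x u 0 - y u 0\<bar> \<partial>node_law p)"
proof -
  interpret P: prob_space P using prob_M0 prob_M by (rule prob_space_tree_law)
  note [measurable] = coordinate_measurable'[OF x] coordinate_measurable'[OF y]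
  have *: "(\<integral>\<^sup>+ z. g (z p) \<partial>P) = (\<integral>\<^sup>+ u. g u \<partial>node_law p)" if "g \<in> borel_measurable M" for g
    using nn_integral_tree_law_mult[OF prob_M0 prob_M sets_eq p that, of "\<lambda>_. 1"] by (simp add: P.emeasure_space_1 del: if_split)
  show "mean_total x p 0 = abs_mean (node_law p) x 0"
    "mean_diff x y p 0 = (\<integral>\<^sup>+ u. ennreal \<bar>x u 0 - y u 0\<bar> \<partial>node_law p)"
    by (simp_all only: abs_total.simps diff_total.simps, (rule *, measurable)+)
qed

end

section \<open>Moments of the totals and the error bound\<close>

definition offspring_mean :: "'x measure \<Rightarrow> ('x \<Rightarrow> nat \<Rightarrow> real) \<Rightarrow> ennreal" where
  "offspring_mean M x = (\<Sum>r. \<integral>\<^sup>+ u. ennreal \<bar>x u (Suc r)\<bar> \<partial>M)"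

lemma nn_integral_l1_seq:
  assumes "\<And>k. (\<lambda>u. x u k) \<in> borel_measurable M"
  shows "(\<integral>\<^sup>+ u. l1_seq (x u) \<partial>M) = abs_mean M x 0 + offspring_mean M x"
proof -
  note [measurable] = assms
  have "(\<integral>\<^sup>+ u. l1_seq (x u) \<partial>M) = (\<Sum>k. \<integral>\<^sup>+ u. ennreal \<bar>x u k\<bar> \<partial>M)"
    unfolding l1_seq_def by (simp add: nn_integral_suminf)
  also have "\<dots> = (\<Sum>r. \<integral>\<^sup>+ u. ennreal \<bar>x u (Suc r)\<bar> \<partial>M) + abs_mean M x 0"
    using suminf_offset[OF summableI, of "\<lambda>k. \<integral>\<^sup>+ u. ennreal \<bar>x u k\<bar> \<partial>M" 1] by (simp add: add.commute)
  finally show ?thesis by (simp add: offspring_mean_def add.commute)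
qed

context labelled_tree
begin

text \<open>Away from the root all labels have law \<open>M\<close>, so each generation multiplies
  the mean by the same factor, as in a Galton-Watson process.\<close>

lemma nn_integral_abs_total:
  assumes x: "x \<in> measurable M seq_space" and p: "p \<in> nodes" "p \<noteq> []"
  shows "mean_total x p j = offspring_mean M x ^ j * abs_mean M x 0"
  using p
proof (induction j arbitrary: p)
  case 0
  then show ?case using nn_integral_total_0(1)[OF x x] by simp
next
  case (Suc j)
  then show ?case
    by (simp add: nn_integral_abs_total_Suc[OF x] offspring_mean_def ennreal_suminf_multc mult.assoc del: abs_total.simps)
qed

lemma nn_integral_abs_total_root:
  assumes x: "x \<in> measurable M seq_space"
  shows "mean_total x [] (Suc j) =
    offspring_mean M0 x * (offspring_mean M x ^ j * abs_mean M x 0)"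
  by (simp add: nn_integral_abs_total_Suc[OF x] nn_integral_abs_total[OF x] offspring_mean_def[of M0] ennreal_suminf_multc
      del: abs_total.simps)

lemma nn_integral_abs_total_finite:
  assumes x: "x \<in> measurable M seq_space"
    and fin: "(\<integral>\<^sup>+ u. l1_seq (x u) \<partial>M0) < \<infinity>" "(\<integral>\<^sup>+ u. l1_seq (x u) \<partial>M) < \<infinity>"
  shows "mean_total x [] j < \<infinity>"
proof -
  note m = coordinate_measurable'[OF x]
  note fin' = fin[unfolded nn_integral_l1_seq[of x, OF m] nn_integral_l1_seq[of x, OF borel_measurable_M0[OF m]]]
  show ?thesis
  proof (cases j)
    case 0
    with fin' show ?thesis using nn_integral_total_0(1)[OF x x, of "[]"] by simp
  next
    case (Suc i)
    with fin' show ?thesis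
      by (simp add: nn_integral_abs_total_root[OF x] ennreal_mult_less_top power_less_top_ennreal del: abs_total.simps)
  qed
qed

text \<open>One level of the error recursion. The \<open>l1_seq\<close> distance of two labels
  dominates both the error in coordinate 0 and the error in the weights, so \<open>c\<close> bounds
  either. An error made at \<open>p\<close> is multiplied by the total \<open>A\<close> below, an
  error \<open>B\<close> made below by the mean weight \<open>R\<close> passed down.\<close>

lemma mean_diff_le:
  assumes x: "x \<in> measurable M seq_space" and y: "y \<in> measurable M seq_space" and p: "p \<in> nodes"
    and c: "(\<integral>\<^sup>+ u. l1_seq (x u - y u) \<partial>node_law p) \<le> c"
  shows "mean_diff x y p 0 \<le> c"
    and "offspring_mean (node_law p) x \<le> R \<Longrightarrow> (\<And>r. mean_total y (p @ [Suc r]) j \<le> A) \<Longrightarrow>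
      (\<And>r. mean_diff x y (p @ [Suc r]) j \<le> B) \<Longrightarrow> mean_diff x y p (Suc j) \<le> c * A + R * B"
proof -
  have m: "(\<lambda>u. (x u - y u) k) \<in> borel_measurable M" for k
    using coordinate_measurable'[OF x] coordinate_measurable'[OF y] by simp
  have "(\<lambda>u. (x u - y u) k) \<in> borel_measurable (node_law p)" for k
    using m[of k] borel_measurable_M0[OF m[of k]] by simp
  note c' = c[unfolded nn_integral_l1_seq[of "\<lambda>u. x u - y u", OF this]]
  show "mean_diff x y p 0 \<le> c"
    unfolding nn_integral_total_0(2)[OF x y p] using order.trans[OF add_increasing2[OF _ order.refl] c'] by simp
  assume R: "offspring_mean (node_law p) x \<le> R" and A: "\<And>r. mean_total y (p @ [Suc r]) j \<le> A"
    and B: "\<And>r. mean_diff x y (p @ [Suc r]) j \<le> B"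
  have "mean_diff x y p (Suc j) \<le> (\<Sum>r. (\<integral>\<^sup>+ u. ennreal \<bar>x u (Suc r) - y u (Suc r)\<bar> \<partial>node_law p) * A
      + abs_mean (node_law p) x (Suc r) * B)"
    unfolding nn_integral_diff_total_Suc[OF x y p]
    by (intro suminf_le summableI add_mono mult_mono A B) auto
  also have "\<dots> = offspring_mean (node_law p) (\<lambda>u. x u - y u) * A + offspring_mean (node_law p) x * B"
    by (subst suminf_add[symmetric]) (simp_all add: offspring_mean_def ennreal_suminf_multc)
  also have "\<dots> \<le> c * A + R * B"
    using order.trans[OF add_increasing[OF _ order.refl] c'] R by (intro add_mono mult_mono) auto
  finally show "mean_diff x y p (Suc j) \<le> c * A + R * B" .
qed

context
  fixes x y :: "'x \<Rightarrow> nat \<Rightarrow> real" and c R \<beta> :: real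
  assumes x: "x \<in> measurable M seq_space" and y: "y \<in> measurable M seq_space"
    and c: "(\<integral>\<^sup>+ u. l1_seq (x u - y u) \<partial>M) \<le> ennreal c" "c \<ge> 0"
    and R: "offspring_mean M x \<le> ennreal R" "offspring_mean M y \<le> ennreal R" "R > 0"
    and \<beta>: "abs_mean M y 0 \<le> ennreal \<beta>" "\<beta> \<ge> 0"
begin

lemma mean_total_le:
  assumes "p \<in> nodes" "p \<noteq> []"
  shows "mean_total y p j \<le> ennreal (R ^ j * \<beta>)"
proof -
  have "mean_total y p j \<le> ennreal R ^ j * ennreal \<beta>"
    unfolding nn_integral_abs_total[OF y assms] by (intro mult_mono power_mono R \<beta>) auto
  then show ?thesis using R(3) \<beta>(2) by (simp add: ennreal_mult ennreal_power)
qed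

text \<open>Solves \<open>D (j + 1) \<le> c \<beta> R ^ j + R D j\<close> with
  \<open>D 0 \<le> c\<close>: relative to the power of \<open>R\<close>, every level adds the same
  error \<open>c \<beta> / R\<close>, hence the growth linear in \<open>j\<close>. \<open>R\<close>
  bounds both offspring means, since weights of \<open>x\<close> stand above the changed label and
  weights of \<open>y\<close> below it.\<close>

lemma mean_diff_nonroot_le:
  "p \<in> nodes \<Longrightarrow> p \<noteq> [] \<Longrightarrow> mean_diff x y p j \<le> ennreal (c * (1 + j * \<beta> / R) * R ^ j)"
proof (induction j arbitrary: p)
  case 0
  then show ?case using mean_diff_le(1)[OF x y, of p "ennreal c"] c by simp
next
  case (Suc j)
  have "mean_diff x y p (Suc j) \<le> ennreal c * ennreal (R ^ j * \<beta>) + ennreal R * ennreal (c * (1 + j * \<beta> / R) * R ^ j)"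
    by (rule mean_diff_le(2)[OF x y]) (use Suc c R(1) mean_total_le in auto)
  also have "\<dots> = ennreal (c * (R ^ j * \<beta>) + R * (c * (1 + j * \<beta> / R) * R ^ j))"
    using c(2) R(3) \<beta>(2) by (simp add: ennreal_mult ennreal_plus)
  also have "c * (R ^ j * \<beta>) + R * (c * (1 + j * \<beta> / R) * R ^ j) = c * (1 + Suc j * \<beta> / R) * R ^ Suc j"
    using R(3) by (simp add: field_simps)
  finally show ?case .
qed

text \<open>One more step of the same recursion, with the root's own error \<open>c0\<close> and
  mean weight \<open>R0\<close>; generation 0 sees the root label alone.\<close>

lemma mean_diff_root_le:
  assumes c0: "(\<integral>\<^sup>+ u. l1_seq (x u - y u) \<partial>M0) \<le> ennreal c0" "c0 \<ge> 0"
    and R0: "offspring_mean M0 x \<le> ennreal R0" "R0 \<ge> 0"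
  shows "mean_diff x y [] 0 \<le> ennreal c0"
    "mean_diff x y [] (Suc j) \<le> ennreal ((c0 * \<beta> + R0 * c * (1 + j * \<beta> / R)) * R ^ j)"
proof -
  show "mean_diff x y [] 0 \<le> ennreal c0"
    by (rule mean_diff_le(1)[OF x y]) (use c0 in simp_all)
  have "mean_diff x y [] (Suc j) \<le> ennreal c0 * ennreal (R ^ j * \<beta>) + ennreal R0 * ennreal (c * (1 + j * \<beta> / R) * R ^ j)"
    by (rule mean_diff_le(2)[OF x y]) (use c0 R0 mean_total_le mean_diff_nonroot_le in auto)
  also have "\<dots> = ennreal (c0 * (R ^ j * \<beta>) + R0 * (c * (1 + j * \<beta> / R) * R ^ j))"
    using c(2) c0(2) R(3) \<beta>(2) R0(2) by (simp add: ennreal_mult ennreal_plus)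
  also have "c0 * (R ^ j * \<beta>) + R0 * (c * (1 + j * \<beta> / R) * R ^ j) = (c0 * \<beta> + R0 * c * (1 + j * \<beta> / R)) * R ^ j"
    by (simp add: algebra_simps)
  finally show "mean_diff x y [] (Suc j) \<le> ennreal ((c0 * \<beta> + R0 * c * (1 + j * \<beta> / R)) * R ^ j)" .
qed

end

lemma indep_vars_components: "prob_space.indep_vars P (\<lambda>i. if i = [] then M0 else M) (\<lambda>i z. z i) nodes"
proof -
  let ?M = "\<lambda>i::nat list. if i = [] then M0 else M"
  interpret P: prob_space P using prob_M0 prob_M by (rule prob_space_tree_law)
  have "distr P (Pi\<^sub>M nodes ?M) (\<lambda>z. restrict z nodes) = distr P P (\<lambda>z. z)"
    by (rule distr_cong) (auto simp: tree_law_def space_PiM)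
  also have "\<dots> = Pi\<^sub>M nodes ?M" by (simp add: tree_law_def)
  also have "\<dots> = Pi\<^sub>M nodes (\<lambda>i. distr P (?M i) (\<lambda>z. z i))"
    unfolding tree_law_def
    by (intro PiM_cong refl distr_PiM_component[symmetric]) (use prob_M0 prob_M in auto)
  finally show ?thesis
    using nodes_simps(1)
    by (subst P.indep_vars_iff_distr_eq_PiM')
       (blast, unfold tree_law_def, rule measurable_component_singleton, assumption)
qed

end

section \<open>Laws of the generation sums and their couplings\<close>

lemma contribution_cong:
  "(\<And>i. i \<in> nodes \<Longrightarrow> v i = w i) \<Longrightarrow> p \<in> nodes \<Longrightarrow> s \<in> nodes \<Longrightarrow> contribution v p s = contribution w p s"
  by (induction s arbitrary: p) auto

lemma tree_sum_cong: "(\<And>i. i \<in> nodes \<Longrightarrow> v i = w i) \<Longrightarrow> tree_sum j v = tree_sum j w"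
  unfolding tree_sum_def
  by (intro Bochner_Integration.integral_cong refl contribution_cong) (auto simp: words_def)

definition sum_law :: "nat \<Rightarrow> (nat \<Rightarrow> real) measure \<Rightarrow> (nat \<Rightarrow> real) measure \<Rightarrow> real measure" where
  "sum_law j \<mu>0 \<mu> = distr (tree_law \<mu>0 \<mu>) borel (tree_sum j)"

lemma labelled_tree_seq:
  assumes "prob_space \<mu>0" "prob_space \<mu>" "sets \<mu>0 = sets seq_space" "sets \<mu> = sets seq_space"
  shows "labelled_tree \<mu>0 \<mu>"
  using assms(1,2) trans[OF assms(3) assms(4)[symmetric]] by (rule labelled_tree.intro)

lemma tree_sum_measurable_tree_law:
  assumes "prob_space \<mu>0" "prob_space \<mu>" "sets \<mu>0 = sets seq_space" "sets \<mu> = sets seq_space"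
  shows "tree_sum j \<in> borel_measurable (tree_law \<mu>0 \<mu>)"
  using labelled_tree.tree_sum_measurable[OF labelled_tree_seq[OF assms], of "\<lambda>u. u" j] measurable_ident_sets[OF assms(4)]
  by simp

lemma distr_indep_labels:
  assumes "prob_space \<Omega>" and indep: "prob_space.indep_vars \<Omega> (\<lambda>_. seq_space) V nodes"
    and law: "distr \<Omega> seq_space (V []) = \<mu>0" "\<And>i. i \<in> nodes \<Longrightarrow> i \<noteq> [] \<Longrightarrow> distr \<Omega> seq_space (V i) = \<mu>"
  shows "distr \<Omega> (PiM nodes (\<lambda>_. seq_space)) (\<lambda>\<omega>. \<lambda>i\<in>nodes. V i \<omega>) = tree_law \<mu>0 \<mu>"
proof -
  interpret prob_space \<Omega> by fact
  have V: "V i \<in> measurable \<Omega> seq_space" if "i \<in> nodes" for i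
    using indep that by (simp add: indep_vars_def)
  have "distr \<Omega> (PiM nodes (\<lambda>_. seq_space)) (\<lambda>\<omega>. \<lambda>i\<in>nodes. V i \<omega>) = PiM nodes (\<lambda>i. distr \<Omega> seq_space (V i))"
    using indep indep_vars_iff_distr_eq_PiM'[of nodes V "\<lambda>_. seq_space"] V nodes_simps(1) by blast
  also have "\<dots> = tree_law \<mu>0 \<mu>"
    unfolding tree_law_def by (intro PiM_cong) (auto simp: law)
  finally show ?thesis .
qed

text \<open>The passage from an arbitrary probability space to the product space: the law of a
  generation sum depends on the two label laws only. Being laws of actual labels, these are
  probability measures on the sequence space; the node \<open>[1]\<close> serves as witness for
  \<open>\<mu>\<close>.\<close>

lemma sum_law_indep_labels:
  assumes "prob_space \<Omega>" and indep: "prob_space.indep_vars \<Omega> (\<lambda>_. seq_space) V nodes"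
    and law: "distr \<Omega> seq_space (V []) = \<mu>0" "\<And>i. i \<in> nodes \<Longrightarrow> i \<noteq> [] \<Longrightarrow> distr \<Omega> seq_space (V i) = \<mu>"
  shows "distr \<Omega> borel (\<lambda>\<omega>. tree_sum j (\<lambda>i. V i \<omega>)) = sum_law j \<mu>0 \<mu>"
    "(\<lambda>\<omega>. tree_sum j (\<lambda>i. V i \<omega>)) \<in> borel_measurable \<Omega>"
    "prob_space \<mu>0" "prob_space \<mu>" "sets \<mu>0 = sets seq_space" "sets \<mu> = sets seq_space"
proof -
  interpret prob_space \<Omega> by fact
  have V: "V i \<in> measurable \<Omega> seq_space" if "i \<in> nodes" for i
    using indep that by (simp add: indep_vars_def)
  have 1: "[] \<in> nodes" "[1] \<in> nodes" by simp_all
  show \<mu>: "prob_space \<mu>0" "prob_space \<mu>" "sets \<mu>0 = sets seq_space" "sets \<mu> = sets seq_space"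
    using prob_space_distr[OF V[OF 1(1)]] prob_space_distr[OF V[OF 1(2)]] law(2)[OF 1(2)] law(1) by auto
  let ?S = "PiM nodes (\<lambda>_. seq_space) :: (nat list \<Rightarrow> nat \<Rightarrow> real) measure"
  let ?V = "\<lambda>\<omega>. \<lambda>i\<in>nodes. V i \<omega>"
  have eq: "distr \<Omega> ?S ?V = tree_law \<mu>0 \<mu>" by (rule distr_indep_labels[OF assms])
  have mV: "?V \<in> measurable \<Omega> ?S" by (intro measurable_restrict V)
  have mT: "tree_sum j \<in> borel_measurable ?S"
  proof -
    have S: "sets (tree_law \<mu>0 \<mu>) = sets ?S"
      unfolding eq[symmetric] by (rule sets_distr)
    from tree_sum_measurable_tree_law[OF \<mu>, of j] show ?thesis
      unfolding measurable_cong_sets[OF S refl] .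
  qed
  have cong: "tree_sum j (\<lambda>i. V i \<omega>) = tree_sum j (?V \<omega>)" for \<omega>
    by (rule tree_sum_cong) simp
  show "(\<lambda>\<omega>. tree_sum j (\<lambda>i. V i \<omega>)) \<in> borel_measurable \<Omega>"
    unfolding cong by (rule measurable_compose[OF mV mT])
  show "distr \<Omega> borel (\<lambda>\<omega>. tree_sum j (\<lambda>i. V i \<omega>)) = sum_law j \<mu>0 \<mu>"
    unfolding cong sum_law_def eq[symmetric] by (subst distr_distr[OF mT mV]) (simp add: comp_def)
qed

lemma real_distribution_sum_law:
  assumes "prob_space \<mu>0" "prob_space \<mu>" "sets \<mu>0 = sets seq_space" "sets \<mu> = sets seq_space"
  shows "real_distribution (sum_law j \<mu>0 \<mu>)"
proof -
  interpret prob_space "tree_law \<mu>0 \<mu>" using assms by (intro prob_space_tree_law)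
  show ?thesis
    unfolding sum_law_def by (rule real_distribution_distr) (rule tree_sum_measurable_tree_law[OF assms])
qed

lemma nn_integral_sum_law_le:
  assumes "prob_space \<mu>0" "prob_space \<mu>" "sets \<mu>0 = sets seq_space" "sets \<mu> = sets seq_space"
  shows "(\<integral>\<^sup>+ y. l1_vec y \<partial>sum_law j \<mu>0 \<mu>) \<le> (\<integral>\<^sup>+ v. abs_total v [] j \<partial>tree_law \<mu>0 \<mu>)"
proof -
  note tree_sum_measurable_tree_law[OF assms, measurable]
  have "(\<integral>\<^sup>+ y. l1_vec y \<partial>sum_law j \<mu>0 \<mu>) = (\<integral>\<^sup>+ v. ennreal \<bar>tree_sum j v\<bar> \<partial>tree_law \<mu>0 \<mu>)"
    unfolding sum_law_def by (simp add: nn_integral_distr l1_vec_real)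
  also have "\<dots> \<le> (\<integral>\<^sup>+ v. abs_total v [] j \<partial>tree_law \<mu>0 \<mu>)"
    by (intro nn_integral_mono abs_tree_sum_le)
  finally show ?thesis .
qed

text \<open>The tree law with labels drawn from \<open>\<gamma>0\<close> and \<open>\<gamma>\<close>
  projects under \<open>fst\<close> and \<open>snd\<close> onto the two given tree laws, so the pair
  of generation sums is a coupling. The finite moments make both totals finite almost surely, as
  \<open>tree_sum_diff_le\<close> asks.\<close>

lemma sum_law_coupling:
  assumes \<mu>: "prob_space \<mu>0" "prob_space \<mu>" "sets \<mu>0 = sets seq_space" "sets \<mu> = sets seq_space"
    and \<nu>: "prob_space \<nu>0" "prob_space \<nu>" "sets \<nu>0 = sets seq_space" "sets \<nu> = sets seq_space"
    and fin: "(\<integral>\<^sup>+ u. l1_seq u \<partial>\<mu>0) < \<infinity>" "(\<integral>\<^sup>+ u. l1_seq u \<partial>\<mu>) < \<infinity>"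
      "(\<integral>\<^sup>+ u. l1_seq u \<partial>\<nu>0) < \<infinity>" "(\<integral>\<^sup>+ u. l1_seq u \<partial>\<nu>) < \<infinity>"
    and \<gamma>0: "\<gamma>0 \<in> couplings \<mu>0 \<nu>0" and \<gamma>: "\<gamma> \<in> couplings \<mu> \<nu>"
  obtains \<eta> where "\<eta> \<in> couplings (sum_law j \<mu>0 \<mu>) (sum_law j \<nu>0 \<nu>)"
    "cost l1_vec \<eta> \<le>
      (\<integral>\<^sup>+ z. diff_total (\<lambda>i. fst (z i)) (\<lambda>i. snd (z i)) [] j \<partial>tree_law \<gamma>0 \<gamma>)"
proof -
  have "sets (\<mu>0 \<Otimes>\<^sub>M \<nu>0) = sets (\<mu> \<Otimes>\<^sub>M \<nu>)"
    using \<mu> \<nu> by (intro sets_pair_measure_cong) auto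
  then have "sets \<gamma>0 = sets \<gamma>"
    unfolding couplingsD(2)[OF \<gamma>0] couplingsD(2)[OF \<gamma>] .
  then interpret labelled_tree \<gamma>0 \<gamma>
    by (rule labelled_tree.intro[OF couplingsD(1)[OF \<gamma>0] couplingsD(1)[OF \<gamma>]])
  interpret P: prob_space P using prob_M0 prob_M by (rule prob_space_tree_law)
  have fs: "fst \<in> measurable \<gamma> seq_space" "snd \<in> measurable \<gamma> seq_space"
    and fs0: "fst \<in> measurable \<gamma>0 seq_space" "snd \<in> measurable \<gamma>0 seq_space"
    using couplingsD(5,6)[OF \<gamma>] couplingsD(5,6)[OF \<gamma>0] \<mu> \<nu> by (simp_all cong: measurable_cong_sets)
  have indep: "P.indep_vars (\<lambda>_. seq_space) (\<lambda>i z. f (z i)) nodes"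
    if "f \<in> measurable \<gamma> seq_space" "f \<in> measurable \<gamma>0 seq_space" for f :: "_ \<Rightarrow> nat \<Rightarrow> real"
    by (rule P.indep_vars_compose2[OF indep_vars_components]) (use that in auto)
  have law: "distr P seq_space (\<lambda>z. f (z i)) = distr (if i = [] then \<gamma>0 else \<gamma>) seq_space f"
    if f: "f \<in> measurable \<gamma> seq_space" "f \<in> measurable \<gamma>0 seq_space" and i: "i \<in> nodes" for f :: "_ \<Rightarrow> nat \<Rightarrow> real" and i
  proof -
    have "distr P (if i = [] then \<gamma>0 else \<gamma>) (\<lambda>z. z i) = (if i = [] then \<gamma>0 else \<gamma>)"
      unfolding tree_law_def using distr_PiM_component[of nodes "\<lambda>i. if i = [] then \<gamma>0 else \<gamma>" i] prob_M0 prob_M i by auto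
    moreover have "(\<lambda>z. z i) \<in> measurable P (if i = [] then \<gamma>0 else \<gamma>)"
      unfolding tree_law_def using measurable_component_singleton[OF i, of "\<lambda>i. if i = [] then \<gamma>0 else \<gamma>"] by simp
    moreover have "f \<in> measurable (if i = [] then \<gamma>0 else \<gamma>) seq_space" using f by simp
    ultimately show ?thesis
      using distr_distr[of f "if i = [] then \<gamma>0 else \<gamma>" seq_space "\<lambda>z. z i" P] by (simp add: comp_def del: if_split)
  qed
  have m: "distr \<gamma>0 seq_space fst = \<mu>0" "distr \<gamma> seq_space fst = \<mu>" "distr \<gamma>0 seq_space snd = \<nu>0" "distr \<gamma> seq_space snd = \<nu>"
    using couplingsD(3,4)[OF \<gamma>0] couplingsD(3,4)[OF \<gamma>] \<mu> \<nu> by (metis distr_cong)+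
  let ?x = "\<lambda>z. tree_sum j (\<lambda>i. fst (z i))" and ?y = "\<lambda>z. tree_sum j (\<lambda>i. snd (z i))"
  have x: "distr P borel ?x = sum_law j \<mu>0 \<mu>" "?x \<in> borel_measurable P"
    using sum_law_indep_labels(1,2)[OF P.prob_space_axioms indep[OF fs(1) fs0(1)]] law[OF fs(1) fs0(1)] m by simp_all
  have y: "distr P borel ?y = sum_law j \<nu>0 \<nu>" "?y \<in> borel_measurable P"
    using sum_law_indep_labels(1,2)[OF P.prob_space_axioms indep[OF fs(2) fs0(2)]] law[OF fs(2) fs0(2)] m by simp_all
  let ?\<eta> = "distr P (borel \<Otimes>\<^sub>M borel) (\<lambda>z. (?x z, ?y z))"
  have pair: "(\<lambda>z. (?x z, ?y z)) \<in> measurable P (borel \<Otimes>\<^sub>M borel)"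
    using x(2) y(2) by simp
  show ?thesis
  proof
    have "distr ?\<eta> (sum_law j \<mu>0 \<mu>) fst = distr P borel ?x"
      using pair by (subst distr_distr) (auto simp: comp_def sum_law_def intro!: distr_cong)
    moreover have "distr ?\<eta> (sum_law j \<nu>0 \<nu>) snd = distr P borel ?y"
      using pair by (subst distr_distr) (auto simp: comp_def sum_law_def intro!: distr_cong)
    moreover have "sets ?\<eta> = sets (sum_law j \<mu>0 \<mu> \<Otimes>\<^sub>M sum_law j \<nu>0 \<nu>)"
      unfolding sets_distr sum_law_def by (rule sets_pair_measure_cong) simp_all
    ultimately show "?\<eta> \<in> couplings (sum_law j \<mu>0 \<mu>) (sum_law j \<nu>0 \<nu>)"
      unfolding couplings_def mem_Collect_eq using x(1) y(1) P.prob_space_distr[OF pair] by simp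
    have l1[measurable]: "l1_seq \<in> borel_measurable seq_space"
      unfolding l1_seq_def by measurable
    have l1': "l1_seq \<in> borel_measurable \<rho>" if "sets \<rho> = sets seq_space" for \<rho>
      using l1 measurable_cong_sets[OF that refl, of "borel :: ennreal measure"] by simp
    have "(\<integral>\<^sup>+ z. abs_total (\<lambda>i. fst (z i)) [] j \<partial>P) < \<infinity>"
      using fin \<mu> by (intro nn_integral_abs_total_finite fs) (simp_all add: nn_integral_coupling_fst[OF \<gamma>0 l1'] nn_integral_coupling_fst[OF \<gamma> l1'])
    then have ax: "AE z in P. abs_total (\<lambda>i. fst (z i)) [] j \<noteq> \<infinity>"
      by (intro nn_integral_noteq_infinite abs_total_measurable fs) auto
    have "(\<integral>\<^sup>+ z. abs_total (\<lambda>i. snd (z i)) [] j \<partial>P) < \<infinity>"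
      using fin \<nu> by (intro nn_integral_abs_total_finite fs) (simp_all add: nn_integral_coupling_snd[OF \<gamma>0 l1'] nn_integral_coupling_snd[OF \<gamma> l1'])
    then have ay: "AE z in P. abs_total (\<lambda>i. snd (z i)) [] j \<noteq> \<infinity>"
      by (intro nn_integral_noteq_infinite abs_total_measurable fs) auto
    have "cost l1_vec ?\<eta> = (\<integral>\<^sup>+ z. ennreal \<bar>?x z - ?y z\<bar> \<partial>P)"
      using pair by (simp add: nn_integral_distr l1_vec_real)
    also have "\<dots> \<le> (\<integral>\<^sup>+ z. diff_total (\<lambda>i. fst (z i)) (\<lambda>i. snd (z i)) [] j \<partial>P)"
      using ax ay by (intro nn_integral_mono_AE, eventually_elim) (intro tree_sum_diff_le, auto simp: less_top)
    finally show "cost l1_vec ?\<eta> \<le> (\<integral>\<^sup>+ z. diff_total (\<lambda>i. fst (z i)) (\<lambda>i. snd (z i)) [] j \<partial>P)" .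
  qed
qed

section \<open>Convergence of the laws of generation sums\<close>

text \<open>For the label law of either case this is the mean \<open>\<rho>\<close>, as an extended
  value.\<close>

abbreviation label_mean :: "(nat \<Rightarrow> real) measure \<Rightarrow> ennreal" where
  "label_mean \<mu> \<equiv> offspring_mean \<mu> (\<lambda>u. u)"

lemma borel_measurable_l1_seq: "sets \<mu> = sets seq_space \<Longrightarrow> l1_seq \<in> borel_measurable \<mu>"
proof -
  assume "sets \<mu> = sets seq_space"
  moreover have "l1_seq \<in> borel_measurable seq_space"
    unfolding l1_seq_def by measurable
  ultimately show ?thesis
    by (subst measurable_cong_sets[OF _ refl])
qed

lemma borel_measurable_component: "sets \<mu> = sets seq_space \<Longrightarrow> (\<lambda>u. u k) \<in> borel_measurable \<mu>"
  by (subst measurable_cong_sets[OF _ refl], assumption, rule measurable_component_singleton) simp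

lemma l1_seq_triangle: "l1_seq (u - v) \<le> l1_seq u + l1_seq v"
proof -
  have "l1_seq (u - v) \<le> (\<Sum>k. ennreal \<bar>u k\<bar> + ennreal \<bar>v k\<bar>)"
    unfolding l1_seq_def by (intro suminf_le summableI) (simp flip: ennreal_plus)
  then show ?thesis by (simp add: l1_seq_def suminf_add summableI)
qed

text \<open>The product coupling already has finite cost. Finiteness allows the distances to be
  treated as reals below.\<close>

lemma d1_finite:
  assumes "prob_space \<mu>" "prob_space \<nu>" and tri: "\<And>x y. l1 (x - y) \<le> l1 x + l1 y"
    and l1: "l1 \<in> borel_measurable \<mu>" "l1 \<in> borel_measurable \<nu>"
    and fin: "finite_first_moment l1 \<mu>" "finite_first_moment l1 \<nu>"
  shows "d1 l1 \<mu> \<nu> < \<infinity>"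
proof -
  have \<gamma>: "\<mu> \<Otimes>\<^sub>M \<nu> \<in> couplings \<mu> \<nu>" using assms by (intro pair_measure_in_couplings)
  have "d1 l1 \<mu> \<nu> \<le> (\<integral>\<^sup>+ z. l1 (fst z - snd z) \<partial>(\<mu> \<Otimes>\<^sub>M \<nu>))" by (rule d1_le_coupling[OF \<gamma>])
  also have "\<dots> \<le> (\<integral>\<^sup>+ z. l1 (fst z) + l1 (snd z) \<partial>(\<mu> \<Otimes>\<^sub>M \<nu>))" by (intro nn_integral_mono tri)
  also have "\<dots> = (\<integral>\<^sup>+ x. l1 x \<partial>\<mu>) + (\<integral>\<^sup>+ y. l1 y \<partial>\<nu>)"
    using measurable_compose[OF measurable_fst l1(1), of \<nu>] measurable_compose[OF measurable_snd l1(2), of \<mu>]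
    by (simp add: nn_integral_add nn_integral_coupling_fst[OF \<gamma> l1(1)] nn_integral_coupling_snd[OF \<gamma> l1(2)])
  also have "\<dots> < \<infinity>" using fin by (simp add: finite_first_moment_def)
  finally show ?thesis .
qed

lemma near_optimal_couplings:
  fixes \<mu> :: "nat \<Rightarrow> 'a::minus measure" and w :: "nat \<Rightarrow> nat"
  assumes prob: "\<And>n. prob_space (\<mu> n)" "prob_space \<nu>" and fin: "\<And>n. d1 l1 (\<mu> n) \<nu> < \<infinity>"
    and lim: "(\<lambda>n. d1 l1 (\<mu> n) \<nu>) \<longlonglongrightarrow> 0" "(\<lambda>n. of_nat (w n) * d1 l1 (\<mu> n) \<nu>) \<longlonglongrightarrow> 0"
  obtains \<gamma> c where "\<And>n. \<gamma> n \<in> couplings (\<mu> n) \<nu>" "\<And>n. cost l1 (\<gamma> n) \<le> ennreal (c n)"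
    "\<And>n. c n \<ge> 0" "c \<longlonglongrightarrow> 0" "(\<lambda>n. real (w n) * c n) \<longlonglongrightarrow> 0"
proof -
  \<comment> \<open>This slack tends to 0 even after multiplication by \<open>w n\<close>, so the
    costs inherit both limits from the distances.\<close>
  define e where "e n = 1 / (real (Suc n) * real (Suc (w n)))" for n
  have e: "e n > 0" for n by (simp add: e_def)
  have "\<exists>\<gamma>. \<gamma> \<in> couplings (\<mu> n) \<nu> \<and> cost l1 \<gamma> \<le> d1 l1 (\<mu> n) \<nu> + ennreal (e n)" for n
    using near_optimal_coupling[OF prob(1)[of n] prob(2), of "ennreal (e n)" l1] e[of n] by (metis ennreal_less_zero_iff)
  then obtain \<gamma> where \<gamma>: "\<And>n. \<gamma> n \<in> couplings (\<mu> n) \<nu>"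
      "\<And>n. cost l1 (\<gamma> n) \<le> d1 l1 (\<mu> n) \<nu> + ennreal (e n)" by metis
  define d where "d n = enn2real (d1 l1 (\<mu> n) \<nu>)" for n
  have d: "d1 l1 (\<mu> n) \<nu> = ennreal (d n)" "d n \<ge> 0" for n using fin[of n] by (simp_all add: d_def)
  have "e n \<le> inverse (real (Suc n))" for n
    by (simp add: e_def divide_simps)
  then have e0: "e \<longlonglongrightarrow> 0"
    using e by (intro tendsto_sandwich[OF _ _ tendsto_const LIMSEQ_inverse_real_of_nat]) (auto simp: less_imp_le)
  have "real (w n) * e n \<le> inverse (real (Suc n))" for n
    by (simp add: e_def divide_simps)
  then have we0: "(\<lambda>n. real (w n) * e n) \<longlonglongrightarrow> 0"
    using e by (intro tendsto_sandwich[OF _ _ tendsto_const LIMSEQ_inverse_real_of_nat]) (auto simp: less_imp_le)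
  have "(\<lambda>n. ennreal (d n)) \<longlonglongrightarrow> ennreal 0" using lim(1) by (simp add: d)
  then have d0: "d \<longlonglongrightarrow> 0" by (subst (asm) tendsto_ennreal_iff) (auto simp: d)
  have "(\<lambda>n. ennreal (real (w n) * d n)) \<longlonglongrightarrow> ennreal 0"
    using lim(2) by (simp add: d ennreal_mult ennreal_of_nat_eq_real_of_nat)
  then have wd0: "(\<lambda>n. real (w n) * d n) \<longlonglongrightarrow> 0" by (subst (asm) tendsto_ennreal_iff) (auto simp: d)
  show ?thesis
  proof (rule that[of \<gamma> "\<lambda>n. d n + e n"])
    show "cost l1 (\<gamma> n) \<le> ennreal (d n + e n)" for n
      using \<gamma>(2)[of n] e[of n] d[of n] by simp
    show "(\<lambda>n. d n + e n) \<longlonglongrightarrow> 0" using tendsto_add[OF d0 e0] by simp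
    show "(\<lambda>n. real (w n) * (d n + e n)) \<longlonglongrightarrow> 0" using tendsto_add[OF wd0 we0] by (simp add: distrib_left)
    show "0 \<le> d n + e n" for n using e[of n] d(2)[of n] by simp
  qed (rule \<gamma>)
qed

definition seq_prob :: "(nat \<Rightarrow> real) measure \<Rightarrow> bool" where
  "seq_prob \<mu> \<longleftrightarrow> prob_space \<mu> \<and> sets \<mu> = sets seq_space \<and> finite_first_moment l1_seq \<mu>"

lemma seq_probD:
  assumes "seq_prob \<mu>"
  shows "prob_space \<mu>" "sets \<mu> = sets seq_space" "(\<integral>\<^sup>+ u. l1_seq u \<partial>\<mu>) < \<infinity>" "finite_first_moment l1_seq \<mu>"
    "label_mean \<mu> < \<infinity>" "abs_mean \<mu> (\<lambda>u. u) 0 < \<infinity>"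
proof -
  show *: "prob_space \<mu>" "sets \<mu> = sets seq_space" "(\<integral>\<^sup>+ u. l1_seq u \<partial>\<mu>) < \<infinity>" "finite_first_moment l1_seq \<mu>"
    using assms by (auto simp: seq_prob_def finite_first_moment_def)
  from *(3) show "label_mean \<mu> < \<infinity>" "abs_mean \<mu> (\<lambda>u. u) 0 < \<infinity>"
    using nn_integral_l1_seq[of "\<lambda>u. u" \<mu>, OF borel_measurable_component[OF *(2)]] by auto
qed

lemma d1_seq_finite: "seq_prob \<mu> \<Longrightarrow> seq_prob \<nu> \<Longrightarrow> d1 l1_seq \<mu> \<nu> < \<infinity>"
  by (intro d1_finite l1_seq_triangle borel_measurable_l1_seq) (simp_all add: seq_probD)

text \<open>The bound of \<open>mean_diff_root_le\<close> with \<open>R0 = m0 + c0\<close>: the root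
  weights above a changed label belong to the approximating tree, whose root mean exceeds the
  limiting \<open>m0\<close> by at most \<open>c0\<close>.\<close>

definition sum_bound :: "real \<Rightarrow> real \<Rightarrow> real \<Rightarrow> real \<Rightarrow> real \<Rightarrow> nat \<Rightarrow> real" where
  "sum_bound m0 \<beta> R c0 c j =
    (case j of 0 \<Rightarrow> c0 | Suc i \<Rightarrow> (c0 * \<beta> + (m0 + c0) * c * (1 + real i * \<beta> / R)) * R ^ i)"

lemma coupling_components:
  assumes "seq_prob \<mu>'" "seq_prob \<nu>'" "\<gamma>' \<in> couplings \<mu>' \<nu>'"
  shows "(\<lambda>z. fst z k) \<in> borel_measurable \<gamma>'" "(\<lambda>z. snd z k) \<in> borel_measurable \<gamma>'"
    "offspring_mean \<gamma>' fst = label_mean \<mu>'" "offspring_mean \<gamma>' snd = label_mean \<nu>'"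
    "abs_mean \<gamma>' snd 0 = abs_mean \<nu>' (\<lambda>u. u) 0"
proof -
  note m = borel_measurable_component[OF seq_probD(2)[OF assms(1)]] borel_measurable_component[OF seq_probD(2)[OF assms(2)]]
  show "(\<lambda>z. fst z k) \<in> borel_measurable \<gamma>'" "(\<lambda>z. snd z k) \<in> borel_measurable \<gamma>'"
    using measurable_compose[OF couplingsD(5)[OF assms(3)] m(1)] measurable_compose[OF couplingsD(6)[OF assms(3)] m(2)] by auto
  have a: "abs_mean \<gamma>' fst k = abs_mean \<mu>' (\<lambda>u. u) k" for k
    by (rule nn_integral_coupling_fst[OF assms(3)]) (use m in simp)
  have b: "abs_mean \<gamma>' snd k = abs_mean \<nu>' (\<lambda>u. u) k" for k
    by (rule nn_integral_coupling_snd[OF assms(3)]) (use m in simp)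
  show "offspring_mean \<gamma>' fst = label_mean \<mu>'" "offspring_mean \<gamma>' snd = label_mean \<nu>'"
      "abs_mean \<gamma>' snd 0 = abs_mean \<nu>' (\<lambda>u. u) 0"
    by (simp_all add: offspring_mean_def a b)
qed

text \<open>The triangle inequality inside the coupling, coordinate by coordinate. The first
  direction supplies a common bound \<open>R\<close> for both means; together they bound the
  difference of the means by the cost.\<close>

lemma coupling_mean_le:
  assumes "seq_prob \<mu>'" "seq_prob \<nu>'" "\<gamma>' \<in> couplings \<mu>' \<nu>'" "cost l1_seq \<gamma>' \<le> ennreal c'"
  shows "label_mean \<mu>' \<le> label_mean \<nu>' + ennreal c'" "label_mean \<nu>' \<le> label_mean \<mu>' + ennreal c'"
proof -
  note [measurable] = coupling_components(1,2)[OF assms(1-3)]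
  have "offspring_mean \<gamma>' (\<lambda>z. fst z - snd z) \<le> cost l1_seq \<gamma>'"
    by (subst nn_integral_l1_seq) auto
  with assms(4) have d: "offspring_mean \<gamma>' (\<lambda>z. fst z - snd z) \<le> ennreal c'" by simp
  have "offspring_mean \<gamma>' fst \<le> offspring_mean \<gamma>' snd + offspring_mean \<gamma>' (\<lambda>z. fst z - snd z)"
    unfolding offspring_mean_def
    by (subst suminf_add)
       (auto intro!: suminf_le summableI nn_integral_mono simp flip: nn_integral_add ennreal_plus)
  also have "\<dots> \<le> offspring_mean \<gamma>' snd + ennreal c'" by (intro add_mono d order.refl)
  finally show "label_mean \<mu>' \<le> label_mean \<nu>' + ennreal c'" by (simp add: coupling_components[OF assms(1-3)])
  have "offspring_mean \<gamma>' snd \<le> offspring_mean \<gamma>' fst + offspring_mean \<gamma>' (\<lambda>z. fst z - snd z)"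
    unfolding offspring_mean_def
    by (subst suminf_add)
       (auto intro!: suminf_le summableI nn_integral_mono simp flip: nn_integral_add ennreal_plus)
  also have "\<dots> \<le> offspring_mean \<gamma>' fst + ennreal c'" by (intro add_mono d order.refl)
  finally show "label_mean \<nu>' \<le> label_mean \<mu>' + ennreal c'" by (simp add: coupling_components[OF assms(1-3)])
qed

context
  fixes \<mu>0 \<mu> \<nu>0 \<nu> :: "(nat \<Rightarrow> real) measure" and \<gamma>0 \<gamma> and c0 c :: real
  assumes \<mu>0: "seq_prob \<mu>0" and \<mu>: "seq_prob \<mu>" and \<nu>0: "seq_prob \<nu>0" and \<nu>: "seq_prob \<nu>"
    and \<gamma>0: "\<gamma>0 \<in> couplings \<mu>0 \<nu>0" and \<gamma>: "\<gamma> \<in> couplings \<mu> \<nu>"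
    and c0: "cost l1_seq \<gamma>0 \<le> ennreal c0" "c0 \<ge> 0"
    and c: "cost l1_seq \<gamma> \<le> ennreal c" "c \<ge> 0"
begin

lemma label_mean_diff: "\<bar>enn2real (label_mean \<mu>) - enn2real (label_mean \<nu>)\<bar> \<le> c"
proof -
  have "label_mean \<mu> = ennreal (enn2real (label_mean \<mu>))" "label_mean \<nu> = ennreal (enn2real (label_mean \<nu>))"
    using seq_probD(5)[OF \<mu>] seq_probD(5)[OF \<nu>] by simp_all
  then have "ennreal (enn2real (label_mean \<mu>)) \<le> ennreal (enn2real (label_mean \<nu>) + c)"
    "ennreal (enn2real (label_mean \<nu>)) \<le> ennreal (enn2real (label_mean \<mu>) + c)"
    using coupling_mean_le[OF \<mu> \<nu> \<gamma> c(1)] c(2) by (simp_all add: enn2real_nonneg)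
  then have "enn2real (label_mean \<mu>) \<le> enn2real (label_mean \<nu>) + c" "enn2real (label_mean \<nu>) \<le> enn2real (label_mean \<mu>) + c"
    using c(2) by (simp_all add: enn2real_nonneg del: ennreal_plus)
  then show ?thesis by linarith
qed

lemma sum_law_coupling_bound:
  assumes R: "R \<ge> enn2real (label_mean \<nu>) + c" "R > 0"
  obtains \<eta> where "\<eta> \<in> couplings (sum_law j \<mu>0 \<mu>) (sum_law j \<nu>0 \<nu>)"
    "cost l1_vec \<eta> \<le>
      ennreal (sum_bound (enn2real (label_mean \<nu>0)) (enn2real (abs_mean \<nu> (\<lambda>u. u) 0)) R c0 c j)"
proof -
  note D = seq_probD[OF \<mu>0] seq_probD[OF \<mu>] seq_probD[OF \<nu>0] seq_probD[OF \<nu>]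
  let ?m0 = "enn2real (label_mean \<nu>0)" and ?\<beta> = "enn2real (abs_mean \<nu> (\<lambda>u. u) 0)"
  have prod: "sets (\<mu>0 \<Otimes>\<^sub>M \<nu>0) = sets (\<mu> \<Otimes>\<^sub>M \<nu>)"
    using D by (intro sets_pair_measure_cong) auto
  then have "sets \<gamma>0 = sets \<gamma>"
    unfolding couplingsD(2)[OF \<gamma>0] couplingsD(2)[OF \<gamma>] .
  then interpret labelled_tree \<gamma>0 \<gamma>
    by (rule labelled_tree.intro[OF couplingsD(1)[OF \<gamma>0] couplingsD(1)[OF \<gamma>]])
  have fs: "fst \<in> measurable \<gamma> seq_space" "snd \<in> measurable \<gamma> seq_space"
    using couplingsD(5,6)[OF \<gamma>] D by (simp_all cong: measurable_cong_sets)
  have R': "offspring_mean \<gamma> fst \<le> ennreal R" "offspring_mean \<gamma> snd \<le> ennreal R"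
  proof -
    have \<nu>': "label_mean \<nu> = ennreal (enn2real (label_mean \<nu>))" using seq_probD(5)[OF \<nu>] by simp
    have "label_mean \<nu> + ennreal c = ennreal (enn2real (label_mean \<nu>) + c)"
      using \<nu>' c(2) by (simp add: enn2real_nonneg)
    also have "\<dots> \<le> ennreal R" using R by (intro ennreal_leI)
    finally have *: "label_mean \<nu> + ennreal c \<le> ennreal R" .
    with coupling_mean_le(1)[OF \<mu> \<nu> \<gamma> c(1)] show "offspring_mean \<gamma> fst \<le> ennreal R"
      unfolding coupling_components[OF \<mu> \<nu> \<gamma>] by (rule order.trans)
    show "offspring_mean \<gamma> snd \<le> ennreal R"
      unfolding coupling_components[OF \<mu> \<nu> \<gamma>] by (rule order.trans[OF _ *]) simp
  qed
  have \<beta>: "abs_mean \<gamma> snd 0 \<le> ennreal ?\<beta>"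
    using D unfolding coupling_components[OF \<mu> \<nu> \<gamma>] by simp
  have R0: "offspring_mean \<gamma>0 fst \<le> ennreal (?m0 + c0)"
    using coupling_mean_le(1)[OF \<mu>0 \<nu>0 \<gamma>0 c0(1)] c0(2) D
    unfolding coupling_components[OF \<mu>0 \<nu>0 \<gamma>0] by (simp add: enn2real_nonneg)
  obtain \<eta> where \<eta>: "\<eta> \<in> couplings (sum_law j \<mu>0 \<mu>) (sum_law j \<nu>0 \<nu>)"
    "cost l1_vec \<eta> \<le>
      (\<integral>\<^sup>+ z. diff_total (\<lambda>i. fst (z i)) (\<lambda>i. snd (z i)) [] j \<partial>tree_law \<gamma>0 \<gamma>)"
    using sum_law_coupling[OF D(1,7,2,8) D(13,19,14,20) D(3,9,15,21) \<gamma>0 \<gamma>] by blast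
  have "(\<integral>\<^sup>+ z. diff_total (\<lambda>i. fst (z i)) (\<lambda>i. snd (z i)) [] j \<partial>tree_law \<gamma>0 \<gamma>) \<le> ennreal (sum_bound ?m0 ?\<beta> R c0 c j)"
    using mean_diff_root_le[OF fs c(1,2) R' R(2) \<beta> _ c0 R0] c0(2)
    by (cases j) (simp_all add: sum_bound_def enn2real_nonneg del: diff_total.simps)
  with \<eta> show ?thesis using that order.trans by blast
qed

end

theorem sum_law_tendsto:
  assumes \<mu>0: "\<And>n. seq_prob (\<mu>0 n)" and \<mu>: "\<And>n. seq_prob (\<mu> n)" and \<nu>0: "seq_prob \<nu>0" and \<nu>: "seq_prob \<nu>"
    and lim: "(\<lambda>n. d1 l1_seq (\<mu>0 n) \<nu>0) \<longlonglongrightarrow> 0" "(\<lambda>n. d1 l1_seq (\<mu> n) \<nu>) \<longlonglongrightarrow> 0"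
  shows "(\<lambda>n. d1 l1_vec (sum_law j (\<mu>0 n) (\<mu> n)) (sum_law j \<nu>0 \<nu>)) \<longlonglongrightarrow> 0"
proof -
  obtain \<gamma>0 c0 where \<gamma>0: "\<And>n. \<gamma>0 n \<in> couplings (\<mu>0 n) \<nu>0" "\<And>n. cost l1_seq (\<gamma>0 n) \<le> ennreal (c0 n)"
    "\<And>n. c0 n \<ge> 0" "c0 \<longlonglongrightarrow> 0"
    using near_optimal_couplings[of \<mu>0 \<nu>0 l1_seq "\<lambda>_. 0"] seq_probD(1) \<mu>0 \<nu>0 d1_seq_finite[OF \<mu>0 \<nu>0] lim(1)
    by (auto simp: seq_probD)
  obtain \<gamma> c where \<gamma>: "\<And>n. \<gamma> n \<in> couplings (\<mu> n) \<nu>" "\<And>n. cost l1_seq (\<gamma> n) \<le> ennreal (c n)"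
    "\<And>n. c n \<ge> 0" "c \<longlonglongrightarrow> 0"
    using near_optimal_couplings[of \<mu> \<nu> l1_seq "\<lambda>_. 0"] seq_probD(1) \<mu> \<nu> d1_seq_finite[OF \<mu> \<nu>] lim(2)
    by (auto simp: seq_probD)
  let ?m0 = "enn2real (label_mean \<nu>0)" and ?\<beta> = "enn2real (abs_mean \<nu> (\<lambda>u. u) 0)"
  \<comment> \<open>The added 1 keeps \<open>R\<close> away from 0 even when the limiting mean
    vanishes; for fixed \<open>j\<close> a bounded power of \<open>R\<close> is good enough.\<close>
  let ?R = "\<lambda>n. enn2real (label_mean \<nu>) + c n + 1"
  let ?b = "\<lambda>n. sum_bound ?m0 ?\<beta> (?R n) (c0 n) (c n) j"
  have R: "?R n > 0" for n using enn2real_nonneg[of "label_mean \<nu>"] \<gamma>(3)[of n] by linarith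
  have le: "d1 l1_vec (sum_law j (\<mu>0 n) (\<mu> n)) (sum_law j \<nu>0 \<nu>) \<le> ennreal (?b n)" for n
  proof -
    have "?R n \<ge> enn2real (label_mean \<nu>) + c n" by simp
    then obtain \<eta> where "\<eta> \<in> couplings (sum_law j (\<mu>0 n) (\<mu> n)) (sum_law j \<nu>0 \<nu>)"
      "cost l1_vec \<eta> \<le> ennreal (?b n)"
      using R[of n] by (rule sum_law_coupling_bound[OF \<mu>0 \<mu> \<nu>0 \<nu> \<gamma>0(1) \<gamma>(1) \<gamma>0(2)[of n] \<gamma>0(3) \<gamma>(2)[of n] \<gamma>(3)])
    then show ?thesis using d1_le_coupling order.trans by blast
  qed
  have "?b \<longlonglongrightarrow> 0"
  proof (cases j)
    case 0
    then show ?thesis using \<gamma>0(4) by (simp add: sum_bound_def)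
  next
    case (Suc i)
    have "enn2real (label_mean \<nu>) + 0 + 1 \<noteq> 0" using enn2real_nonneg[of "label_mean \<nu>"] by linarith
    then have "?b \<longlonglongrightarrow> (0 * ?\<beta> + (?m0 + 0) * 0 * (1 + i * ?\<beta> / (enn2real (label_mean \<nu>) + 0 + 1))) * (enn2real (label_mean \<nu>) + 0 + 1) ^ i"
      unfolding sum_bound_def Suc nat.case by (intro tendsto_intros \<gamma>0 \<gamma>)
    then show ?thesis by simp
  qed
  then have "(\<lambda>n. ennreal (?b n)) \<longlonglongrightarrow> 0"
    using tendsto_ennrealI by fastforce
  then show ?thesis
    by (rule tendsto_sandwich[OF _ _ tendsto_const, rotated 2]) (simp_all add: le)
qed

text \<open>Bernoulli's inequality bounds the power below by \<open>1 - j x\<close> and the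
  exponential bounds it above by \<open>exp (j x)\<close>.\<close>

lemma power_tendsto_1:
  fixes a x :: "nat \<Rightarrow> real" and j :: "nat \<Rightarrow> nat"
  assumes a: "\<And>n. \<bar>a n - 1\<bar> \<le> x n" "x \<longlonglongrightarrow> 0" and jx: "(\<lambda>n. j n * x n) \<longlonglongrightarrow> 0"
  shows "(\<lambda>n. a n ^ j n) \<longlonglongrightarrow> 1"
proof (rule tendsto_sandwich)
  have small: "\<forall>\<^sub>F n in sequentially. x n < 1" using order_tendstoD(2)[OF a(2)] by simp
  then show "\<forall>\<^sub>F n in sequentially. 1 + of_nat (j n) * (- x n) \<le> a n ^ j n"
  proof eventually_elim
    case (elim n)
    have "1 + of_nat (j n) * (- x n) \<le> (1 + - x n) ^ j n"
      by (rule Bernoulli_inequality) (use elim in simp)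
    also have "\<dots> \<le> a n ^ j n" using a(1)[of n] elim by (intro power_mono) auto
    finally show ?case .
  qed
  from small show "\<forall>\<^sub>F n in sequentially. a n ^ j n \<le> exp (j n * x n)"
  proof eventually_elim
    case (elim n)
    have "a n ^ j n \<le> (1 + x n) ^ j n" using a(1)[of n] elim by (intro power_mono) auto
    also have "\<dots> \<le> exp (x n) ^ j n" using a(1)[of n] by (intro power_mono exp_ge_add_one_self) auto
    finally show ?case by (simp add: exp_of_nat_mult)
  qed
  show "(\<lambda>n. 1 + of_nat (j n) * (- x n)) \<longlonglongrightarrow> 1" using tendsto_diff[OF tendsto_const jx, of 1] by simp
  show "(\<lambda>n. exp (j n * x n)) \<longlonglongrightarrow> 1" using tendsto_exp[OF jx] by simp
qed

text \<open>The limit law \<open>L\<close> is arbitrary, so each case only has to supply the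
  convergence \<open>conv\<close> of its own limiting tree.\<close>

theorem sum_law_normalised_weak_conv:
  fixes \<rho> :: real and j :: "nat \<Rightarrow> nat"
  assumes \<mu>0: "\<And>n. seq_prob (\<mu>0 n)" and \<mu>: "\<And>n. seq_prob (\<mu> n)" and \<nu>0: "seq_prob \<nu>0" and \<nu>: "seq_prob \<nu>"
    and lim: "(\<lambda>n. d1 l1_seq (\<mu>0 n) \<nu>0) \<longlonglongrightarrow> 0" "(\<lambda>n. d1 l1_seq (\<mu> n) \<nu>) \<longlonglongrightarrow> 0"
      "(\<lambda>n. of_nat (j n) * d1 l1_seq (\<mu> n) \<nu>) \<longlonglongrightarrow> 0"
    and \<rho>: "\<rho> = enn2real (label_mean \<nu>)" "\<rho> > 0" and j: "filterlim j at_top sequentially"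
    and L: "real_distribution L"
    and conv: "\<And>f :: real \<Rightarrow> real. continuous_on UNIV f \<Longrightarrow> (\<And>x. \<bar>f x\<bar> \<le> 1) \<Longrightarrow>
      (\<lambda>n. \<integral>y. f (y / \<rho> ^ j n) \<partial>sum_law (j n) \<nu>0 \<nu>) \<longlonglongrightarrow> (\<integral>y. f y \<partial>L)"
  shows "weak_conv_m (\<lambda>n. distr (sum_law (j n) (\<mu>0 n) (\<mu> n)) borel (\<lambda>y. y / enn2real (label_mean (\<mu> n)) ^ j n)) L"
    and "weak_conv_m (\<lambda>n. distr (sum_law (j n) (\<mu>0 n) (\<mu> n)) borel (\<lambda>y. y / \<rho> ^ j n)) L"
proof -
  obtain \<gamma>0 c0 where \<gamma>0: "\<And>n. \<gamma>0 n \<in> couplings (\<mu>0 n) \<nu>0" "\<And>n. cost l1_seq (\<gamma>0 n) \<le> ennreal (c0 n)"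
    "\<And>n. c0 n \<ge> 0" "c0 \<longlonglongrightarrow> 0"
    using near_optimal_couplings[of \<mu>0 \<nu>0 l1_seq "\<lambda>_. 0"] seq_probD(1) \<mu>0 \<nu>0 d1_seq_finite[OF \<mu>0 \<nu>0] lim(1)
    by (auto simp: seq_probD)
  obtain \<gamma> c where \<gamma>: "\<And>n. \<gamma> n \<in> couplings (\<mu> n) \<nu>" "\<And>n. cost l1_seq (\<gamma> n) \<le> ennreal (c n)"
    "\<And>n. c n \<ge> 0" "c \<longlonglongrightarrow> 0" and jc: "(\<lambda>n. real (j n) * c n) \<longlonglongrightarrow> 0"
    using near_optimal_couplings[OF seq_probD(1)[OF \<mu>] seq_probD(1)[OF \<nu>] d1_seq_finite[OF \<mu> \<nu>] lim(2,3)] by blast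
  let ?m0 = "enn2real (label_mean \<nu>0)" and ?\<beta> = "enn2real (abs_mean \<nu> (\<lambda>u. u) 0)"
  \<comment> \<open>Here \<open>R\<close> is \<open>\<rho> + c n\<close> with nothing added:
    \<open>(R / \<rho>) ^ j n\<close> has to stay bounded, and \<open>\<rho> > 0\<close> already
    makes \<open>R\<close> positive.\<close>
  let ?b = "\<lambda>n. sum_bound ?m0 ?\<beta> (\<rho> + c n) (c0 n) (c n) (j n)"
  note nn = enn2real_nonneg[of "label_mean \<nu>0"] enn2real_nonneg[of "\<integral>\<^sup>+ u. ennreal \<bar>u 0\<bar> \<partial>\<nu>"]
  have "\<exists>\<eta>. \<eta> \<in> couplings (sum_law (j n) (\<mu>0 n) (\<mu> n)) (sum_law (j n) \<nu>0 \<nu>) \<and>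
      cost l1_vec \<eta> \<le> ennreal (?b n)" for n
  proof -
    have "\<rho> + c n \<ge> enn2real (label_mean \<nu>) + c n" "\<rho> + c n > 0"
      using \<rho> \<gamma>(3)[of n] by auto
    then obtain \<eta> where "\<eta> \<in> couplings (sum_law (j n) (\<mu>0 n) (\<mu> n)) (sum_law (j n) \<nu>0 \<nu>)"
      "cost l1_vec \<eta> \<le> ennreal (?b n)"
      by (rule sum_law_coupling_bound[OF \<mu>0 \<mu> \<nu>0 \<nu> \<gamma>0(1) \<gamma>(1) \<gamma>0(2)[of n] \<gamma>0(3) \<gamma>(2)[of n] \<gamma>(3)])
    then show ?thesis by (intro exI conjI)
  qed
  then have "\<exists>\<eta>. \<forall>n. \<eta> n \<in> couplings (sum_law (j n) (\<mu>0 n) (\<mu> n)) (sum_law (j n) \<nu>0 \<nu>) \<and>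
      cost l1_vec (\<eta> n) \<le> ennreal (?b n)"
    by (intro choice allI)
  then obtain \<eta> where \<eta>': "\<forall>n. \<eta> n \<in> couplings (sum_law (j n) (\<mu>0 n) (\<mu> n)) (sum_law (j n) \<nu>0 \<nu>) \<and>
      cost l1_vec (\<eta> n) \<le> ennreal (?b n)" ..
  note \<eta> = spec[OF \<eta>', THEN conjunct1] spec[OF \<eta>', THEN conjunct2]
  \<comment> \<open>Generation 0 has its own form in \<open>sum_bound\<close>; as \<open>j n\<close>
    tends to infinity, it can be discarded.\<close>
  have j1: "\<forall>\<^sub>F n in sequentially. 1 \<le> j n"
    using j by (auto simp: filterlim_at_top)
  have b_nonneg: "?b n \<ge> 0" for n
    using nn \<gamma>0(3)[of n] \<gamma>(3)[of n] \<rho>(2) by (auto simp: sum_bound_def split: nat.split)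
  have b0: "(\<lambda>n. ?b n / \<rho> ^ j n) \<longlonglongrightarrow> 0"
  proof (rule tendsto_sandwich[OF _ _ tendsto_const])
    \<comment> \<open>The exponential dominates \<open>((\<rho> + c n) / \<rho>) ^ i\<close>. The
      index \<open>j n\<close> now occurs only in the product \<open>j n * c n\<close>, so every
      term has a limit.\<close>
    let ?u = "\<lambda>n. (c0 n * ?\<beta> + (?m0 + c0 n) * (c n + real (j n) * c n * ?\<beta> / \<rho>)) * exp (real (j n) * c n / \<rho>) / \<rho>"
    show "\<forall>\<^sub>F n in sequentially. 0 \<le> ?b n / \<rho> ^ j n"
      using b_nonneg \<rho>(2) by simp
    show "\<forall>\<^sub>F n in sequentially. ?b n / \<rho> ^ j n \<le> ?u n"
      using j1
    proof eventually_elim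
      case (elim n)
      then obtain i where i: "j n = Suc i" by (cases "j n") auto
      note nonneg = nn \<gamma>0(3)[of n] \<gamma>(3)[of n] \<rho>(2)
      have "real i * ?\<beta> / (\<rho> + c n) \<le> real (j n) * ?\<beta> / \<rho>"
        using nonneg i by (intro frac_le mult_right_mono) auto
      then have 1: "c0 n * ?\<beta> + (?m0 + c0 n) * c n * (1 + real i * ?\<beta> / (\<rho> + c n))
        \<le> c0 n * ?\<beta> + (?m0 + c0 n) * c n * (1 + real (j n) * ?\<beta> / \<rho>)"
        using nonneg by (intro add_mono mult_left_mono) auto
      also have "\<dots> = c0 n * ?\<beta> + (?m0 + c0 n) * (c n + real (j n) * c n * ?\<beta> / \<rho>)"
        by (simp add: algebra_simps)
      finally have 2: "c0 n * ?\<beta> + (?m0 + c0 n) * c n * (1 + real i * ?\<beta> / (\<rho> + c n)) \<le> \<dots>" .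
      have "((\<rho> + c n) / \<rho>) ^ i = (1 + c n / \<rho>) ^ i" using \<rho>(2) by (simp add: add_divide_distrib)
      also have "\<dots> \<le> (1 + c n / \<rho>) ^ j n" using nonneg i by (intro power_increasing) auto
      also have "\<dots> \<le> exp (c n / \<rho>) ^ j n" using nonneg by (intro power_mono exp_ge_add_one_self) auto
      finally have 3: "((\<rho> + c n) / \<rho>) ^ i \<le> exp (real (j n) * c n / \<rho>)" by (simp add: exp_of_nat_mult[symmetric])
      have "?b n / \<rho> ^ j n = (c0 n * ?\<beta> + (?m0 + c0 n) * c n * (1 + real i * ?\<beta> / (\<rho> + c n))) * ((\<rho> + c n) / \<rho>) ^ i / \<rho>"
        using \<rho>(2) by (simp add: sum_bound_def i power_divide)
      also have "\<dots> \<le> ?u n"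
        using 2 3 nonneg by (intro divide_right_mono mult_mono) auto
      finally show ?case .
    qed
    have "?u \<longlonglongrightarrow> (0 * ?\<beta> + (?m0 + 0) * (0 + 0 * ?\<beta> / \<rho>)) * exp (0 / \<rho>) / \<rho>"
      using \<rho>(2) by (intro tendsto_intros \<gamma>0(4) \<gamma>(4) jc) auto
    then show "?u \<longlonglongrightarrow> 0" by simp
  qed
  \<comment> \<open>A bound, uniform in \<open>n\<close>, on the first moment of the normalised
    limiting sum. The root contributes \<open>?m0\<close> in place of one factor
    \<open>\<rho>\<close>, whence the quotient.\<close>
  define K where "K = ?m0 * ?\<beta> / \<rho>"
  have K: "K \<ge> 0" using nn \<rho>(2) by (simp add: K_def)
  have moment: "(\<integral>\<^sup>+ y. l1_vec y \<partial>sum_law (j n) \<nu>0 \<nu>) \<le> ennreal (K * \<rho> ^ j n)" if j: "1 \<le> j n" for n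
  proof -
    obtain i where i: "j n = Suc i" using j by (cases "j n") auto
    note D = seq_probD[OF \<nu>0] seq_probD[OF \<nu>]
    interpret labelled_tree \<nu>0 \<nu> using D by (intro labelled_tree_seq)
    have "(\<integral>\<^sup>+ y. l1_vec y \<partial>sum_law (j n) \<nu>0 \<nu>) \<le> (\<integral>\<^sup>+ v. abs_total v [] (j n) \<partial>tree_law \<nu>0 \<nu>)"
      using D by (intro nn_integral_sum_law_le)
    also have "\<dots> = label_mean \<nu>0 * (label_mean \<nu> ^ i * abs_mean \<nu> (\<lambda>u. u) 0)"
      using nn_integral_abs_total_root[OF measurable_ident_sets[OF D(8)], of i] by (simp add: i)
    also have "\<dots> = ennreal ?m0 * (ennreal \<rho> ^ i * ennreal ?\<beta>)"
      using D by (simp add: \<rho>(1))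
    also have "\<dots> = ennreal (?m0 * (\<rho> ^ i * ?\<beta>))"
      using nn \<rho>(2) by (simp add: ennreal_mult ennreal_power)
    also have "?m0 * (\<rho> ^ i * ?\<beta>) = K * \<rho> ^ j n"
      using \<rho>(2) by (simp add: K_def i)
    finally show ?thesis .
  qed
  \<comment> \<open>Both normalisations are instances: \<open>s n\<close> only has to be
    asymptotically equivalent to \<open>1 / \<rho> ^ j n\<close>.\<close>
  have main: "weak_conv_m (\<lambda>n. distr (sum_law (j n) (\<mu>0 n) (\<mu> n)) borel (\<lambda>y. s n * y)) L"
    if s: "\<And>n. s n \<ge> 0" "(\<lambda>n. s n * \<rho> ^ j n) \<longlonglongrightarrow> 1" for s
  proof (rule weak_conv_m_of_coupling[OF _ _ L \<eta>(1) s(1), where t = "\<lambda>n. 1 / \<rho> ^ j n"])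
    show "real_distribution (sum_law (j n) (\<mu>0 n) (\<mu> n))" for n
      by (rule real_distribution_sum_law[OF seq_probD(1)[OF \<mu>0] seq_probD(1)[OF \<mu>] seq_probD(2)[OF \<mu>0] seq_probD(2)[OF \<mu>]])
    show "real_distribution (sum_law (j n) \<nu>0 \<nu>)" for n
      by (rule real_distribution_sum_law[OF seq_probD(1)[OF \<nu>0] seq_probD(1)[OF \<nu>] seq_probD(2)[OF \<nu>0] seq_probD(2)[OF \<nu>]])
    show "(\<lambda>n. \<integral>y. f (1 / \<rho> ^ j n * y) \<partial>sum_law (j n) \<nu>0 \<nu>) \<longlonglongrightarrow> (\<integral>y. f y \<partial>L)"
      if "continuous_on UNIV f" "\<And>x. \<bar>f x\<bar> \<le> 1" for f :: "real \<Rightarrow> real"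
      using conv[OF that] by simp
    let ?h = "\<lambda>n. (s n * \<rho> ^ j n) * (?b n / \<rho> ^ j n) + \<bar>s n * \<rho> ^ j n - 1\<bar> * K"
    have "?h \<longlonglongrightarrow> 1 * 0 + \<bar>1 - 1\<bar> * K"
      by (intro tendsto_intros s b0)
    then have "?h \<longlonglongrightarrow> 0" by (simp only: mult_zero_right mult_zero_left diff_self abs_zero add_0)
    from tendsto_ennrealI[OF this] have lim_h: "(\<lambda>n. ennreal (?h n)) \<longlonglongrightarrow> 0" by (simp only: ennreal_0)
    have le_h: "\<forall>\<^sub>F n in sequentially. ennreal (s n) * cost l1_vec (\<eta> n)
        + ennreal \<bar>s n - 1 / \<rho> ^ j n\<bar> * (\<integral>\<^sup>+ y. l1_vec y \<partial>sum_law (j n) \<nu>0 \<nu>) \<le> ennreal (?h n)"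
      using j1
    proof eventually_elim
      case (elim n)
      have "ennreal (s n) * cost l1_vec (\<eta> n)
        + ennreal \<bar>s n - 1 / \<rho> ^ j n\<bar> * (\<integral>\<^sup>+ y. l1_vec y \<partial>sum_law (j n) \<nu>0 \<nu>)
        \<le> ennreal (s n) * ennreal (?b n) + ennreal \<bar>s n - 1 / \<rho> ^ j n\<bar> * ennreal (K * \<rho> ^ j n)"
        by (intro add_mono mult_left_mono \<eta> moment elim) auto
      also have "\<dots> = ennreal (s n * ?b n + \<bar>s n - 1 / \<rho> ^ j n\<bar> * (K * \<rho> ^ j n))"
        using s(1)[of n] b_nonneg[of n] K \<rho>(2) by (simp add: ennreal_mult)
      also have "s n * ?b n = (s n * \<rho> ^ j n) * (?b n / \<rho> ^ j n)" using \<rho>(2) by simp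
      also have "\<bar>s n - 1 / \<rho> ^ j n\<bar> * (K * \<rho> ^ j n) = \<bar>(s n - 1 / \<rho> ^ j n) * \<rho> ^ j n\<bar> * K"
        using \<rho>(2) by (simp add: abs_mult)
      also have "(s n - 1 / \<rho> ^ j n) * \<rho> ^ j n = s n * \<rho> ^ j n - 1"
        using \<rho>(2) by (simp add: left_diff_distrib)
      finally show ?case .
    qed
    show "(\<lambda>n. ennreal (s n) * cost l1_vec (\<eta> n)
        + ennreal \<bar>s n - 1 / \<rho> ^ j n\<bar> * (\<integral>\<^sup>+ y. l1_vec y \<partial>sum_law (j n) \<nu>0 \<nu>)) \<longlonglongrightarrow> 0"
      by (rule tendsto_sandwich[OF _ le_h tendsto_const lim_h]) (intro always_eventually allI zero_le)
  qed
  \<comment> \<open>The mean of \<open>\<mu> n\<close> is within \<open>c n\<close> of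
    \<open>\<rho>\<close>, so \<open>j n * c n \<rightarrow> 0\<close> makes the ratio of the powers
    tend to 1. The mean can vanish for finitely many \<open>n\<close> only, where the value of the
    division does not affect the limit.\<close>
  have "weak_conv_m (\<lambda>n. distr (sum_law (j n) (\<mu>0 n) (\<mu> n)) borel (\<lambda>y. (1 / enn2real (label_mean (\<mu> n)) ^ j n) * y)) L"
  proof (rule main)
    have "\<bar>enn2real (label_mean (\<mu> n)) / \<rho> - 1\<bar> \<le> c n / \<rho>" for n
    proof -
      have "enn2real (label_mean (\<mu> n)) / \<rho> - 1 = (enn2real (label_mean (\<mu> n)) - \<rho>) / \<rho>"
        using \<rho>(2) by (simp add: diff_divide_distrib)
      then show ?thesis
        using label_mean_diff[OF \<mu>0 \<mu> \<nu>0 \<nu> \<gamma>0(1) \<gamma>(1) \<gamma>0(2)[of n] \<gamma>0(3) \<gamma>(2)[of n] \<gamma>(3)] \<rho>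
        by (simp add: abs_divide divide_right_mono)
    qed
    then have "(\<lambda>n. (enn2real (label_mean (\<mu> n)) / \<rho>) ^ j n) \<longlonglongrightarrow> 1"
      using tendsto_divide[OF \<gamma>(4) tendsto_const, of \<rho>] tendsto_divide[OF jc tendsto_const, of \<rho>] \<rho>(2)
      by (intro power_tendsto_1[where x = "\<lambda>n. c n / \<rho>"]) auto
    then have "(\<lambda>n. inverse ((enn2real (label_mean (\<mu> n)) / \<rho>) ^ j n)) \<longlonglongrightarrow> inverse 1"
      by (rule tendsto_inverse) simp
    then show "(\<lambda>n. 1 / enn2real (label_mean (\<mu> n)) ^ j n * \<rho> ^ j n) \<longlonglongrightarrow> 1"
      by (simp add: power_divide)
  qed simp
  then show "weak_conv_m (\<lambda>n. distr (sum_law (j n) (\<mu>0 n) (\<mu> n)) borel (\<lambda>y. y / enn2real (label_mean (\<mu> n)) ^ j n)) L"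
    by simp
  have "weak_conv_m (\<lambda>n. distr (sum_law (j n) (\<mu>0 n) (\<mu> n)) borel (\<lambda>y. (1 / \<rho> ^ j n) * y)) L"
    by (rule main) (use \<rho>(2) in auto)
  then show "weak_conv_m (\<lambda>n. distr (sum_law (j n) (\<mu>0 n) (\<mu> n)) borel (\<lambda>y. y / \<rho> ^ j n)) L"
    by simp
qed

section \<open>The martingale of a labelled tree\<close>

lemma nn_integral_count_space_swap:
  assumes "countable A" "sigma_finite_measure M" and f: "\<And>s. s \<in> A \<Longrightarrow> f s \<in> borel_measurable M"
  shows "(\<integral>\<^sup>+ z. \<integral>\<^sup>+ s. f s z \<partial>count_space A \<partial>M) = (\<integral>\<^sup>+ s. \<integral>\<^sup>+ z. f s z \<partial>M \<partial>count_space A)"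
    and "(\<lambda>z. \<integral>\<^sup>+ s. f s z \<partial>count_space A) \<in> borel_measurable M"
proof -
  interpret M: sigma_finite_measure M by fact
  interpret A: sigma_finite_measure "count_space A"
    using assms(1) by (rule sigma_finite_measure_count_space_countable)
  interpret pair_sigma_finite M "count_space A" ..
  have 1: "(\<lambda>(s, z). f s z) \<in> borel_measurable (count_space A \<Otimes>\<^sub>M M)"
    by (rule measurable_pair_measure_countable1[OF assms(1)]) (simp add: f)
  then have 2: "(\<lambda>(z, s). f s z) \<in> borel_measurable (M \<Otimes>\<^sub>M count_space A)"
    by (subst measurable_pair_swap_iff) (simp add: split_def)
  show "(\<integral>\<^sup>+ z. \<integral>\<^sup>+ s. f s z \<partial>count_space A \<partial>M) = (\<integral>\<^sup>+ s. \<integral>\<^sup>+ z. f s z \<partial>M \<partial>count_space A)"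
    using Fubini'[OF 2] by simp
  show "(\<lambda>z. \<integral>\<^sup>+ s. f s z \<partial>count_space A) \<in> borel_measurable M"
    using A.borel_measurable_nn_integral[OF 2] by simp
qed

text \<open>Passing to the next generation attaches children to the leaves, so the martingale step
  needs the last letter.\<close>

lemma nn_integral_words_snoc:
  "(\<integral>\<^sup>+ t. f t \<partial>count_space (words (Suc j))) = (\<integral>\<^sup>+ s. (\<Sum>r. f (s @ [Suc r])) \<partial>count_space (words j))"
proof (induction j arbitrary: f)
  case 0
  show ?case by (simp add: nn_integral_words_Suc nn_integral_count_space_finite)
next
  case (Suc j)
  show ?case
    by (subst (1 2) nn_integral_words_Suc) (simp add: Suc)
qed

text \<open>A path from \<open>p\<close> reads the labels at the nodes before its endpoint, but not
  the label of the endpoint itself; hence equality of lengths is allowed.\<close>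

lemma path_prod_fun_upd: "length p + length s \<le> length i \<Longrightarrow> path_prod (v(i := x)) p s = path_prod v p s"
proof (induction s arbitrary: p)
  case (Cons r s)
  then have "p \<noteq> i" by auto
  with Cons show ?case by (simp del: fun_upd_apply add: fun_upd_other)
qed simp

text \<open>The absolute generation sum with \<open>Q = 1\<close>, kept in \<open>ennreal\<close> so
  that no convergence has to be checked before the moments are known.\<close>

definition mass :: "nat \<Rightarrow> (nat list \<Rightarrow> nat \<Rightarrow> real) \<Rightarrow> ennreal" where
  "mass j v = (\<integral>\<^sup>+ s. ennreal \<bar>path_prod v [] s\<bar> \<partial>count_space (words j))"

lemma mass_fun_upd: "j \<le> length i \<Longrightarrow> mass j (v(i := x)) = mass j v"
  unfolding mass_def by (intro nn_integral_cong) (simp add: words_def path_prod_fun_upd)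

lemma countable_nodes: "countable (A :: nat list set)"
  by (rule countableI_type)

text \<open>A substitute for the sigma-algebra of the labels in generations below \<open>n\<close>:
  invariance under changing one later label is what resampling a node asks for, and it passes to
  complements and countable unions. Tail events are invariant too and may belong to it, without harm
  to the martingale identity.\<close>

definition before_generation :: "(nat list \<Rightarrow> nat \<Rightarrow> real) measure \<Rightarrow> nat \<Rightarrow> (nat list \<Rightarrow> nat \<Rightarrow> real) set set" where
  "before_generation P n = {A \<in> sets P. \<forall>i\<in>nodes. n \<le> length i \<longrightarrow> (\<forall>v\<in>space P. \<forall>u. v(i := u) \<in> A \<longleftrightarrow> v \<in> A)}"

text \<open>From generation \<open>n\<close> to \<open>n + 1\<close> every leaf is multiplied by the
  weights of a fresh label with mean total \<open>\<rho>\<close>, so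
  \<open>mass n / \<rho> ^ n\<close> is a martingale. The argument runs with absolute values;
  nonnegativity and \<open>Q = 1\<close> identify \<open>mass\<close> with the generation sum at the
  end.\<close>

lemma tree_sum_martingale_convergent:
  assumes \<mu>: "prob_space \<mu>" "sets \<mu> = sets seq_space"
    and \<rho>: "offspring_mean \<mu> (\<lambda>u. u) = ennreal \<rho>" "\<rho> > 0"
    and label: "AE u in \<mu>. u 0 = 1 \<and> (\<forall>r. u (Suc r) \<ge> 0)"
  shows "AE v in tree_law \<mu> \<mu>. convergent (\<lambda>j. tree_sum j v / \<rho> ^ j)"
proof -
  interpret labelled_tree \<mu> \<mu> using \<mu> by (intro labelled_tree_seq)
  interpret P: prob_space P using \<mu> by (intro prob_space_tree_law)
  have id: "(\<lambda>u. u) \<in> measurable \<mu> seq_space" by (rule measurable_ident_sets[OF \<mu>(2)])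
  note coord = coordinate_measurable[OF id]
  have spM: "space \<mu> = UNIV" using sets_eq_imp_space_eq[OF \<mu>(2)] by (simp add: space_PiM)
  have spP: "space P = extensional nodes" by (auto simp: tree_law_def space_PiM spM PiE_def)
  have upd_space: "v(i := u) \<in> space P" if "v \<in> space P" "i \<in> nodes" for v i u
    using that by (auto simp: spP extensional_def)
  have path_measurable: "(\<lambda>v. path_prod v p s) \<in> borel_measurable P" if "p \<in> nodes" "s \<in> nodes" for p s
    using that
  proof (induction s arbitrary: p)
    case (Cons r s)
    have "(\<lambda>v. path_prod v (p @ [r]) s) \<in> borel_measurable P" using Cons by simp
    with coord[OF Cons.prems(1)] show ?case by simp
  qed simp
  have words: "s \<in> nodes" "length s = j" if "s \<in> words j" for s j using that by (auto simp: words_def)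
  have path_measurable': "(\<lambda>v. ennreal \<bar>path_prod v [] s\<bar>) \<in> borel_measurable P" if "s \<in> words j" for s j
    using path_measurable[OF _ words(1)[OF that], of "[]"] by simp
  have mass_measurable: "mass j \<in> borel_measurable P" for j
    unfolding mass_def
    by (rule nn_integral_count_space_swap(2)[OF countable_nodes P.sigma_finite_measure_axioms path_measurable'])
  define F where "F n = sigma (space P) (before_generation P n)" for n
  have Pow: "before_generation P n \<subseteq> Pow (space P)" for n
    using sets.sets_into_space by (auto simp: before_generation_def)
  have sigma: "sigma_algebra (space P) (before_generation P n)" for n
  proof (rule sigma_algebra_iff2[THEN iffD2], intro conjI ballI allI impI)
    show "before_generation P n \<subseteq> Pow (space P)" by (rule Pow)
    show "{} \<in> before_generation P n" by (simp add: before_generation_def)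
    show "space P - A \<in> before_generation P n" if "A \<in> before_generation P n" for A
      using that upd_space by (auto simp: before_generation_def)
    show "(\<Union>i. A i) \<in> before_generation P n" if "range A \<subseteq> before_generation P n" for A :: "nat \<Rightarrow> _"
    proof -
      have "A i \<in> before_generation P n" for i using that by auto
      then show ?thesis by (auto simp: before_generation_def)
    qed
  qed
  have setsF: "sets (F n) = before_generation P n" and spF: "space (F n) = space P" for n
    using sigma_algebra.sigma_sets_eq[OF sigma] by (simp_all add: F_def sets_measure_of[OF Pow] space_measure_of[OF Pow])
  define X where "X j v = enn2real (mass j v) / \<rho> ^ j" for j v
  \<comment> \<open>For \<open>s\<close> of length \<open>n\<close>, neither \<open>A\<close> nor
    the path to \<open>s\<close> is affected by the label of \<open>s\<close>, which carries the
    weights of its children. Integrating this label out leaves the factor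
    \<open>\<rho>\<close>.\<close>
  have step: "(\<integral>\<^sup>+ v. indicator A v * mass (Suc n) v \<partial>P) = ennreal \<rho> * (\<integral>\<^sup>+ v. indicator A v * mass n v \<partial>P)"
    if A: "A \<in> before_generation P n" for A n
  proof -
    have AP: "A \<in> sets P" using A by (simp add: before_generation_def)
    define h where "h s v = indicator A v * ennreal \<bar>path_prod v [] s\<bar>" for s v
    have h_measurable: "h s \<in> borel_measurable P" if "s \<in> words n" for s
      unfolding h_def by (intro borel_measurable_times_ennreal borel_measurable_indicator AP path_measurable'[OF that])
    have "(\<integral>\<^sup>+ v. indicator A v * mass (Suc n) v \<partial>P) =
      (\<integral>\<^sup>+ v. \<integral>\<^sup>+ s. (\<Sum>r. ennreal \<bar>v s (Suc r)\<bar> * h s v) \<partial>count_space (words n) \<partial>P)"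
    proof (intro nn_integral_cong)
      fix v
      have "mass (Suc n) v = (\<integral>\<^sup>+ s. (\<Sum>r. ennreal \<bar>path_prod v [] s\<bar> * ennreal \<bar>v s (Suc r)\<bar>) \<partial>count_space (words n))"
        unfolding mass_def nn_integral_words_snoc path_prod_snoc append_Nil abs_mult
        by (simp only: ennreal_mult abs_ge_zero)
      then show "indicator A v * mass (Suc n) v =
          (\<integral>\<^sup>+ s. (\<Sum>r. ennreal \<bar>v s (Suc r)\<bar> * h s v) \<partial>count_space (words n))"
        by (simp only: h_def nn_integral_cmult[symmetric] borel_measurable_count_space ennreal_suminf_cmult[symmetric])
          (simp only: mult.commute mult.left_commute)
    qed
    also have "\<dots> = (\<integral>\<^sup>+ s. \<integral>\<^sup>+ v. (\<Sum>r. ennreal \<bar>v s (Suc r)\<bar> * h s v) \<partial>P \<partial>count_space (words n))"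
      by (intro nn_integral_count_space_swap(1) countable_nodes P.sigma_finite_measure_axioms
          borel_measurable_suminf_order borel_measurable_times_ennreal h_measurable
          measurable_compose[OF _ measurable_ennreal] borel_measurable_abs coord words) auto
    also have "\<dots> = (\<integral>\<^sup>+ s. ennreal \<rho> * (\<integral>\<^sup>+ v. h s v \<partial>P) \<partial>count_space (words n))"
    proof (intro nn_integral_cong)
      fix s assume "s \<in> space (count_space (words n))"
      then have s: "s \<in> words n" by simp
      have h_upd: "h s (v(s := u)) = h s v" if "v \<in> space P" for v u
      proof -
        have "v(s := u) \<in> A \<longleftrightarrow> v \<in> A"
          using A that words[OF s] by (simp add: before_generation_def)
        then show ?thesis
          by (simp add: h_def path_prod_fun_upd indicator_def del: fun_upd_apply)
      qed
      have "(\<integral>\<^sup>+ v. (\<Sum>r. ennreal \<bar>v s (Suc r)\<bar> * h s v) \<partial>P) = (\<Sum>r. \<integral>\<^sup>+ v. ennreal \<bar>v s (Suc r)\<bar> * h s v \<partial>P)"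
        by (intro nn_integral_suminf borel_measurable_times_ennreal h_measurable[OF s]
            measurable_compose[OF _ measurable_ennreal] borel_measurable_abs coord words[OF s])
      also have "\<dots> = (\<Sum>r. abs_mean \<mu> (\<lambda>u. u) (Suc r) * (\<integral>\<^sup>+ v. h s v \<partial>P))"
      proof (intro arg_cong[where f = suminf] ext)
        fix r
        have g: "(\<lambda>u. ennreal \<bar>u (Suc r)\<bar>) \<in> borel_measurable \<mu>"
          using coordinate_measurable'[OF id] by simp
        have "(\<integral>\<^sup>+ v. ennreal \<bar>v s (Suc r)\<bar> * h s v \<partial>P) =
            (\<integral>\<^sup>+ u. ennreal \<bar>u (Suc r)\<bar> \<partial>(if s = [] then \<mu> else \<mu>)) * (\<integral>\<^sup>+ v. h s v \<partial>P)"
          by (rule nn_integral_tree_law_mult[OF \<mu>(1) \<mu>(1) refl words(1)[OF s] g h_measurable[OF s]]) (rule h_upd)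
        then show "(\<integral>\<^sup>+ v. ennreal \<bar>v s (Suc r)\<bar> * h s v \<partial>P) = abs_mean \<mu> (\<lambda>u. u) (Suc r) * (\<integral>\<^sup>+ v. h s v \<partial>P)"
          by simp
      qed
      also have "\<dots> = ennreal \<rho> * (\<integral>\<^sup>+ v. h s v \<partial>P)"
        by (simp add: \<rho>(1)[symmetric] offspring_mean_def ennreal_suminf_multc)
      finally show "(\<integral>\<^sup>+ v. (\<Sum>r. ennreal \<bar>v s (Suc r)\<bar> * h s v) \<partial>P)
        = ennreal \<rho> * (\<integral>\<^sup>+ v. h s v \<partial>P)" .
    qed
    also have "\<dots> = ennreal \<rho> * (\<integral>\<^sup>+ s. (\<integral>\<^sup>+ v. h s v \<partial>P) \<partial>count_space (words n))"
      by (rule nn_integral_cmult) simp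
    also have "(\<integral>\<^sup>+ s. (\<integral>\<^sup>+ v. h s v \<partial>P) \<partial>count_space (words n)) =
        (\<integral>\<^sup>+ v. \<integral>\<^sup>+ s. h s v \<partial>count_space (words n) \<partial>P)"
      by (intro nn_integral_count_space_swap(1)[symmetric] countable_nodes P.sigma_finite_measure_axioms h_measurable)
    also have "\<dots> = (\<integral>\<^sup>+ v. indicator A v * mass n v \<partial>P)"
      unfolding mass_def h_def by (intro nn_integral_cong nn_integral_cmult) simp
    finally show ?thesis .
  qed
  have space_before: "space P \<in> before_generation P n" for n
    using upd_space by (auto simp: before_generation_def)
  have mass_mean: "(\<integral>\<^sup>+ v. mass n v \<partial>P) = ennreal (\<rho> ^ n)" for n
  proof (induction n)
    case 0
    show ?case by (simp add: mass_def nn_integral_count_space_finite P.emeasure_space_1)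
  next
    case (Suc n)
    have "(\<integral>\<^sup>+ v. indicator (space P) v * mass m v \<partial>P) = (\<integral>\<^sup>+ v. mass m v \<partial>P)" for m
      by (intro nn_integral_cong) simp
    with step[OF space_before, of n] Suc \<rho>(2) show ?case by (simp add: ennreal_mult)
  qed
  have mass_finite: "AE v in P. mass n v \<noteq> \<infinity>" for n
    by (rule nn_integral_noteq_infinite[OF mass_measurable]) (simp add: mass_mean)
  have X_measurable [measurable]: "X n \<in> borel_measurable P" for n
    unfolding X_def by (intro borel_measurable_divide borel_measurable_const borel_measurable_enn2real mass_measurable)
  \<comment> \<open>\<open>X\<close> is real while \<open>mass\<close> is extended; they agree
    almost everywhere because the mean of \<open>mass\<close> is finite.\<close>
  have X_mean: "(\<integral>\<^sup>+ v. indicator A v * ennreal (X n v) \<partial>P) = ennreal (1 / \<rho> ^ n) * (\<integral>\<^sup>+ v. indicator A v * mass n v \<partial>P)"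
    if [measurable]: "A \<in> sets P" for A n
  proof -
    have "(\<integral>\<^sup>+ v. indicator A v * ennreal (X n v) \<partial>P) = (\<integral>\<^sup>+ v. ennreal (1 / \<rho> ^ n) * (indicator A v * mass n v) \<partial>P)"
      using mass_finite[of n]
    proof (intro nn_integral_cong_AE, eventually_elim)
      case (elim v)
      have "X n v = (1 / \<rho> ^ n) * enn2real (mass n v)" by (simp add: X_def)
      also have "ennreal \<dots> = ennreal (1 / \<rho> ^ n) * ennreal (enn2real (mass n v))"
        by (rule ennreal_mult) (use \<rho>(2) in auto)
      also have "ennreal (enn2real (mass n v)) = mass n v"
        using elim by (simp add: less_top)
      finally have "ennreal (X n v) = ennreal (1 / \<rho> ^ n) * mass n v" .
      then show ?case by (simp add: mult_ac)
    qed
    then show ?thesis using mass_measurable by (simp add: nn_integral_cmult)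
  qed
  have X_nonneg: "0 \<le> X n v" for n v using \<rho>(2) by (simp add: X_def)
  have X_integrable: "integrable P (X n)" for n
  proof (rule integrableI_nonneg)
    have "(\<integral>\<^sup>+ v. ennreal (X n v) \<partial>P) = (\<integral>\<^sup>+ v. indicator (space P) v * ennreal (X n v) \<partial>P)"
      by (intro nn_integral_cong) simp
    also have "\<dots> = ennreal (1 / \<rho> ^ n) * (\<integral>\<^sup>+ v. indicator (space P) v * mass n v \<partial>P)"
      by (rule X_mean) simp
    also have "(\<integral>\<^sup>+ v. indicator (space P) v * mass n v \<partial>P) = ennreal (\<rho> ^ n)"
      unfolding mass_mean[symmetric] by (intro nn_integral_cong) simp
    finally show "(\<integral>\<^sup>+ v. ennreal (X n v) \<partial>P) < \<infinity>"
      by (simp add: ennreal_mult_less_top)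
  qed (use X_nonneg in auto)
  have "AE v in P. convergent (\<lambda>n. X n v)"
  proof (rule nonneg_martingale_AE_convergent[of P F])
    show "prob_space P" by (rule P.prob_space_axioms)
    show "subalgebra P (F n)" for n
      unfolding subalgebra_def setsF spF by (auto simp: before_generation_def)
    show "sets (F m) \<subseteq> sets (F n)" if "m \<le> n" for m n
      using that unfolding setsF by (auto simp: before_generation_def)
    show "X n \<in> borel_measurable (F n)" for n
    proof (rule measurableI)
      fix B :: "real set" assume "B \<in> sets borel"
      then have "X n -` B \<inter> space P \<in> sets P"
        by (rule measurable_sets[OF X_measurable])
      then show "X n -` B \<inter> space (F n) \<in> sets (F n)"
        unfolding setsF spF using upd_space
        by (auto simp: before_generation_def X_def mass_fun_upd simp del: fun_upd_apply)
    qed simp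
    show "integrable P (X n)" "0 \<le> X n v" for n v by (rule X_integrable X_nonneg)+
    show "(\<integral>v. indicator A v * X (Suc n) v \<partial>P) = (\<integral>v. indicator A v * X n v \<partial>P)" if "A \<in> sets (F n)" for n A
    proof -
      have A: "A \<in> before_generation P n" using that by (simp add: setsF)
      then have AP [measurable]: "A \<in> sets P" by (simp add: before_generation_def)
      have eq: "(\<integral>v. indicator A v * X m v \<partial>P) = enn2real (\<integral>\<^sup>+ v. indicator A v * ennreal (X m v) \<partial>P)" for m
        by (subst integral_eq_nn_integral)
           (auto simp: X_nonneg ennreal_mult ennreal_indicator)
      have "(\<integral>\<^sup>+ v. indicator A v * ennreal (X (Suc n) v) \<partial>P) = ennreal (1 / \<rho> ^ Suc n) * (ennreal \<rho> * (\<integral>\<^sup>+ v. indicator A v * mass n v \<partial>P))"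
        unfolding X_mean[OF AP] step[OF A] ..
      also have "\<dots> = ennreal (1 / \<rho> ^ Suc n * \<rho>) * (\<integral>\<^sup>+ v. indicator A v * mass n v \<partial>P)"
        using \<rho>(2) by (subst ennreal_mult) (auto simp: mult.assoc)
      also have "1 / \<rho> ^ Suc n * \<rho> = 1 / \<rho> ^ n" using \<rho>(2) by simp
      finally show ?thesis unfolding eq X_mean[OF AP] by simp
    qed
  qed
  moreover have "AE v in P. \<forall>i\<in>nodes. v i 0 = 1 \<and> (\<forall>r. v i (Suc r) \<ge> 0)"
  proof (rule AE_ball_countable[THEN iffD2, OF countable_nodes], rule ballI)
    fix i :: "nat list" assume i: "i \<in> nodes"
    have "distr P \<mu> (\<lambda>v. v i) = \<mu>"
      unfolding tree_law_def using distr_PiM_component[of nodes "\<lambda>i. if i = [] then \<mu> else \<mu>" i] \<mu>(1) i by simp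
    from label have "AE u in distr P \<mu> (\<lambda>v. v i). u 0 = 1 \<and> (\<forall>r. u (Suc r) \<ge> 0)"
      unfolding \<open>distr P \<mu> (\<lambda>v. v i) = \<mu>\<close> .
    from AE_distrD[OF component_measurable[OF i] this]
    show "AE v in P. v i 0 = 1 \<and> (\<forall>r. v i (Suc r) \<ge> 0)" .
  qed
  ultimately show ?thesis
  proof eventually_elim
    case (elim v)
    have pos: "path_prod v p s \<ge> 0" if "p \<in> nodes" "s \<in> nodes" for p s
      using that
    proof (induction s arbitrary: p)
      case (Cons r s)
      then have "v p r \<ge> 0" using elim(2) by (cases r) auto
      with Cons show ?case by simp
    qed simp
    have "tree_sum j v = enn2real (mass j v)" for j
    proof -
      have "tree_sum j v = (\<integral>s. \<bar>path_prod v [] s\<bar> \<partial>count_space (words j))"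
        unfolding tree_sum_def
        using elim(2) pos[of "[]"] by (intro Bochner_Integration.integral_cong) (auto simp: contribution_def words)
      then show ?thesis by (simp add: integral_eq_nn_integral mass_def)
    qed
    with elim(1) show ?case by (simp add: X_def)
  qed
qed

lemma generation_subset_words: "generation N j \<omega> \<subseteq> words j"
  by (induction j) (auto simp: words_def)

lemma generation_snoc:
  "s @ [r] \<in> generation N (length (s @ [r])) \<omega> \<longleftrightarrow> s \<in> generation N (length s) \<omega> \<and> 1 \<le> r \<and> enat r \<le> N s \<omega>"
  by auto

text \<open>Reduces each case to an identity between single contributions; words outside the
  generation add zeros.\<close>

lemma W_eq_tree_sum:
  assumes "\<And>s. s \<in> nodes \<Longrightarrow> contribution v [] s =
    (if s \<in> generation N (length s) \<omega> then Q s \<omega> * path_weight C s \<omega> else 0)"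
  shows "W Q N C j \<omega> = tree_sum j v"
  unfolding W_def tree_sum_def infsum_eq_integral_count_space[symmetric]
  using generation_subset_words[of N j \<omega>] by (intro infsum_cong_neutral) (auto simp: assms words_def)

section \<open>Weighted branching processes as labelled trees\<close>

definition wbp_label :: "wbp_vector \<Rightarrow> nat \<Rightarrow> real" where
  "wbp_label = (\<lambda>(q, m, c) k. if k = 0 then q else if enat k \<le> m then c k else 0)"

lemma wbp_mu_eq: "wbp_mu G = distr G seq_space wbp_label"
  by (simp add: wbp_mu_def wbp_label_def)

lemma wbp_label_measurable [measurable]: "wbp_label \<in> measurable wbp_space seq_space"
proof (rule measurable_PiM_single')
  fix k :: nat
  have [measurable]: "(\<lambda>x. snd (snd x) k) \<in> borel_measurable wbp_space" if "k \<ge> 1"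
  proof -
    have "(\<lambda>x. snd (snd x)) \<in> measurable wbp_space (PiM {1..} (\<lambda>_. borel))"
      unfolding wbp_space_def by (rule measurable_compose[OF measurable_snd measurable_snd])
    from measurable_compose[OF this measurable_component_singleton[of k]] that show ?thesis by simp
  qed
  have N: "(\<lambda>x. fst (snd x)) \<in> measurable wbp_space (count_space UNIV)"
    unfolding wbp_space_def by measurable
  have [measurable]: "Measurable.pred wbp_space (\<lambda>x. enat k \<le> fst (snd x))"
    by (rule measurable_compose[OF N, of "\<lambda>m. enat k \<le> m"]) (simp only: measurable_count_space_eq1 space_count_space Pi_UNIV UNIV_I)
  have [measurable]: "fst \<in> borel_measurable wbp_space"
    unfolding wbp_space_def by measurable
  show "(\<lambda>x. wbp_label x k) \<in> borel_measurable wbp_space"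
    by (cases "k = 0") (simp_all add: wbp_label_def split_def)
qed auto

text \<open>Induction on the last letter, since \<open>generation\<close> and
  \<open>path_weight\<close> grow by appending. A child beyond the offspring number gets weight 0,
  which annihilates every path through it.\<close>

lemma contribution_wbp_label:
  fixes Q C :: "nat list \<Rightarrow> 'a \<Rightarrow> real" and N :: "nat list \<Rightarrow> 'a \<Rightarrow> enat"
  defines "v \<omega> i \<equiv> wbp_label (Q i \<omega>, N i \<omega>, \<lambda>r\<in>{1..}. C (i @ [r]) \<omega>)"
  shows "s \<in> nodes \<Longrightarrow> contribution (v \<omega>) [] s =
    (if s \<in> generation N (length s) \<omega> then Q s \<omega> * path_weight C s \<omega> else 0)"
proof -
  have "s \<in> nodes \<Longrightarrow> path_prod (v \<omega>) [] s = (if s \<in> generation N (length s) \<omega> then path_weight C s \<omega> else 0)" for s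
  proof (induction s rule: rev_induct)
    case (snoc r s)
    then have "v \<omega> s r = (if enat r \<le> N s \<omega> then C (s @ [r]) \<omega> else 0)" by (simp add: v_def wbp_label_def)
    with snoc show ?case
      unfolding path_prod_snoc generation_snoc by auto
  qed simp
  then show "s \<in> nodes \<Longrightarrow> contribution (v \<omega>) [] s =
    (if s \<in> generation N (length s) \<omega> then Q s \<omega> * path_weight C s \<omega> else 0)"
    by (auto simp: contribution_def v_def wbp_label_def)
qed

lemma weighted_branching_process_labels:
  assumes wbp: "weighted_branching_process M G Q N C"
  obtains V where "prob_space.indep_vars M (\<lambda>_. seq_space) V nodes"
    "\<And>i. i \<in> nodes \<Longrightarrow> distr M seq_space (V i) = wbp_mu G"
    "\<And>j \<omega>. W Q N C j \<omega> = tree_sum j (\<lambda>i. V i \<omega>)" "prob_space M"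
proof -
  let ?X = "\<lambda>i \<omega>. (Q i \<omega>, N i \<omega>, \<lambda>r\<in>{1..}. C (i @ [r]) \<omega>)"
  interpret prob_space M using wbp by (simp add: weighted_branching_process_def Let_def)
  have X: "indep_vars (\<lambda>_. wbp_space) ?X nodes" "\<And>i. i \<in> nodes \<Longrightarrow> distr M wbp_space (?X i) = G"
    using wbp by (simp_all add: weighted_branching_process_def Let_def)
  show ?thesis
  proof (rule that)
    show "indep_vars (\<lambda>_. seq_space) (\<lambda>i \<omega>. wbp_label (?X i \<omega>)) nodes"
      by (rule indep_vars_compose2[OF X(1)]) simp
    show "distr M seq_space (\<lambda>\<omega>. wbp_label (?X i \<omega>)) = wbp_mu G" if "i \<in> nodes" for i
    proof -
      have "?X i \<in> measurable M wbp_space" using X(1) that by (simp add: indep_vars_def)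
      then show ?thesis
        unfolding X(2)[OF that, symmetric] wbp_mu_eq by (simp add: distr_distr comp_def)
    qed
    show "W Q N C j \<omega> = tree_sum j (\<lambda>i. wbp_label (?X i \<omega>))" for j \<omega>
      by (rule W_eq_tree_sum) (rule contribution_wbp_label)
  qed (rule prob_space_axioms)
qed

lemma sets_wbp_law:
  assumes "weighted_branching_process M G Q N C"
  shows "sets G = sets wbp_space" "prob_space G"
proof -
  let ?X = "\<lambda>i \<omega>. (Q i \<omega>, N i \<omega>, \<lambda>r\<in>{1..}. C (i @ [r]) \<omega>)"
  interpret prob_space M using assms by (simp add: weighted_branching_process_def Let_def)
  have X: "indep_vars (\<lambda>_. wbp_space) ?X nodes" "\<And>i. i \<in> nodes \<Longrightarrow> distr M wbp_space (?X i) = G"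
    using assms by (simp_all add: weighted_branching_process_def Let_def)
  then have "?X [] \<in> measurable M wbp_space" unfolding indep_vars_def using nodes_simps(1) by blast
  from prob_space_distr[OF this] show "sets G = sets wbp_space" "prob_space G"
    unfolding X(2)[OF nodes_simps(1), symmetric] by simp_all
qed

lemma integral_enn2real:
  assumes [measurable]: "h \<in> borel_measurable M" and fin: "(\<integral>\<^sup>+ x. h x \<partial>M) < \<infinity>"
  shows "(\<integral>x. enn2real (h x) \<partial>M) = enn2real (\<integral>\<^sup>+ x. h x \<partial>M)"
proof -
  have "AE x in M. h x \<noteq> \<infinity>" using fin by (intro nn_integral_noteq_infinite) auto
  then have "(\<integral>\<^sup>+ x. ennreal (enn2real (h x)) \<partial>M) = (\<integral>\<^sup>+ x. h x \<partial>M)"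
    by (intro nn_integral_cong_AE, eventually_elim) (simp add: less_top)
  then show ?thesis by (simp add: integral_eq_nn_integral)
qed

lemma label_mean_distr:
  assumes "f \<in> measurable M seq_space"
  shows "label_mean (distr M seq_space f) = (\<integral>\<^sup>+ x. (\<Sum>r. ennreal \<bar>f x (Suc r)\<bar>) \<partial>M)"
proof -
  have [measurable]: "(\<lambda>x. f x k) \<in> borel_measurable M" for k
    using assms by measurable
  have "label_mean (distr M seq_space f) = (\<Sum>r. \<integral>\<^sup>+ x. ennreal \<bar>f x (Suc r)\<bar> \<partial>M)"
    unfolding offspring_mean_def using assms by (subst nn_integral_distr) simp_all
  then show ?thesis by (simp add: nn_integral_suminf)
qed

lemma seq_prob_distr:
  assumes "prob_space M" "f \<in> measurable M seq_space"
  shows "seq_prob (distr M seq_space f) \<longleftrightarrow> (\<integral>\<^sup>+ x. l1_seq (f x) \<partial>M) < \<infinity>"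
    "finite_first_moment l1_seq (distr M seq_space f) \<longleftrightarrow> (\<integral>\<^sup>+ x. l1_seq (f x) \<partial>M) < \<infinity>"
  using prob_space.prob_space_distr[OF assms] assms(2)
  by (simp_all add: seq_prob_def finite_first_moment_def nn_integral_distr borel_measurable_l1_seq)

lemma wbp_rho_eq:
  assumes G: "sets G = sets wbp_space" and fin: "label_mean (wbp_mu G) < \<infinity>"
  shows "wbp_rho G = enn2real (label_mean (wbp_mu G))"
proof -
  have m [measurable]: "wbp_label \<in> measurable G seq_space"
    by (rule measurable_from_sets_eq[OF G wbp_label_measurable])
  \<comment> \<open>This holds pointwise, even where the series diverges: there
    \<open>infsum\<close> is 0, and so is \<open>enn2real\<close> of infinity.\<close>
  have eq: "(case x of (q, m, c) \<Rightarrow> \<Sum>\<^sub>\<infinity>r\<in>{r. 1 \<le> r \<and> enat r \<le> m}. \<bar>c r\<bar>) =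
      enn2real (\<Sum>r. ennreal \<bar>wbp_label x (Suc r)\<bar>)" for x
  proof -
    obtain q m c where x: "x = (q, m, c)" by (cases x)
    have "(\<Sum>\<^sub>\<infinity>r\<in>{r. 1 \<le> r \<and> enat r \<le> m}. \<bar>c r\<bar>) = (\<Sum>\<^sub>\<infinity>r\<in>range Suc. \<bar>wbp_label x r\<bar>)"
      by (rule infsum_cong_neutral) (auto simp: x wbp_label_def image_iff Suc_le_eq dest: gr0_implies_Suc)
    also have "\<dots> = (\<Sum>\<^sub>\<infinity>r. \<bar>wbp_label x (Suc r)\<bar>)"
      by (subst infsum_reindex) (simp_all add: comp_def)
    also have "\<dots> = enn2real (\<integral>\<^sup>+ r. ennreal \<bar>wbp_label x (Suc r)\<bar> \<partial>count_space UNIV)"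
      unfolding infsum_eq_integral_count_space by (rule integral_eq_nn_integral) auto
    finally show ?thesis by (simp add: x nn_integral_count_space_nat)
  qed
  show ?thesis
    unfolding wbp_rho_def eq wbp_mu_eq label_mean_distr[OF m]
    using fin unfolding wbp_mu_eq label_mean_distr[OF m] by (intro integral_enn2real) measurable
qed

lemma wbp_label_AE:
  assumes G: "sets G = sets wbp_space" and AE: "AE (q, m, c) in G. q = 1 \<and> (\<forall>r\<ge>1. c r \<ge> 0)"
  shows "AE u in wbp_mu G. u 0 = 1 \<and> (\<forall>r. u (Suc r) \<ge> 0)"
proof -
  have m: "wbp_label \<in> measurable G seq_space"
    by (rule measurable_from_sets_eq[OF G wbp_label_measurable])
  have *: "{u \<in> space seq_space. u 0 = 1 \<and> (\<forall>r. u (Suc r) \<ge> (0::real))} \<in> sets seq_space"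
    by measurable
  show ?thesis
    unfolding wbp_mu_eq AE_distr_iff[OF m *] using AE by eventually_elim (auto simp: wbp_label_def)
qed

lemma seq_prob_wbp_mu:
  assumes "weighted_branching_process M G Q N C" "finite_first_moment l1_seq (wbp_mu G)"
  shows "seq_prob (wbp_mu G)"
proof -
  note G = sets_wbp_law[OF assms(1)]
  have m: "wbp_label \<in> measurable G seq_space"
    by (rule measurable_from_sets_eq[OF G(1) wbp_label_measurable])
  show ?thesis using assms(2) unfolding wbp_mu_eq seq_prob_distr[OF G(2) m] .
qed

lemma wbp_law:
  assumes "weighted_branching_process M G Q N C"
  shows "distr M borel (W Q N C j) = sum_law j (wbp_mu G) (wbp_mu G)" "W Q N C j \<in> borel_measurable M"
    "prob_space M"
proof -
  obtain V where V: "prob_space.indep_vars M (\<lambda>_. seq_space) V nodes"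
    "\<And>i. i \<in> nodes \<Longrightarrow> distr M seq_space (V i) = wbp_mu G"
    "\<And>j \<omega>. W Q N C j \<omega> = tree_sum j (\<lambda>i. V i \<omega>)" "prob_space M"
    using weighted_branching_process_labels[OF assms] by blast
  have "W Q N C j = (\<lambda>\<omega>. tree_sum j (\<lambda>i. V i \<omega>))" by (rule ext) (rule V)
  then show "distr M borel (W Q N C j) = sum_law j (wbp_mu G) (wbp_mu G)" "W Q N C j \<in> borel_measurable M"
    using sum_law_indep_labels(1,2)[OF V(4,1) V(2) V(2)] by simp_all
qed (rule weighted_branching_process_labels[OF assms])

text \<open>Convergence is known on the product space of labels and is pulled back along the map
  that collects the labels of the given process; \<open>lim\<close> then provides a measurable
  version of the limit.\<close>

lemma wbp_martingale_limit:
  assumes wbp: "weighted_branching_process M G Q N C" and fin: "finite_first_moment l1_seq (wbp_mu G)"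
    and \<rho>: "\<rho> = enn2real (label_mean (wbp_mu G))" "\<rho> > 0"
    and label: "AE u in wbp_mu G. u 0 = 1 \<and> (\<forall>r. u (Suc r) \<ge> 0)"
  obtains L where "L \<in> borel_measurable M" "AE \<omega> in M. (\<lambda>j. W Q N C j \<omega> / \<rho> ^ j) \<longlonglongrightarrow> L \<omega>"
proof -
  obtain V where V: "prob_space.indep_vars M (\<lambda>_. seq_space) V nodes"
    "\<And>i. i \<in> nodes \<Longrightarrow> distr M seq_space (V i) = wbp_mu G"
    "\<And>j \<omega>. W Q N C j \<omega> = tree_sum j (\<lambda>i. V i \<omega>)" "prob_space M"
    using weighted_branching_process_labels[OF wbp] by blast
  interpret prob_space M by (rule V)
  note D = seq_probD[OF seq_prob_wbp_mu[OF wbp fin]]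
  have "label_mean (wbp_mu G) = ennreal \<rho>" using D(5) \<rho> by simp
  note conv = tree_sum_martingale_convergent[OF D(1,2) this \<rho>(2) label]
  have eq: "distr M (PiM nodes (\<lambda>_. seq_space)) (\<lambda>\<omega>. \<lambda>i\<in>nodes. V i \<omega>) = tree_law (wbp_mu G) (wbp_mu G)"
    by (rule distr_indep_labels[OF V(4,1)]) (simp_all only: V(2) nodes_simps)
  have "AE v in distr M (PiM nodes (\<lambda>_. seq_space)) (\<lambda>\<omega>. \<lambda>i\<in>nodes. V i \<omega>). convergent (\<lambda>j. tree_sum j v / \<rho> ^ j)"
    unfolding eq by (rule conv)
  moreover have "(\<lambda>\<omega>. \<lambda>i\<in>nodes. V i \<omega>) \<in> measurable M (PiM nodes (\<lambda>_. seq_space))"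
    using V(1) by (intro measurable_restrict) (simp add: indep_vars_def)
  ultimately have AE: "AE \<omega> in M. convergent (\<lambda>j. tree_sum j (\<lambda>i\<in>nodes. V i \<omega>) / \<rho> ^ j)"
    using AE_distrD by blast
  have W: "W Q N C j \<omega> = tree_sum j (\<lambda>i\<in>nodes. V i \<omega>)" for j \<omega>
    unfolding V(3) by (rule tree_sum_cong) simp
  note wbp_law(2)[OF wbp, measurable]
  show ?thesis
  proof (rule that)
    show "(\<lambda>\<omega>. lim (\<lambda>j. W Q N C j \<omega> / \<rho> ^ j)) \<in> borel_measurable M"
      by measurable
    show "AE \<omega> in M. (\<lambda>j. W Q N C j \<omega> / \<rho> ^ j) \<longlonglongrightarrow> lim (\<lambda>j. W Q N C j \<omega> / \<rho> ^ j)"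
      using AE unfolding W[symmetric] by eventually_elim (simp add: convergent_LIMSEQ_iff)
  qed
qed

section \<open>Weighted branching trees as labelled trees\<close>

definition wbt_label :: "wbt_vector \<Rightarrow> nat \<Rightarrow> real" where
  "wbt_label = (\<lambda>(q, m, c) k. if k = 0 then c * q else if k \<le> m then c else 0)"

text \<open>The weight of the root does not enter \<open>W\<close>.\<close>

definition root_label :: "real \<times> real \<Rightarrow> nat \<Rightarrow> real" where
  "root_label = (\<lambda>(q, m) k. if k = 0 then q else if real k \<le> m then 1 else 0)"

definition wbt_root :: "wbt_vector measure \<Rightarrow> (nat \<Rightarrow> real) measure" where
  "wbt_root H = distr H seq_space (\<lambda>(q, m, c). root_label (q, real m))"

lemma wbt_mu_eq: "wbt_mu H = distr H seq_space wbt_label"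
  by (simp add: wbt_mu_def wbt_label_def)

lemma wbt_components [measurable]:
  "fst \<in> borel_measurable wbt_space" "(\<lambda>x. fst (snd x)) \<in> measurable wbt_space (count_space UNIV)"
  "(\<lambda>x. snd (snd x)) \<in> borel_measurable wbt_space"
  unfolding wbt_space_def by measurable

lemma wbt_label_measurable [measurable]: "wbt_label \<in> measurable wbt_space seq_space"
  by (rule measurable_PiM_single') (auto simp: wbt_label_def split_def)

lemma root_label_measurable [measurable]: "root_label \<in> measurable borel seq_space"
proof (rule measurable_PiM_single')
  show "(\<lambda>x. root_label x k) \<in> borel_measurable borel" for k
    unfolding root_label_def split_def borel_prod[symmetric] by measurable
qed auto

lemma wbt_root_label_measurable [measurable]:
  "(\<lambda>(q, m, c). root_label (q, real m)) \<in> measurable wbt_space seq_space"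
proof -
  have "(\<lambda>x. (fst x, real (fst (snd x)))) \<in> measurable wbt_space (borel \<Otimes>\<^sub>M borel)"
    by measurable
  then have "(\<lambda>x. (fst x, real (fst (snd x)))) \<in> measurable wbt_space borel"
    by (simp only: borel_prod)
  from measurable_compose[OF this root_label_measurable] show ?thesis by (simp add: split_def)
qed

text \<open>The product of labels on the way to \<open>s\<close> contains the weights of the proper
  prefixes other than the root, but not yet that of \<open>s\<close>. The induction therefore
  includes the factor \<open>C s\<close>, which coordinate 0 of the label of \<open>s\<close>
  supplies in the end.\<close>

lemma contribution_wbt_label:
  fixes Q C :: "nat list \<Rightarrow> 'a \<Rightarrow> real" and K :: "nat list \<Rightarrow> 'a \<Rightarrow> nat"
  defines "v \<omega> i \<equiv> (if i = [] then root_label (Q i \<omega>, real (K i \<omega>)) else wbt_label (Q i \<omega>, K i \<omega>, C i \<omega>))"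
    and "N \<equiv> \<lambda>i \<omega>. enat (K i \<omega>)"
  shows "s \<in> nodes \<Longrightarrow> contribution (v \<omega>) [] s =
    (if s \<in> generation N (length s) \<omega> then Q s \<omega> * path_weight C s \<omega> else 0)"
proof -
  have "s \<in> nodes \<Longrightarrow> path_prod (v \<omega>) [] s * (if s = [] then 1 else C s \<omega>)
    = (if s \<in> generation N (length s) \<omega> then path_weight C s \<omega> else 0)" for s
  proof (induction s rule: rev_induct)
    case (snoc r s)
    have "path_prod (v \<omega>) [] (s @ [r]) * C (s @ [r]) \<omega> =
        (path_prod (v \<omega>) [] s * (if s = [] then 1 else C s \<omega>)) * (if r \<le> K s \<omega> then C (s @ [r]) \<omega> else 0)"
      unfolding path_prod_snoc using snoc.prems by (auto simp: v_def wbt_label_def root_label_def)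
    also have "\<dots> = (if s @ [r] \<in> generation N (length (s @ [r])) \<omega> then path_weight C (s @ [r]) \<omega> else 0)"
      unfolding generation_snoc using snoc by (auto simp: N_def)
    finally show ?case by simp
  qed simp
  note * = this
  show "s \<in> nodes \<Longrightarrow> contribution (v \<omega>) [] s =
    (if s \<in> generation N (length s) \<omega> then Q s \<omega> * path_weight C s \<omega> else 0)"
    using *[of s] by (auto simp: contribution_def v_def wbt_label_def root_label_def split: if_splits)
qed

lemma weighted_branching_treeD:
  assumes "weighted_branching_tree M H Q K C"
  shows "prob_space M" "prob_space.indep_vars M (\<lambda>_. wbt_space) (\<lambda>i \<omega>. (Q i \<omega>, K i \<omega>, C i \<omega>)) nodes"
    "\<And>i. i \<in> nodes \<Longrightarrow> distr M wbt_space (\<lambda>\<omega>. (Q i \<omega>, K i \<omega>, C i \<omega>)) = H"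
    "\<And>i. i \<in> nodes \<Longrightarrow> (\<lambda>\<omega>. (Q i \<omega>, K i \<omega>, C i \<omega>)) \<in> measurable M wbt_space"
    "sets H = sets wbt_space" "prob_space H"
proof -
  show M: "prob_space M" using assms by (simp add: weighted_branching_tree_def Let_def)
  interpret prob_space M by fact
  show X: "indep_vars (\<lambda>_. wbt_space) (\<lambda>i \<omega>. (Q i \<omega>, K i \<omega>, C i \<omega>)) nodes"
    and H: "\<And>i. i \<in> nodes \<Longrightarrow> distr M wbt_space (\<lambda>\<omega>. (Q i \<omega>, K i \<omega>, C i \<omega>)) = H"
    using assms by (simp_all add: weighted_branching_tree_def Let_def)
  show m: "\<And>i. i \<in> nodes \<Longrightarrow> (\<lambda>\<omega>. (Q i \<omega>, K i \<omega>, C i \<omega>)) \<in> measurable M wbt_space"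
    using X by (simp add: indep_vars_def)
  from prob_space_distr[OF m[OF nodes_simps(1)]] H[OF nodes_simps(1)]
  show "sets H = sets wbt_space" "prob_space H" by auto
qed

lemma wbt_law:
  assumes "weighted_branching_tree M H Q K C"
  shows "distr M borel (W_tree Q K C j) = sum_law j (wbt_root H) (wbt_mu H)" "W_tree Q K C j \<in> borel_measurable M"
    "prob_space M"
proof -
  note D = weighted_branching_treeD[OF assms]
  interpret prob_space M by (rule D)
  let ?X = "\<lambda>i \<omega>. (Q i \<omega>, K i \<omega>, C i \<omega>)"
  define f where "f i = (if i = ([] :: nat list) then (\<lambda>(q, m, c). root_label (q, real m)) else wbt_label)" for i
  have f: "f i \<in> measurable wbt_space seq_space" for i
    unfolding f_def using wbt_root_label_measurable wbt_label_measurable by simp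
  define V where "V i \<omega> = f i (?X i \<omega>)" for i \<omega>
  have indep: "indep_vars (\<lambda>_. seq_space) V nodes"
    unfolding V_def by (rule indep_vars_compose2[OF D(2) f])
  have law: "distr M seq_space (V i) = distr H seq_space (f i)" if "i \<in> nodes" for i
    unfolding V_def D(3)[OF that, symmetric] using D(4)[OF that] f by (simp add: distr_distr comp_def)
  have W: "W_tree Q K C j = (\<lambda>\<omega>. tree_sum j (\<lambda>i. V i \<omega>))"
  proof
    fix \<omega>
    have "(\<lambda>i. V i \<omega>) = (\<lambda>i. if i = [] then root_label (Q i \<omega>, real (K i \<omega>)) else wbt_label (Q i \<omega>, K i \<omega>, C i \<omega>))"
      by (auto simp: V_def f_def)
    show "W_tree Q K C j \<omega> = tree_sum j (\<lambda>i. V i \<omega>)"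
      unfolding \<open>(\<lambda>i. V i \<omega>) = _\<close> by (rule W_eq_tree_sum) (rule contribution_wbt_label)
  qed
  show "distr M borel (W_tree Q K C j) = sum_law j (wbt_root H) (wbt_mu H)" "W_tree Q K C j \<in> borel_measurable M"
    unfolding W
    using sum_law_indep_labels(1,2)[OF D(1) indep, of "wbt_root H" "wbt_mu H"] law
    by (simp_all add: wbt_root_def wbt_mu_eq f_def)
qed (rule weighted_branching_treeD[OF assms])

lemma suminf_le_indicator:
  "(\<Sum>r. if Suc r \<le> m then a else 0) = of_nat m * (a :: ennreal)"
proof -
  have "(\<Sum>r. if Suc r \<le> m then a else 0) = (\<Sum>r<m. a)"
    by (subst suminf_finite[of "{..<m}"]) (auto intro: sum.cong)
  then show ?thesis by simp
qed

lemma wbt_rho_eq: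
  assumes H: "sets H = sets wbt_space" and fin: "label_mean (wbt_mu H) < \<infinity>"
  shows "wbt_rho H = enn2real (label_mean (wbt_mu H))"
proof -
  have m [measurable]: "wbt_label \<in> measurable H seq_space"
    by (rule measurable_from_sets_eq[OF H wbt_label_measurable])
  have "(\<Sum>r. ennreal \<bar>wbt_label x (Suc r)\<bar>) = (\<Sum>r. if Suc r \<le> fst (snd x) then ennreal \<bar>snd (snd x)\<bar> else 0)" for x
    by (intro arg_cong[where f = suminf] ext) (simp add: wbt_label_def split_def)
  then have eq: "(case x of (q, m, c) \<Rightarrow> real m * \<bar>c\<bar>) = enn2real (\<Sum>r. ennreal \<bar>wbt_label x (Suc r)\<bar>)" for x
    by (simp add: suminf_le_indicator split_def enn2real_mult)
  show ?thesis
    unfolding wbt_rho_def eq wbt_mu_eq label_mean_distr[OF m]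
    using fin unfolding wbt_mu_eq label_mean_distr[OF m] by (intro integral_enn2real) measurable
qed

lemma seq_prob_wbt_mu:
  assumes "weighted_branching_tree M H Q K C" "finite_first_moment l1_seq (wbt_mu H)"
  shows "seq_prob (wbt_mu H)"
proof -
  note H = weighted_branching_treeD(5,6)[OF assms(1)]
  have m: "wbt_label \<in> measurable H seq_space"
    by (rule measurable_from_sets_eq[OF H(1) wbt_label_measurable])
  show ?thesis using assms(2) unfolding wbt_mu_eq seq_prob_distr[OF H(2) m] .
qed

lemma l1_seq_root_label:
  "l1_seq (root_label (q, real m)) = l1_vec (q, real m)"
proof -
  have "l1_seq (root_label (q, real m)) = (\<Sum>r. ennreal \<bar>root_label (q, real m) (Suc r)\<bar>) + ennreal \<bar>root_label (q, real m) 0\<bar>"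
    unfolding l1_seq_def using suminf_offset[OF summableI, of "\<lambda>k. ennreal \<bar>root_label (q, real m) k\<bar>" 1] by (simp add: add.commute)
  also have "(\<Sum>r. ennreal \<bar>root_label (q, real m) (Suc r)\<bar>) = (\<Sum>r. if Suc r \<le> m then 1 else 0)"
    by (intro arg_cong[where f = suminf] ext) (auto simp: root_label_def)
  finally show ?thesis
    unfolding suminf_le_indicator
    by (simp add: l1_vec_pair root_label_def ennreal_of_nat_eq_real_of_nat add.commute)
qed

text \<open>The indicator sequences of \<open>k \<le> m\<close> and \<open>k \<le> m'\<close> differ
  in exactly \<open>\<bar>m - m'\<bar>\<close> places, so \<open>root_label\<close> is an isometry
  on pairs with a natural second component.\<close>

lemma l1_seq_root_label_diff:
  "l1_seq (root_label (q, real m) - root_label (q', real m')) = l1_vec ((q, real m) - (q', real m'))"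
proof -
  let ?d = "root_label (q, real m) - root_label (q', real m')"
  have "l1_seq ?d = (\<Sum>r. ennreal \<bar>?d (Suc r)\<bar>) + ennreal \<bar>?d 0\<bar>"
    unfolding l1_seq_def using suminf_offset[OF summableI, of "\<lambda>k. ennreal \<bar>?d k\<bar>" 1] by (simp add: add.commute)
  also have "(\<Sum>r. ennreal \<bar>?d (Suc r)\<bar>) = (\<Sum>r. if r \<in> {min m m'..<max m m'} then 1 else 0)"
    by (intro arg_cong[where f = suminf] ext) (auto simp: root_label_def)
  also have "\<dots> = (\<Sum>r\<in>{min m m'..<max m m'}. 1 :: ennreal)"
    by (subst suminf_finite[of "{min m m'..<max m m'}"]) (auto intro: sum.cong)
  also have "\<dots> = ennreal \<bar>real m - real m'\<bar>"
    by (cases "m \<le> m'") (auto simp: max_def min_def ennreal_of_nat_eq_real_of_nat of_nat_diff)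
  also have "?d 0 = q - q'" by (simp add: root_label_def)
  finally show ?thesis
    by (simp add: l1_vec_pair add.commute fun_diff_def)
qed

text \<open>The root law is an image of the law of \<open>(Q, N)\<close> on the plane, which is why
  \<open>root_label\<close> takes a real second argument. That this argument is almost surely a
  natural number is recorded because the isometry is proved for those.\<close>

lemma
  assumes H: "sets H = sets wbt_space" "prob_space H"
  shows seq_prob_wbt_root: "finite_first_moment l1_vec (wbt_nu H) \<Longrightarrow> seq_prob (wbt_root H)"
    and wbt_root_eq: "wbt_root H = distr (wbt_nu H) seq_space root_label"
    and AE_wbt_nu: "AE x in wbt_nu H. \<exists>m. snd x = real m"
proof -
  have "(\<lambda>x. (fst x, real (fst (snd x)))) \<in> measurable wbt_space (borel \<Otimes>\<^sub>M borel)"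
    by measurable
  then have m': "(\<lambda>(q, m, c). (q, real m)) \<in> measurable wbt_space borel"
    by (simp add: borel_prod split_def)
  then have m: "(\<lambda>(q, m, c). (q, real m)) \<in> measurable H borel"
    using measurable_cong_sets[OF H(1) refl, of "borel :: (real \<times> real) measure"] by blast
  have r: "(\<lambda>(q, m, c). root_label (q, real m)) \<in> measurable H seq_space"
    by (rule measurable_from_sets_eq[OF H(1) wbt_root_label_measurable])
  show "wbt_root H = distr (wbt_nu H) seq_space root_label"
    unfolding wbt_root_def wbt_nu_def
    by (subst distr_distr[OF root_label_measurable m]) (simp add: comp_def split_def)
  have l1: "l1_vec \<in> borel_measurable (borel :: (real \<times> real) measure)"
    unfolding l1_vec_pair[abs_def] borel_prod[symmetric] by measurable
  show "seq_prob (wbt_root H)" if "finite_first_moment l1_vec (wbt_nu H)"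
  proof -
    have "(\<integral>\<^sup>+ x. l1_vec (case x of (q, m, c) \<Rightarrow> (q, real m)) \<partial>H) < \<infinity>"
      using that m l1 unfolding finite_first_moment_def wbt_nu_def by (simp add: nn_integral_distr)
    also have "(\<integral>\<^sup>+ x. l1_vec (case x of (q, m, c) \<Rightarrow> (q, real m)) \<partial>H) =
        (\<integral>\<^sup>+ x. l1_seq (case x of (q, m, c) \<Rightarrow> root_label (q, real m)) \<partial>H)"
      by (intro nn_integral_cong) (simp add: l1_seq_root_label split_def)
    finally show ?thesis unfolding wbt_root_def seq_prob_distr[OF H(2) r] .
  qed
  have "range real \<in> sets borel"
    by (intro borel_closed closed_subset_Ints) auto
  then have [measurable]: "{y. \<exists>m. y = real m} \<in> sets borel" by (simp add: full_SetCompr_eq)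
  have "{x \<in> space borel. \<exists>m. snd x = real m} = snd -` {y. \<exists>m. y = real m} \<inter> space (borel :: (real \<times> real) measure)"
    by auto
  also have "\<dots> \<in> sets borel"
    by (rule measurable_sets) (auto simp: borel_prod[symmetric])
  finally show "AE x in wbt_nu H. \<exists>m. snd x = real m"
    unfolding wbt_nu_def by (subst AE_distr_iff[OF m]) auto
qed

text \<open>Every coupling of the laws of \<open>(Q, N)\<close> is pushed through
  \<open>root_label\<close>, which almost surely preserves the distance of the two points and hence
  the cost.\<close>

lemma d1_wbt_root_le:
  assumes H: "sets H = sets wbt_space" "prob_space H" and H': "sets H' = sets wbt_space" "prob_space H'"
  shows "d1 l1_seq (wbt_root H) (wbt_root H') \<le> d1 l1_vec (wbt_nu H) (wbt_nu H')"
  unfolding d1_def[of l1_vec]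
proof (rule INF_greatest)
  fix \<gamma> assume \<gamma>: "\<gamma> \<in> couplings (wbt_nu H) (wbt_nu H')"
  have r: "root_label \<in> measurable (wbt_nu H) seq_space" "root_label \<in> measurable (wbt_nu H') seq_space"
    using root_label_measurable by (simp_all add: wbt_nu_def)
  let ?f = "\<lambda>z. (root_label (fst z), root_label (snd z))"
  have f: "?f \<in> measurable \<gamma> (seq_space \<Otimes>\<^sub>M seq_space)"
    using measurable_compose[OF couplingsD(5)[OF \<gamma>] r(1)] measurable_compose[OF couplingsD(6)[OF \<gamma>] r(2)] by simp
  have "distr \<gamma> (seq_space \<Otimes>\<^sub>M seq_space) ?f \<in> couplings (wbt_root H) (wbt_root H')"
    unfolding wbt_root_eq[OF H] wbt_root_eq[OF H'] by (rule couplings_distr[OF \<gamma> r])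
  then have "d1 l1_seq (wbt_root H) (wbt_root H') \<le> (\<integral>\<^sup>+ z. l1_seq (fst z - snd z) \<partial>distr \<gamma> (seq_space \<Otimes>\<^sub>M seq_space) ?f)"
    by (rule d1_le_coupling)
  also have "\<dots> = (\<integral>\<^sup>+ z. l1_seq (root_label (fst z) - root_label (snd z)) \<partial>\<gamma>)"
  proof -
    have "(\<lambda>z. l1_seq (fst z - snd z)) \<in> borel_measurable (seq_space \<Otimes>\<^sub>M seq_space)"
      unfolding l1_seq_def by simp
    with f show ?thesis by (simp add: nn_integral_distr)
  qed
  also have "\<dots> = cost l1_vec \<gamma>"
  proof (rule nn_integral_cong_AE)
    have "AE z in \<gamma>. \<exists>m. snd (fst z) = real m"
      by (rule AE_distrD[OF couplingsD(5)[OF \<gamma>]]) (unfold couplingsD(3)[OF \<gamma>], rule AE_wbt_nu[OF H])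
    moreover have "AE z in \<gamma>. \<exists>m. snd (snd z) = real m"
      by (rule AE_distrD[OF couplingsD(6)[OF \<gamma>]]) (unfold couplingsD(4)[OF \<gamma>], rule AE_wbt_nu[OF H'])
    ultimately show "AE z in \<gamma>. l1_seq (root_label (fst z) - root_label (snd z)) = l1_vec (fst z - snd z)"
    proof eventually_elim
      case (elim z)
      then obtain m m' where "fst z = (fst (fst z), real m)" "snd z = (fst (snd z), real m')"
        by (metis prod.collapse)
      then show ?case using l1_seq_root_label_diff by metis
    qed
  qed
  finally show "d1 l1_seq (wbt_root H) (wbt_root H') \<le> cost l1_vec \<gamma>" .
qed

text \<open>Lets the members of one block of independent parts be numbered by
  \<open>nat\<close>.\<close>

lemma (in prob_space) indep_vars_reindex:
  assumes X: "indep_vars M' X I" and h: "inj_on h J" "h ` J \<subseteq> I"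
  shows "indep_vars (\<lambda>j. M' (h j)) (\<lambda>j. X (h j)) J"
  unfolding indep_vars_def2
proof (intro conjI ballI)
  show "random_variable (M' (h j)) (X (h j))" if "j \<in> J" for j
    using X h that by (auto simp: indep_vars_def)
  have F: "indep_sets (\<lambda>i. {X i -` A \<inter> space M |A. A \<in> sets (M' i)}) I"
    using X by (simp add: indep_vars_def2)
  show "indep_sets (\<lambda>j. {X (h j) -` A \<inter> space M |A. A \<in> sets (M' (h j))}) J"
  proof (rule indep_setsI)
    show "{X (h j) -` A \<inter> space M |A. A \<in> sets (M' (h j))} \<subseteq> events" if "j \<in> J" for j
      using F h that by (auto simp: indep_sets_def)
    fix A L assume L: "L \<noteq> {}" "L \<subseteq> J" "finite L"
      and A: "\<forall>j\<in>L. A j \<in> {X (h j) -` B \<inter> space M |B. B \<in> sets (M' (h j))}"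
    have inj: "inj_on h L" using h(1) L(2) by (rule inj_on_subset)
    have "h ` L \<subseteq> I" using L(2) h(2) by blast
    let ?A = "\<lambda>i. A (inv_into L h i)"
    have "prob (\<Inter>i\<in>h ` L. ?A i) = (\<Prod>i\<in>h ` L. prob (?A i))"
      by (rule indep_setsD[OF F]) (use L A inj \<open>h ` L \<subseteq> I\<close> in auto)
    also have "\<dots> = (\<Prod>j\<in>L. prob (A j))"
      by (subst prod.reindex[OF inj]) (simp add: inj)
    also have "(\<Inter>i\<in>h ` L. ?A i) = (\<Inter>j\<in>L. A j)"
      using inj by simp
    finally show "prob (\<Inter>j\<in>L. A j) = (\<Prod>j\<in>L. prob (A j))" .
  qed
qed

section \<open>Trees with weights independent of the offspring\<close>

text \<open>Both parts of a vector keep the type \<open>wbt_vector\<close>, with the discarded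
  components set to 0, so that they can belong to one independent family.\<close>

definition select :: "bool \<Rightarrow> wbt_vector \<Rightarrow> wbt_vector" where
  "select b = (\<lambda>(q, m, c). if b then (q, m, 0) else (0, 0, c))"

lemma space_wbt_space [simp]: "space wbt_space = UNIV"
  by (simp add: wbt_space_def space_pair_measure)

lemma select_measurable [measurable]: "select b \<in> measurable wbt_space wbt_space"
proof -
  have "(\<lambda>x. (fst x, fst (snd x), 0::real)) \<in> measurable wbt_space (borel \<Otimes>\<^sub>M count_space UNIV \<Otimes>\<^sub>M borel)"
    "(\<lambda>x. (0::real, 0::nat, snd (snd x))) \<in> measurable wbt_space (borel \<Otimes>\<^sub>M count_space UNIV \<Otimes>\<^sub>M borel)"
    by measurable
  then have "(\<lambda>x. (fst x, fst (snd x), 0)) \<in> measurable wbt_space wbt_space"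
    "(\<lambda>x. (0, 0, snd (snd x))) \<in> measurable wbt_space wbt_space"
    unfolding wbt_space_def[symmetric] .
  then show ?thesis by (cases b) (simp_all only: select_def split_def if_True if_False)
qed

text \<open>Preimages under \<open>select\<close> are events about \<open>(q, m)\<close> or about
  \<open>c\<close>, obtained by slicing \<open>A\<close> at weight 0 and \<open>B\<close> at
  \<open>(0, 0)\<close>.\<close>

lemma weight_indep_select:
  assumes H: "sets H = sets wbt_space" "prob_space H" and ind: "wbt_weight_indep H"
    and A: "A \<in> sets wbt_space" and B: "B \<in> sets wbt_space"
  shows "measure H (select True -` A \<inter> select False -` B) = measure H (select True -` A) * measure H (select False -` B)"
proof -
  interpret H: prob_space H by fact
  have sp: "space H = UNIV" using sets_eq_imp_space_eq[OF H(1)] by simp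
  have "(\<lambda>c. (0, 0, c)) \<in> measurable borel wbt_space"
    unfolding wbt_space_def by measurable
  from measurable_sets[OF this B] have B': "{c. (0, 0, c) \<in> B} \<in> sets borel"
    by (simp add: vimage_def)
  have "(\<lambda>x. (fst x, snd x, 0)) \<in> measurable (borel \<Otimes>\<^sub>M count_space UNIV) wbt_space"
    unfolding wbt_space_def by measurable
  from measurable_sets[OF this A] have A': "{x. (fst x, snd x, 0) \<in> A} \<in> sets (borel \<Otimes>\<^sub>M count_space UNIV)"
    by (simp add: vimage_def space_pair_measure)
  have b: "select False -` B = (\<lambda>(q, m, c). c) -` {c. (0, 0, c) \<in> B} \<inter> space H"
    and a: "select True -` A = (\<lambda>(q, m, c). (q, m)) -` {x. (fst x, snd x, 0) \<in> A} \<inter> space H"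
    by (auto simp: select_def sp split: prod.splits)
  have "select False -` B \<in> {(\<lambda>(q, m, c). c) -` A \<inter> space H |A. A \<in> sets borel}"
    unfolding b using B' by blast
  moreover have "select True -` A \<in> {(\<lambda>(q, m, c). (q, m)) -` B \<inter> space H |B. B \<in> sets (borel \<Otimes>\<^sub>M count_space UNIV)}"
    unfolding a using A' by blast
  ultimately have "measure H (select False -` B \<inter> select True -` A) = measure H (select False -` B) * measure H (select True -` A)"
    by (rule H.indep_setD[OF ind[unfolded wbt_weight_indep_def]])
  then show ?thesis by (simp add: Int_commute mult.commute)
qed

context
  fixes M :: "'a measure" and H Q K C
  assumes wbt: "weighted_branching_tree M H Q K C" and ind: "wbt_weight_indep H"
begin

interpretation prob_space M by (rule weighted_branching_treeD[OF wbt])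

definition part :: "nat list \<times> bool \<Rightarrow> 'a \<Rightarrow> wbt_vector" where
  "part k \<omega> = select (snd k) (Q (fst k) \<omega>, K (fst k) \<omega>, C (fst k) \<omega>)"

lemma part_measurable: "fst k \<in> nodes \<Longrightarrow> part k \<in> measurable M wbt_space"
  unfolding part_def using measurable_compose[OF weighted_branching_treeD(4)[OF wbt] select_measurable] .

lemma distr_part: "fst k \<in> nodes \<Longrightarrow> distr M wbt_space (part k) = distr H wbt_space (select (snd k))"
  using weighted_branching_treeD(3)[OF wbt, symmetric, of "fst k"] weighted_branching_treeD(4)[OF wbt, of "fst k"]
  by (simp add: distr_distr comp_def part_def[abs_def])

text \<open>A finite index set is first enlarged to contain both parts of each of its nodes. The
  probability of such an intersection factorises over the nodes by independence of the vectors, and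
  inside each node by \<open>weight_indep_select\<close>.\<close>

lemma indep_part: "indep_vars (\<lambda>_. wbt_space) part (nodes \<times> UNIV)"
  unfolding indep_vars_def2
proof (intro conjI ballI)
  let ?X = "\<lambda>i \<omega>. (Q i \<omega>, K i \<omega>, C i \<omega>)"
  note D = weighted_branching_treeD[OF wbt]
  show part: "random_variable wbt_space (part k)" if "k \<in> nodes \<times> UNIV" for k
    using that by (intro part_measurable) auto
  let ?F = "\<lambda>k. {part k -` A \<inter> space M |A. A \<in> sets wbt_space}"
  show "indep_sets ?F (nodes \<times> UNIV)"
    unfolding indep_sets_finite_index_sets[of _ "nodes \<times> UNIV"]
  proof (intro allI impI)
    fix J assume J: "J \<subseteq> nodes \<times> (UNIV :: bool set)" "J \<noteq> {}" "finite J"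
    let ?J = "fst ` J"
    have J': "?J \<subseteq> nodes" "finite ?J" "?J \<noteq> {}" "J \<subseteq> ?J \<times> UNIV"
      using J by (auto intro: rev_image_eqI)
    have "indep_sets ?F (?J \<times> UNIV)"
    proof (rule indep_sets_finite[THEN iffD2])
      show "?J \<times> (UNIV :: bool set) \<noteq> {}" "finite (?J \<times> (UNIV :: bool set))" using J' by auto
      fix k assume k: "k \<in> ?J \<times> (UNIV :: bool set)"
      then have "part k \<in> measurable M wbt_space" using J' by (intro part) auto
      then show "?F k \<subseteq> events" by (auto intro: measurable_sets)
      show "space M \<in> ?F k" by (auto intro!: exI[of _ "space wbt_space"])
    next
      show "\<forall>A\<in>Pi (?J \<times> UNIV) ?F. prob (\<Inter>k\<in>?J \<times> UNIV. A k) = (\<Prod>k\<in>?J \<times> UNIV. prob (A k))"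
      proof
        fix A assume A: "A \<in> Pi (?J \<times> UNIV) ?F"
        have "\<forall>k\<in>?J \<times> UNIV. \<exists>B. B \<in> sets wbt_space \<and> A k = part k -` B \<inter> space M"
        proof
          fix k assume "k \<in> ?J \<times> (UNIV :: bool set)"
          from Pi_mem[OF A this] show "\<exists>B. B \<in> sets wbt_space \<and> A k = part k -` B \<inter> space M" by blast
        qed
        from bchoice[OF this] obtain B where
          B': "\<forall>k\<in>?J \<times> UNIV. B k \<in> sets wbt_space \<and> A k = part k -` B k \<inter> space M" ..
        note B = bspec[OF B', THEN conjunct1] bspec[OF B', THEN conjunct2]
        define E where "E k = select (snd k) -` B k" for k
        have E: "E k \<in> sets wbt_space" if "k \<in> ?J \<times> UNIV" for k
          using measurable_sets[OF select_measurable B(1)[OF that], of "snd k"] by (simp add: E_def)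
        have A: "A k = ?X (fst k) -` E k \<inter> space M" if "k \<in> ?J \<times> UNIV" for k
          unfolding B(2)[OF that] by (auto simp: E_def part_def)
        have law: "prob (?X i -` S \<inter> space M) = measure H S" if "i \<in> ?J" "S \<in> sets wbt_space" for i S
          using that J' D(3)[of i, symmetric] D(4)[of i] by (auto simp: measure_distr)
        have "(\<Inter>k\<in>?J \<times> UNIV. A k) = (\<Inter>i\<in>?J. ?X i -` (E (i, True) \<inter> E (i, False)) \<inter> space M)"
        proof -
          have "(\<Inter>k\<in>?J \<times> UNIV. A k) = (\<Inter>i\<in>?J. A (i, True) \<inter> A (i, False))"
            by (auto simp: UNIV_bool)
          also have "\<dots> = (\<Inter>i\<in>?J. ?X i -` (E (i, True) \<inter> E (i, False)) \<inter> space M)"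
            by (intro INF_cong refl) (auto simp: A)
          finally show ?thesis .
        qed
        also have "prob \<dots> = (\<Prod>i\<in>?J. prob (?X i -` (E (i, True) \<inter> E (i, False)) \<inter> space M))"
          by (rule indep_varsD[OF D(2)]) (use J' E in auto)
        also have "\<dots> = (\<Prod>i\<in>?J. prob (A (i, True)) * prob (A (i, False)))"
        proof (rule prod.cong[OF refl])
          fix i assume i: "i \<in> ?J"
          then have k: "(i, b) \<in> ?J \<times> UNIV" for b :: bool by simp
          have "prob (?X i -` (E (i, True) \<inter> E (i, False)) \<inter> space M) = measure H (E (i, True) \<inter> E (i, False))"
            using law[OF i] E[OF k] by (intro law i sets.Int)
          also have "\<dots> = measure H (E (i, True)) * measure H (E (i, False))"
            using weight_indep_select[OF D(5,6) ind B(1)[OF k] B(1)[OF k], of True False] by (simp add: E_def)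
          also have "\<dots> = prob (A (i, True)) * prob (A (i, False))"
            using law[OF i E[OF k]] by (simp add: A[OF k])
          finally show "prob (?X i -` (E (i, True) \<inter> E (i, False)) \<inter> space M) = prob (A (i, True)) * prob (A (i, False))" .
        qed
        also have "\<dots> = (\<Prod>i\<in>?J. \<Prod>b\<in>UNIV. prob (A (i, b)))"
          by (simp add: UNIV_bool mult.commute)
        also have "\<dots> = (\<Prod>k\<in>?J \<times> UNIV. prob (A k))"
          by (simp add: prod.cartesian_product)
        finally show "prob (\<Inter>k\<in>?J \<times> UNIV. A k) = (\<Prod>k\<in>?J \<times> UNIV. prob (A k))" .
      qed
    qed
    then show "indep_sets ?F J" using J'(4) by (rule indep_sets_mono_index[rotated])
  qed
qed

text \<open>
  Each node \<open>i\<close> splits into the independent parts \<open>(Q, N)\<close> (marked \<open>True\<close>) and \<open>C\<close> (marked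
  \<open>False\<close>). Grouping the first part of \<open>i\<close> with the second parts of its children gives disjoint
  blocks, hence the i.i.d. generic vectors of a weighted branching process.
\<close>

definition family :: "nat list \<Rightarrow> nat \<Rightarrow> nat list \<times> bool" where
  "family i r = (if r = 0 then (i, True) else (i @ [r], False))"

definition regroup :: "(nat \<Rightarrow> wbt_vector) \<Rightarrow> wbp_vector" where
  "regroup z = (fst (z 0), enat (fst (snd (z 0))), \<lambda>r\<in>{1..}. snd (snd (z r)))"

lemma regroup_part:
  "regroup (\<lambda>r. part (family i r) \<omega>) = (Q i \<omega>, enat (K i \<omega>), \<lambda>r\<in>{1..}. C (i @ [r]) \<omega>)"
  by (auto simp: regroup_def part_def family_def select_def)

lemma regroup_measurable:
  assumes "\<And>r. (\<lambda>x. g x r) \<in> measurable N wbt_space"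
  shows "(\<lambda>x. regroup (g x)) \<in> measurable N wbp_space"
proof -
  note c = wbt_components[THEN measurable_compose[OF assms]]
  have "(\<lambda>x. enat (fst (snd (g x 0)))) \<in> measurable N (count_space UNIV)"
    by (rule measurable_compose[OF c(2)]) simp
  then show ?thesis
    unfolding regroup_def wbp_space_def using c(1,3) by (intro measurable_Pair measurable_restrict)
qed

definition regrouped :: "'a \<Rightarrow> wbp_vector" where
  "regrouped \<omega> = (Q [] \<omega>, enat (K [] \<omega>), \<lambda>r\<in>{1..}. C [r] \<omega>)"

definition regrouped_law :: "wbp_vector measure" where
  "regrouped_law = distr M wbp_space regrouped"

text \<open>The blocks are disjoint because \<open>(i, True)\<close> determines \<open>i\<close> and
  a child \<open>i @ [r]\<close> has only one parent; functions of disjoint blocks of independent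
  parts are independent.\<close>

lemma wbt_imp_wbp: "weighted_branching_process M regrouped_law Q (\<lambda>i \<omega>. enat (K i \<omega>)) C"
proof -
  let ?Y = "\<lambda>i \<omega>. (Q i \<omega>, enat (K i \<omega>), \<lambda>r\<in>{1..}. C (i @ [r]) \<omega>)"
  have sub: "range (family i) \<subseteq> nodes \<times> UNIV" if "i \<in> nodes" for i
    using that by (auto simp: family_def)
  have disj: "disjoint_family_on (\<lambda>i. range (family i)) nodes"
    by (auto simp: disjoint_family_on_def family_def split: if_splits)
  have inj: "inj (family i)" for i
    by (auto simp: inj_on_def family_def split: if_splits)
  have "indep_vars (\<lambda>_. wbp_space) (\<lambda>i \<omega>. regroup (\<lambda>r. (\<lambda>k\<in>range (family i). part k \<omega>) (family i r))) nodes"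
    by (rule indep_vars_compose2[OF indep_vars_restrict[OF indep_part sub disj], where Y = "\<lambda>i z. regroup (\<lambda>r. z (family i r))"])
       (auto intro!: regroup_measurable measurable_component_singleton)
  then have indep: "indep_vars (\<lambda>_. wbp_space) ?Y nodes"
    by (simp add: regroup_part)
  \<comment> \<open>The right-hand side does not mention \<open>i\<close>: a block is a product of
    one part \<open>(Q, N)\<close> and infinitely many parts \<open>C\<close>, whatever the
    node.\<close>
  have same_law: "distr M wbp_space (?Y i) = distr (PiM UNIV (\<lambda>r. distr H wbt_space (select (r = 0)))) wbp_space regroup"
    if i: "i \<in> nodes" for i
  proof -
    have rv: "part (family i r) \<in> measurable M wbt_space" for r
      using i by (intro part_measurable) (auto simp: family_def)
    have "indep_vars (\<lambda>_. wbt_space) (\<lambda>r. part (family i r)) UNIV"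
      using indep_vars_reindex[OF indep_part inj sub[OF i]] .
    then have "distr M (PiM UNIV (\<lambda>_. wbt_space)) (\<lambda>\<omega>. \<lambda>r\<in>UNIV. part (family i r) \<omega>) =
        PiM UNIV (\<lambda>r. distr M wbt_space (part (family i r)))"
      using indep_vars_iff_distr_eq_PiM'[of UNIV "\<lambda>r. part (family i r)" "\<lambda>_. wbt_space"] rv by blast
    also have "\<dots> = PiM UNIV (\<lambda>r. distr H wbt_space (select (r = 0)))"
      using i by (intro PiM_cong refl) (subst distr_part, auto simp: family_def)
    finally have law: "distr M (PiM UNIV (\<lambda>_. wbt_space)) (\<lambda>\<omega> r. part (family i r) \<omega>) =
        PiM UNIV (\<lambda>r. distr H wbt_space (select (r = 0)))"
      unfolding restrict_UNIV .
    have rm: "regroup \<in> measurable (PiM UNIV (\<lambda>_. wbt_space)) wbp_space"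
      by (rule regroup_measurable) (rule measurable_component_singleton, simp)
    have pm: "(\<lambda>\<omega> r. part (family i r) \<omega>) \<in> measurable M (PiM UNIV (\<lambda>_. wbt_space))"
      by (rule measurable_PiM_single') (use rv in auto)
    show ?thesis
      unfolding law[symmetric] distr_distr[OF rm pm] by (simp add: comp_def regroup_part)
  qed
  have "regrouped_law = distr M wbp_space (?Y [])"
    by (simp add: regrouped_law_def regrouped_def[abs_def])
  then have law: "distr M wbp_space (?Y i) = regrouped_law" if "i \<in> nodes" for i
    using trans[OF same_law[OF that] same_law[OF nodes_simps(1), symmetric]] by simp
  show ?thesis
    unfolding weighted_branching_process_def Let_def
    using prob_space_axioms indep law by auto
qed

lemma regrouped_measurable:
  "regrouped \<in> measurable M wbp_space"
proof -
  have "(\<lambda>\<omega>. regroup (\<lambda>r. part (family [] r) \<omega>)) \<in> measurable M wbp_space"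
    by (intro regroup_measurable part_measurable) (auto simp: family_def)
  then show ?thesis by (simp add: regroup_part regrouped_def[abs_def])
qed

lemma wbp_label_regrouped:
  "wbp_label (regrouped \<omega>) k = (if k = 0 then Q [] \<omega> else if k \<le> K [] \<omega> then C [k] \<omega> else 0)"
  by (simp add: wbp_label_def regrouped_def)

text \<open>The two parts are independent even when \<open>i = j\<close>, so the result is the same
  for a node's own weight as for the weight of a child.\<close>

lemma nn_integral_offspring_weight:
  assumes i: "i \<in> nodes" and j: "j \<in> nodes"
  shows "(\<integral>\<^sup>+ \<omega>. (if r \<le> K i \<omega> then ennreal \<bar>C j \<omega>\<bar> else 0) \<partial>M) =
    (\<integral>\<^sup>+ \<omega>. (if r \<le> K i \<omega> then 1 else 0) \<partial>M) * (\<integral>\<^sup>+ x. ennreal \<bar>snd (snd x)\<bar> \<partial>H)"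
proof -
  note D = weighted_branching_treeD[OF wbt]
  define g where "g b x = (if b then (if r \<le> fst (snd x) then 1 else 0) else ennreal \<bar>snd (snd x)\<bar>)" for b and x :: wbt_vector
  have g: "g b \<in> borel_measurable wbt_space" for b
    unfolding g_def by (cases b) simp_all
  let ?I = "{(i, True), (j, False)}"
  have "indep_vars (\<lambda>_. wbt_space) part ?I"
    by (rule indep_vars_subset[OF indep_part]) (use i j in auto)
  from indep_vars_compose2[OF this g, of snd]
  have indep: "indep_vars (\<lambda>_. borel) (\<lambda>k \<omega>. g (snd k) (part k \<omega>)) ?I" .
  have "(\<integral>\<^sup>+ \<omega>. (if r \<le> K i \<omega> then ennreal \<bar>C j \<omega>\<bar> else 0) \<partial>M) = (\<integral>\<^sup>+ \<omega>. (\<Prod>k\<in>?I. g (snd k) (part k \<omega>)) \<partial>M)"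
    by (intro nn_integral_cong) (simp add: g_def part_def select_def)
  also have "\<dots> = (\<Prod>k\<in>?I. \<integral>\<^sup>+ \<omega>. g (snd k) (part k \<omega>) \<partial>M)"
    by (rule indep_vars_nn_integral[OF _ indep]) auto
  also have "\<dots> = (\<integral>\<^sup>+ \<omega>. (if r \<le> K i \<omega> then 1 else 0) \<partial>M) * (\<integral>\<^sup>+ \<omega>. ennreal \<bar>C j \<omega>\<bar> \<partial>M)"
    by (simp add: g_def part_def select_def)
  also have "(\<integral>\<^sup>+ \<omega>. ennreal \<bar>C j \<omega>\<bar> \<partial>M) = (\<integral>\<^sup>+ x. ennreal \<bar>snd (snd x)\<bar> \<partial>H)"
    unfolding D(3)[OF j, symmetric] by (subst nn_integral_distr[OF D(4)[OF j]]) simp_all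
  finally show ?thesis .
qed

lemma regrouped_moments:
  assumes "finite_first_moment l1_vec (wbt_nu H)" "finite_first_moment l1_seq (wbt_mu H)"
  shows "label_mean (wbp_mu regrouped_law) = label_mean (wbt_mu H)" "finite_first_moment l1_seq (wbp_mu regrouped_law)"
proof -
  note D = weighted_branching_treeD[OF wbt]
  let ?X = "\<lambda>i \<omega>. (Q i \<omega>, K i \<omega>, C i \<omega>)"
  have mu: "wbp_mu regrouped_law = distr M seq_space (\<lambda>\<omega>. wbp_label (regrouped \<omega>))"
    unfolding regrouped_law_def wbp_mu_eq by (subst distr_distr[OF wbp_label_measurable regrouped_measurable]) (simp add: comp_def)
  have mu': "wbt_mu H = distr M seq_space (\<lambda>\<omega>. wbt_label (?X [] \<omega>))"
    unfolding wbt_mu_eq D(3)[OF nodes_simps(1), symmetric]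
    by (subst distr_distr[OF wbt_label_measurable D(4)]) (simp_all add: comp_def)
  have m: "(\<lambda>\<omega>. wbp_label (regrouped \<omega>)) \<in> measurable M seq_space" "(\<lambda>\<omega>. wbt_label (?X [] \<omega>)) \<in> measurable M seq_space"
    by (rule measurable_compose[OF regrouped_measurable wbp_label_measurable] measurable_compose[OF D(4)[OF nodes_simps(1)] wbt_label_measurable])+
  have c: "(\<lambda>\<omega>. f \<omega> k) \<in> borel_measurable M" if "f \<in> measurable M seq_space" for f :: "'a \<Rightarrow> nat \<Rightarrow> real" and k
    using that by measurable
  have "label_mean (wbp_mu regrouped_law) = (\<Sum>r. \<integral>\<^sup>+ \<omega>. ennreal \<bar>wbp_label (regrouped \<omega>) (Suc r)\<bar> \<partial>M)"
    unfolding mu label_mean_distr[OF m(1)] using c[OF m(1)] by (simp add: nn_integral_suminf)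
  also have "\<dots> = (\<Sum>r. \<integral>\<^sup>+ \<omega>. (if Suc r \<le> K [] \<omega> then ennreal \<bar>C [Suc r] \<omega>\<bar> else 0) \<partial>M)"
    by (intro arg_cong[where f = suminf] ext nn_integral_cong) (simp add: wbp_label_regrouped)
  \<comment> \<open>The weight of a child is exchanged for the weight of the root itself; both
    integrals factorise into the same product.\<close>
  also have "\<dots> = (\<Sum>r. \<integral>\<^sup>+ \<omega>. (if Suc r \<le> K [] \<omega> then ennreal \<bar>C [] \<omega>\<bar> else 0) \<partial>M)"
    by (intro arg_cong[where f = suminf] ext) (simp add: nn_integral_offspring_weight)
  also have "\<dots> = (\<Sum>r. \<integral>\<^sup>+ \<omega>. ennreal \<bar>wbt_label (?X [] \<omega>) (Suc r)\<bar> \<partial>M)"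
    by (intro arg_cong[where f = suminf] ext nn_integral_cong) (simp add: wbt_label_def)
  also have "\<dots> = label_mean (wbt_mu H)"
    unfolding mu' label_mean_distr[OF m(2)] using c[OF m(2)] by (simp add: nn_integral_suminf)
  finally show eq: "label_mean (wbp_mu regrouped_law) = label_mean (wbt_mu H)" .
  have sets: "sets (wbp_mu regrouped_law) = sets seq_space" by (simp add: mu)
  \<comment> \<open>Coordinate 0 is now \<open>Q\<close> instead of \<open>C Q\<close>, so its first
    moment has to come from the law of \<open>(Q, N)\<close>.\<close>
  have "(\<integral>\<^sup>+ u. ennreal \<bar>u 0\<bar> \<partial>wbp_mu regrouped_law) = (\<integral>\<^sup>+ \<omega>. ennreal \<bar>Q [] \<omega>\<bar> \<partial>M)"
    unfolding mu by (subst nn_integral_distr[OF m(1)]) (simp_all add: wbp_label_regrouped)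
  also have "\<dots> = (\<integral>\<^sup>+ u. ennreal \<bar>u 0\<bar> \<partial>wbt_root H)"
  proof -
    have r: "(\<lambda>(q, m, c). root_label (q, real m)) \<in> measurable H seq_space"
      by (rule measurable_from_sets_eq[OF D(5) wbt_root_label_measurable])
    have "(\<integral>\<^sup>+ u. ennreal \<bar>u 0\<bar> \<partial>wbt_root H) = (\<integral>\<^sup>+ x. ennreal \<bar>fst x\<bar> \<partial>H)"
      unfolding wbt_root_def by (subst nn_integral_distr[OF r]) (simp_all add: split_def root_label_def)
    also have "\<dots> = (\<integral>\<^sup>+ \<omega>. ennreal \<bar>Q [] \<omega>\<bar> \<partial>M)"
      unfolding D(3)[OF nodes_simps(1), symmetric] by (subst nn_integral_distr[OF D(4)]) simp_all
    finally show ?thesis by simp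
  qed
  also have "\<dots> < \<infinity>"
    by (rule seq_probD(6)[OF seq_prob_wbt_root[OF D(5,6) assms(1)]])
  finally show "finite_first_moment l1_seq (wbp_mu regrouped_law)"
    using seq_probD(5)[OF seq_prob_wbt_mu[OF wbt assms(2)]] eq
    unfolding finite_first_moment_def
    by (subst nn_integral_l1_seq[of "\<lambda>u. u", OF borel_measurable_component[OF sets]]) simp
qed

lemma regrouped_label_AE:
  assumes AE: "AE (q, m, c) in H. q = 1 \<and> c \<ge> 0"
  shows "AE u in wbp_mu regrouped_law. u 0 = 1 \<and> (\<forall>r. u (Suc r) \<ge> 0)"
proof -
  note D = weighted_branching_treeD[OF wbt]
  have "AE \<omega> in M. \<forall>i\<in>nodes. Q i \<omega> = 1 \<and> C i \<omega> \<ge> 0"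
  proof (rule AE_ball_countable[THEN iffD2, OF countable_nodes], rule ballI)
    fix i :: "nat list" assume i: "i \<in> nodes"
    have "AE x in distr M wbt_space (\<lambda>\<omega>. (Q i \<omega>, K i \<omega>, C i \<omega>)). fst x = 1 \<and> snd (snd x) \<ge> 0"
      unfolding D(3)[OF i] using AE by (simp add: split_def)
    from AE_distrD[OF D(4)[OF i] this] show "AE \<omega> in M. Q i \<omega> = 1 \<and> C i \<omega> \<ge> 0" by simp
  qed
  then have *: "AE \<omega> in M. wbp_label (regrouped \<omega>) 0 = 1 \<and>
      (\<forall>r. wbp_label (regrouped \<omega>) (Suc r) \<ge> 0)"
    by eventually_elim (auto simp: wbp_label_regrouped)
  have m: "(\<lambda>\<omega>. wbp_label (regrouped \<omega>)) \<in> measurable M seq_space"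
    by (rule measurable_compose[OF regrouped_measurable wbp_label_measurable])
  have S: "{u \<in> space seq_space. u 0 = 1 \<and> (\<forall>r. u (Suc r) \<ge> (0::real))} \<in> sets seq_space"
    by measurable
  have mu: "wbp_mu regrouped_law = distr M seq_space (\<lambda>\<omega>. wbp_label (regrouped \<omega>))"
    unfolding regrouped_law_def wbp_mu_eq by (subst distr_distr[OF wbp_label_measurable regrouped_measurable]) (simp add: comp_def)
  show ?thesis unfolding mu AE_distr_iff[OF m S] by (rule *)
qed

end

section \<open>Convergence of weighted branching processes and trees\<close>

lemma sum_law_first_moment:
  assumes "seq_prob \<nu>0" "seq_prob \<nu>"
  shows "finite_first_moment l1_vec (sum_law j \<nu>0 \<nu>)"
proof -
  note D = seq_probD[OF assms(1)] seq_probD[OF assms(2)]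
  interpret labelled_tree \<nu>0 \<nu> using D by (intro labelled_tree_seq)
  have "(\<integral>\<^sup>+ y. l1_vec y \<partial>sum_law j \<nu>0 \<nu>) \<le> (\<integral>\<^sup>+ v. abs_total v [] j \<partial>tree_law \<nu>0 \<nu>)"
    using D by (intro nn_integral_sum_law_le)
  also have "\<dots> < \<infinity>"
    using nn_integral_abs_total_finite[OF measurable_ident_sets[OF D(8)] D(3,9)] by simp
  finally show ?thesis by (simp add: finite_first_moment_def)
qed

text \<open>Almost sure convergence persists along \<open>j n\<close>, and dominated convergence
  turns it into the hypothesis \<open>conv\<close> of
  \<open>sum_law_normalised_weak_conv\<close>.\<close>

lemma normalised_integral_tendsto:
  fixes Y :: "nat \<Rightarrow> 'a \<Rightarrow> real" and f :: "real \<Rightarrow> real"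
  assumes "prob_space M" and Y: "\<And>j. Y j \<in> borel_measurable M" "\<And>j. distr M borel (Y j) = \<Lambda> j"
    and L: "L \<in> borel_measurable M" "AE \<omega> in M. (\<lambda>j. Y j \<omega> / \<rho> ^ j) \<longlonglongrightarrow> L \<omega>"
    and j: "filterlim j at_top sequentially"
    and f: "continuous_on UNIV f" "\<And>x. \<bar>f x\<bar> \<le> 1"
  shows "(\<lambda>n. \<integral>y. f (y / \<rho> ^ j n) \<partial>\<Lambda> (j n)) \<longlonglongrightarrow> (\<integral>y. f y \<partial>distr M borel L)"
proof -
  interpret prob_space M by fact
  have [measurable]: "f \<in> borel_measurable borel" using f(1) by (rule borel_measurable_continuous_onI)
  note [measurable] = Y(1) L(1)
  have "(\<lambda>n. \<integral>\<omega>. f (Y (j n) \<omega> / \<rho> ^ j n) \<partial>M) \<longlonglongrightarrow> (\<integral>\<omega>. f (L \<omega>) \<partial>M)"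
  proof (rule integral_dominated_convergence[where w = "\<lambda>_. 1"])
    show "AE \<omega> in M. (\<lambda>n. f (Y (j n) \<omega> / \<rho> ^ j n)) \<longlonglongrightarrow> f (L \<omega>)"
      using L(2)
    proof eventually_elim
      case (elim \<omega>)
      have "(\<lambda>n. Y (j n) \<omega> / \<rho> ^ j n) \<longlonglongrightarrow> L \<omega>"
        by (rule filterlim_compose[OF elim j])
      then show ?case
        using f(1) by (intro isCont_tendsto_compose[where g = f]) (simp_all add: continuous_on_eq_continuous_at)
    qed
  qed (use f in auto)
  then show ?thesis
    by (simp add: Y(2)[symmetric] integral_distr)
qed

lemma distr_divide:
  fixes f :: "'a \<Rightarrow> real"
  assumes "f \<in> borel_measurable M"
  shows "distr M borel (\<lambda>\<omega>. f \<omega> / a) = distr (distr M borel f) borel (\<lambda>y. y / a)"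
  using assms by (simp add: distr_distr comp_def)

lemma tendsto_0_add_ennrealD:
  fixes a b :: "nat \<Rightarrow> ennreal"
  assumes "(\<lambda>n. a n + b n) \<longlonglongrightarrow> 0"
  shows "a \<longlonglongrightarrow> 0" "b \<longlonglongrightarrow> 0"
proof -
  show "a \<longlonglongrightarrow> 0"
    by (rule tendsto_sandwich[OF _ _ tendsto_const assms]) (simp_all add: add_increasing2)
  show "b \<longlonglongrightarrow> 0"
    by (rule tendsto_sandwich[OF _ _ tendsto_const assms]) (simp_all add: add_increasing)
qed

context
  fixes \<Omega>n :: "nat \<Rightarrow> 'a measure" and \<Omega> :: "'b measure" and Gn G Qn Q Nn N Cn C
  assumes wbpn: "\<And>n. weighted_branching_process (\<Omega>n n) (Gn n) (Qn n) (Nn n) (Cn n)"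
    and wbp: "weighted_branching_process \<Omega> G Q N C"
    and finn: "\<And>n. finite_first_moment l1_seq (wbp_mu (Gn n))" and fin: "finite_first_moment l1_seq (wbp_mu G)"
    and lim: "(\<lambda>n. d1 l1_seq (wbp_mu (Gn n)) (wbp_mu G)) \<longlonglongrightarrow> 0"
begin

private lemmas \<mu>n = seq_prob_wbp_mu[OF wbpn finn] and \<mu> = seq_prob_wbp_mu[OF wbp fin]

lemma wbp_convergence_moment:
  shows "finite_first_moment l1_vec (distr (\<Omega>n n) borel (W (Qn n) (Nn n) (Cn n) j))"
    and "finite_first_moment l1_vec (distr \<Omega> borel (W Q N C j))"
proof -
  show "finite_first_moment l1_vec (distr (\<Omega>n n) borel (W (Qn n) (Nn n) (Cn n) j))"
    unfolding wbp_law(1)[OF wbpn] by (rule sum_law_first_moment[OF \<mu>n \<mu>n])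
  show "finite_first_moment l1_vec (distr \<Omega> borel (W Q N C j))"
    unfolding wbp_law(1)[OF wbp] by (rule sum_law_first_moment[OF \<mu> \<mu>])
qed

lemma wbp_convergence_d1:
  "(\<lambda>n. d1 l1_vec (distr (\<Omega>n n) borel (W (Qn n) (Nn n) (Cn n) j)) (distr \<Omega> borel (W Q N C j))) \<longlonglongrightarrow> 0"
  unfolding wbp_law(1)[OF wbpn] wbp_law(1)[OF wbp] by (rule sum_law_tendsto[OF \<mu>n \<mu>n \<mu> \<mu> lim lim])

text \<open>The limit lives on the space of the limiting process and is chosen before
  \<open>jn\<close>, so one variable serves all sequences.\<close>

lemma wbp_convergence_normalised:
  assumes pos: "wbp_rho G > 0" and label: "AE (q, m, c) in G. q = 1 \<and> (\<forall>r\<ge>1. c r \<ge> 0)"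
  shows "\<exists>\<W>\<in>borel_measurable \<Omega>. (AE \<omega> in \<Omega>. (\<lambda>j. W Q N C j \<omega> / wbp_rho G ^ j) \<longlonglongrightarrow> \<W> \<omega>) \<and>
        (\<forall>jn::nat \<Rightarrow> nat. filterlim jn at_top sequentially \<and>
          (\<lambda>n. of_nat (jn n) * d1 l1_seq (wbp_mu (Gn n)) (wbp_mu G)) \<longlonglongrightarrow> 0 \<longrightarrow>
          weak_conv_m (\<lambda>n. distr (\<Omega>n n) borel (\<lambda>\<omega>. W (Qn n) (Nn n) (Cn n) (jn n) \<omega> / wbp_rho (Gn n) ^ jn n))
            (distr \<Omega> borel \<W>) \<and>
          weak_conv_m (\<lambda>n. distr (\<Omega>n n) borel (\<lambda>\<omega>. W (Qn n) (Nn n) (Cn n) (jn n) \<omega> / wbp_rho G ^ jn n))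
            (distr \<Omega> borel \<W>))"
proof -
  have \<rho>: "wbp_rho G = enn2real (label_mean (wbp_mu G))"
    by (rule wbp_rho_eq[OF sets_wbp_law(1)[OF wbp] seq_probD(5)[OF \<mu>]])
  have \<rho>n: "wbp_rho (Gn n) = enn2real (label_mean (wbp_mu (Gn n)))" for n
    by (rule wbp_rho_eq[OF sets_wbp_law(1)[OF wbpn] seq_probD(5)[OF \<mu>n]])
  obtain L where L: "L \<in> borel_measurable \<Omega>" "AE \<omega> in \<Omega>. (\<lambda>j. W Q N C j \<omega> / wbp_rho G ^ j) \<longlonglongrightarrow> L \<omega>"
    using wbp_martingale_limit[OF wbp fin \<rho> pos wbp_label_AE[OF sets_wbp_law(1)[OF wbp] label]] .
  interpret prob_space \<Omega> by (rule wbp_law(3)[OF wbp])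
  show ?thesis
  proof (intro bexI[OF _ L(1)] conjI[OF L(2)] allI impI, elim conjE, goal_cases)
    case jn: (1 jn)
    have D: "real_distribution (distr \<Omega> borel L)" by (rule real_distribution_distr[OF L(1)])
    note conv = normalised_integral_tendsto[OF prob_space_axioms wbp_law(2)[OF wbp] wbp_law(1)[OF wbp] L jn(1)]
    show ?case
      unfolding distr_divide[OF wbp_law(2)[OF wbpn]] wbp_law(1)[OF wbpn] \<rho>n
      using sum_law_normalised_weak_conv[OF \<mu>n \<mu>n \<mu> \<mu> lim lim jn(2) \<rho> pos jn(1) D conv] by (rule conjI)
  qed
qed

end

context
  fixes \<Omega>n :: "nat \<Rightarrow> 'a measure" and \<Omega> :: "'b measure" and Hn H Qn Q Kn K Cn C
  assumes wbtn: "\<And>n. weighted_branching_tree (\<Omega>n n) (Hn n) (Qn n) (Kn n) (Cn n)"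
    and wbt: "weighted_branching_tree \<Omega> H Q K C" and ind: "wbt_weight_indep H"
    and finn: "\<And>n. finite_first_moment l1_seq (wbt_mu (Hn n))" "\<And>n. finite_first_moment l1_vec (wbt_nu (Hn n))"
    and fin: "finite_first_moment l1_seq (wbt_mu H)" "finite_first_moment l1_vec (wbt_nu H)"
    and lim: "(\<lambda>n. d1 l1_vec (wbt_nu (Hn n)) (wbt_nu H)) \<longlonglongrightarrow> 0" "(\<lambda>n. d1 l1_seq (wbt_mu (Hn n)) (wbt_mu H)) \<longlonglongrightarrow> 0"
begin

private lemmas Hn = weighted_branching_treeD(5,6)[OF wbtn] and H = weighted_branching_treeD(5,6)[OF wbt]
private lemmas \<kappa>n = seq_prob_wbt_mu[OF wbtn finn(1)] and \<kappa> = seq_prob_wbt_mu[OF wbt fin(1)]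
private lemmas \<nu>n = seq_prob_wbt_root[OF Hn finn(2)] and \<nu> = seq_prob_wbt_root[OF H fin(2)]

lemma wbt_root_tendsto: "(\<lambda>n. d1 l1_seq (wbt_root (Hn n)) (wbt_root H)) \<longlonglongrightarrow> 0"
  by (rule tendsto_sandwich[OF _ _ tendsto_const lim(1)]) (simp_all add: d1_wbt_root_le[OF Hn H])

lemma wbt_convergence_moment:
  shows "finite_first_moment l1_vec (distr (\<Omega>n n) borel (W_tree (Qn n) (Kn n) (Cn n) j))"
    and "finite_first_moment l1_vec (distr \<Omega> borel (W_tree Q K C j))"
proof -
  show "finite_first_moment l1_vec (distr (\<Omega>n n) borel (W_tree (Qn n) (Kn n) (Cn n) j))"
    unfolding wbt_law(1)[OF wbtn] by (rule sum_law_first_moment[OF \<nu>n \<kappa>n])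
  show "finite_first_moment l1_vec (distr \<Omega> borel (W_tree Q K C j))"
    unfolding wbt_law(1)[OF wbt] by (rule sum_law_first_moment[OF \<nu> \<kappa>])
qed

lemma wbt_convergence_d1:
  "(\<lambda>n. d1 l1_vec (distr (\<Omega>n n) borel (W_tree (Qn n) (Kn n) (Cn n) j)) (distr \<Omega> borel (W_tree Q K C j))) \<longlonglongrightarrow> 0"
  unfolding wbt_law(1)[OF wbtn] wbt_law(1)[OF wbt] by (rule sum_law_tendsto[OF \<nu>n \<kappa>n \<nu> \<kappa> wbt_root_tendsto lim(2)])

text \<open>Two labellings of the limiting tree are combined: the regrouped one yields the almost
  sure limit, the one with exceptional root the comparison with the approximating trees. Both
  compute the same \<open>W\<close>.\<close>

lemma wbt_convergence_normalised:
  assumes pos: "wbt_rho H > 0" and label: "AE (q, m, c) in H. q = 1 \<and> c \<ge> 0"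
  shows "\<exists>\<W>\<in>borel_measurable \<Omega>. (AE \<omega> in \<Omega>. (\<lambda>j. W_tree Q K C j \<omega> / wbt_rho H ^ j) \<longlonglongrightarrow> \<W> \<omega>) \<and>
        (\<forall>jn::nat \<Rightarrow> nat. filterlim jn at_top sequentially \<and>
          (\<lambda>n. d1 l1_vec (wbt_nu (Hn n)) (wbt_nu H) + of_nat (jn n) * d1 l1_seq (wbt_mu (Hn n)) (wbt_mu H)) \<longlonglongrightarrow> 0 \<longrightarrow>
          weak_conv_m (\<lambda>n. distr (\<Omega>n n) borel (\<lambda>\<omega>. W_tree (Qn n) (Kn n) (Cn n) (jn n) \<omega> / wbt_rho (Hn n) ^ jn n))
            (distr \<Omega> borel \<W>) \<and>
          weak_conv_m (\<lambda>n. distr (\<Omega>n n) borel (\<lambda>\<omega>. W_tree (Qn n) (Kn n) (Cn n) (jn n) \<omega> / wbt_rho H ^ jn n))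
            (distr \<Omega> borel \<W>))"
proof -
  have \<rho>: "wbt_rho H = enn2real (label_mean (wbt_mu H))"
    by (rule wbt_rho_eq[OF H(1) seq_probD(5)[OF \<kappa>]])
  have \<rho>n: "wbt_rho (Hn n) = enn2real (label_mean (wbt_mu (Hn n)))" for n
    by (rule wbt_rho_eq[OF Hn(1) seq_probD(5)[OF \<kappa>n]])
  note regrouped = regrouped_moments[OF wbt ind fin(2,1)]
  \<comment> \<open>The martingale is normalised by the mean of the regrouped process, which equals
    that of the tree.\<close>
  note \<rho>' = trans[OF \<rho> arg_cong[where f = enn2real, OF regrouped(1)[symmetric]]]
  obtain L where L: "L \<in> borel_measurable \<Omega>" "AE \<omega> in \<Omega>. (\<lambda>j. W_tree Q K C j \<omega> / wbt_rho H ^ j) \<longlonglongrightarrow> L \<omega>"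
    using wbp_martingale_limit[OF wbt_imp_wbp[OF wbt ind] regrouped(2) \<rho>' pos regrouped_label_AE[OF wbt ind label]] .
  interpret prob_space \<Omega> by (rule wbt_law(3)[OF wbt])
  show ?thesis
  proof (intro bexI[OF _ L(1)] conjI[OF L(2)] allI impI, elim conjE, goal_cases)
    case jn: (1 jn)
    have D: "real_distribution (distr \<Omega> borel L)" by (rule real_distribution_distr[OF L(1)])
    note conv = normalised_integral_tendsto[OF prob_space_axioms wbt_law(2)[OF wbt] wbt_law(1)[OF wbt] L jn(1)]
    show ?case
      unfolding distr_divide[OF wbt_law(2)[OF wbtn]] wbt_law(1)[OF wbtn] \<rho>n
      using sum_law_normalised_weak_conv[OF \<nu>n \<kappa>n \<nu> \<kappa> wbt_root_tendsto lim(2) tendsto_0_add_ennrealD(2)[OF jn(2)] \<rho> pos jn(1) D conv]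
      by (rule conjI)
  qed
qed

end

theorem theorem4p3:
  fixes \<Omega>n :: "nat \<Rightarrow> 'a measure" and \<Omega> :: "'b measure"
    and Qn Cn :: "nat \<Rightarrow> nat list \<Rightarrow> 'a \<Rightarrow> real" and Q C :: "nat list \<Rightarrow> 'b \<Rightarrow> real"
    \<comment> \<open>Case 1: laws of the generic vectors, offspring numbers\<close>
    and Gn :: "nat \<Rightarrow> wbp_vector measure" and G :: "wbp_vector measure"
    and Nn :: "nat \<Rightarrow> nat list \<Rightarrow> 'a \<Rightarrow> enat" and N :: "nat list \<Rightarrow> 'b \<Rightarrow> enat"
    \<comment> \<open>Case 2: laws of the generic vectors, offspring numbers\<close>
    and Hn :: "nat \<Rightarrow> wbt_vector measure" and H :: "wbt_vector measure"
    and Kn :: "nat \<Rightarrow> nat list \<Rightarrow> 'a \<Rightarrow> nat" and K :: "nat list \<Rightarrow> 'b \<Rightarrow> nat"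
  shows
    "((\<forall>n. weighted_branching_process (\<Omega>n n) (Gn n) (Qn n) (Nn n) (Cn n)) \<and>
      weighted_branching_process \<Omega> G Q N C \<and>
      (\<forall>n. finite_first_moment l1_seq (wbp_mu (Gn n))) \<and>
      finite_first_moment l1_seq (wbp_mu G) \<and>
      (\<lambda>n. d1 l1_seq (wbp_mu (Gn n)) (wbp_mu G)) \<longlonglongrightarrow> 0
      \<longrightarrow>
      (\<forall>j. (\<forall>n. finite_first_moment l1_vec (distr (\<Omega>n n) borel (W (Qn n) (Nn n) (Cn n) j))) \<and>
           finite_first_moment l1_vec (distr \<Omega> borel (W Q N C j)) \<and>
           (\<lambda>n. d1 l1_vec (distr (\<Omega>n n) borel (W (Qn n) (Nn n) (Cn n) j))
                          (distr \<Omega> borel (W Q N C j))) \<longlonglongrightarrow> 0) \<and>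
      (wbp_rho G > 0 \<and>
       (\<forall>n. AE (q, m, c) in Gn n. q = 1 \<and> (\<forall>r\<ge>1. c r \<ge> 0)) \<and>
       (AE (q, m, c) in G. q = 1 \<and> (\<forall>r\<ge>1. c r \<ge> 0))
       \<longrightarrow>
       (\<exists>\<W>\<in>borel_measurable \<Omega>.
          (AE \<omega> in \<Omega>. (\<lambda>j. W Q N C j \<omega> / wbp_rho G ^ j) \<longlonglongrightarrow> \<W> \<omega>) \<and>
          (\<forall>jn::nat \<Rightarrow> nat.
             filterlim jn at_top sequentially \<and>
             (\<lambda>n. of_nat (jn n) * d1 l1_seq (wbp_mu (Gn n)) (wbp_mu G)) \<longlonglongrightarrow> 0
             \<longrightarrow>
             weak_conv_m
               (\<lambda>n. distr (\<Omega>n n) borel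
                      (\<lambda>\<omega>. W (Qn n) (Nn n) (Cn n) (jn n) \<omega> / wbp_rho (Gn n) ^ jn n))
               (distr \<Omega> borel \<W>) \<and>
             weak_conv_m
               (\<lambda>n. distr (\<Omega>n n) borel
                      (\<lambda>\<omega>. W (Qn n) (Nn n) (Cn n) (jn n) \<omega> / wbp_rho G ^ jn n))
               (distr \<Omega> borel \<W>)))))
     \<and>
     ((\<forall>n. weighted_branching_tree (\<Omega>n n) (Hn n) (Qn n) (Kn n) (Cn n)) \<and>
      weighted_branching_tree \<Omega> H Q K C \<and>
      wbt_weight_indep H \<and>
      (\<forall>n. finite_first_moment l1_seq (wbt_mu (Hn n)) \<and>
           finite_first_moment l1_vec (wbt_nu (Hn n))) \<and>
      finite_first_moment l1_seq (wbt_mu H) \<and>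
      finite_first_moment l1_vec (wbt_nu H) \<and>
      (\<lambda>n. d1 l1_vec (wbt_nu (Hn n)) (wbt_nu H) + d1 l1_seq (wbt_mu (Hn n)) (wbt_mu H)) \<longlonglongrightarrow> 0
      \<longrightarrow>
      (\<forall>j. (\<forall>n. finite_first_moment l1_vec
                  (distr (\<Omega>n n) borel (W_tree (Qn n) (Kn n) (Cn n) j))) \<and>
           finite_first_moment l1_vec (distr \<Omega> borel (W_tree Q K C j)) \<and>
           (\<lambda>n. d1 l1_vec (distr (\<Omega>n n) borel (W_tree (Qn n) (Kn n) (Cn n) j))
                          (distr \<Omega> borel (W_tree Q K C j))) \<longlonglongrightarrow> 0) \<and>
      (wbt_rho H > 0 \<and>
       (\<forall>n. AE (q, m, c) in Hn n. q = 1 \<and> c \<ge> 0) \<and>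
       (AE (q, m, c) in H. q = 1 \<and> c \<ge> 0)
       \<longrightarrow>
       (\<exists>\<W>\<in>borel_measurable \<Omega>.
          (AE \<omega> in \<Omega>. (\<lambda>j. W_tree Q K C j \<omega> / wbt_rho H ^ j) \<longlonglongrightarrow> \<W> \<omega>) \<and>
          (\<forall>jn::nat \<Rightarrow> nat.
             filterlim jn at_top sequentially \<and>
             (\<lambda>n. d1 l1_vec (wbt_nu (Hn n)) (wbt_nu H)
                  + of_nat (jn n) * d1 l1_seq (wbt_mu (Hn n)) (wbt_mu H)) \<longlonglongrightarrow> 0
             \<longrightarrow>
             weak_conv_m
               (\<lambda>n. distr (\<Omega>n n) borel
                      (\<lambda>\<omega>. W_tree (Qn n) (Kn n) (Cn n) (jn n) \<omega> / wbt_rho (Hn n) ^ jn n))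
               (distr \<Omega> borel \<W>) \<and>
             weak_conv_m
               (\<lambda>n. distr (\<Omega>n n) borel
                      (\<lambda>\<omega>. W_tree (Qn n) (Kn n) (Cn n) (jn n) \<omega> / wbt_rho H ^ jn n))
               (distr \<Omega> borel \<W>)))))"
proof ((rule conjI; rule impI; elim conjE), goal_cases)
  case 1
  note process = spec[OF 1(1)] 1(2) spec[OF 1(3)] 1(4,5)
  show ?case
    by (intro conjI allI impI wbp_convergence_moment[OF process] wbp_convergence_d1[OF process])
      (elim conjE, rule wbp_convergence_normalised[OF process])
next
  case 2
  note moments = spec[OF 2(4)]
  note tree = spec[OF 2(1)] 2(2,3) moments[THEN conjunct1] moments[THEN conjunct2] 2(5,6)
    tendsto_0_add_ennrealD[OF 2(7)]
  show ?case
    by (intro conjI allI impI wbt_convergence_moment[OF tree] wbt_convergence_d1[OF tree])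
      (elim conjE, rule wbt_convergence_normalised[OF tree])
qed

end
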